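(* Let $\mathscr{V}$ be a symmetric monoidal closed category. There is an equivalence of categories $$\mathrm{Th}_{\underline{\mathscr{V}}}\;\simeq\;\mathrm{Mnd}_{\mathscr{V}\text{-CAT}}(\underline{\mathscr{V}})$$ between the category $\mathrm{Th}_{\underline{\mathscr{V}}}$ of $\underline{\mathscr{V}}$-theories (i.e. $\mathscr{J}$-theories for the system of arities $\mathscr{J}=\underline{\mathscr{V}}$, $j=1_{\underline{\mathscr{V}}}$) and the category $\mathrm{Mnd}_{\mathscr{V}\text{-CAT}}(\underline{\mathscr{V}})$ of arbitrary $\mathscr{V}$-monads on $\underline{\mathscr{V}}$.
   Context: $\underline{\mathscr{V}}$ is $\mathscr{V}$ regarded as a $\mathscr{V}$-category; no completeness or cocompleteness of $\mathscr{V}$ is assumed. $\mathscr{V}$-categories may be large. A $\underline{\mathscr{V}}$-theory is a $\mathscr{V}$-category $\mathscr{T}$ equipped with an identity-on-objects $\mathscr{V}$-functor $\tau:\underline{\mathscr{V}}^{\mathrm{op}}\to\mathscr{T}$ (so $\mathrm{ob}\,\mathscr{T}=\mathrm{ob}\,\mathscr{V}$) that preserves cotensors $[V,C]$ by all objects $V$ of $\mathscr{V}$, where a cotensor $[V,C]$ in a $\mathscr{V}$-category $\mathscr{C}$ is characterized by $\mathscr{C}(D,[V,C])\cong\underline{\mathscr{V}}(V,\mathscr{C}(D,C))$, $\mathscr{V}$-naturally in $D$. A morphism $(\mathscr{T},\tau)\to(\mathscr{U},\upsilon)$ is a $\mathscr{V}$-functor $M:\mathscr{T}\to\mathscr{U}$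 with $M\circ\tau=\upsilon$. Morphisms of $\mathscr{V}$-monads on $\underline{\mathscr{V}}$ are $\mathscr{V}$-natural transformations compatible with units and multiplications. *)

theory Defs
  imports Main "HOL-Library.FuncSet"
begin

section \<open>Categories, functors and equivalences\<close>

record ('o, 'm) category =
  Obj :: "'o set"
  Arr :: "'m set"
  Dom :: "'m \<Rightarrow> 'o"
  Cod :: "'m \<Rightarrow> 'o"
  Id :: "'o \<Rightarrow> 'm"
  Comp :: "'m \<Rightarrow> 'm \<Rightarrow> 'm" (infixr "\<cdot>\<index>" 60)

definition Hom :: "('o, 'm, 'z) category_scheme \<Rightarrow> 'o \<Rightarrow> 'o \<Rightarrow> 'm set" where
  "Hom C A B = {f \<in> Arr C. Dom C f = A \<and> Cod C f = B}"

locale category =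
  fixes C (structure)
  assumes Dom_in: "f \<in> Arr C \<Longrightarrow> Dom C f \<in> Obj C"
    and Cod_in: "f \<in> Arr C \<Longrightarrow> Cod C f \<in> Obj C"
    and Id_in: "A \<in> Obj C \<Longrightarrow> Id C A \<in> Hom C A A"
    and Comp_in: "f \<in> Hom C A B \<Longrightarrow> g \<in> Hom C B D \<Longrightarrow> g \<cdot> f \<in> Hom C A D"
    and Comp_Id: "f \<in> Hom C A B \<Longrightarrow> f \<cdot> Id C A = f"
    and Id_Comp: "f \<in> Hom C A B \<Longrightarrow> Id C B \<cdot> f = f"
    and Comp_assoc: "f \<in> Hom C A B \<Longrightarrow> g \<in> Hom C B D \<Longrightarrow> h \<in> Hom C D E \<Longrightarrow>
      (h \<cdot> g) \<cdot> f = h \<cdot> (g \<cdot> f)"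

definition inverse_pair :: "('o, 'm, 'z) category_scheme \<Rightarrow> 'm \<Rightarrow> 'm \<Rightarrow> bool" where
  "inverse_pair C f g \<longleftrightarrow> f \<in> Arr C \<and> g \<in> Hom C (Cod C f) (Dom C f) \<and>
     Comp C g f = Id C (Dom C f) \<and> Comp C f g = Id C (Cod C f)"

definition iso :: "('o, 'm, 'z) category_scheme \<Rightarrow> 'm \<Rightarrow> bool" where
  "iso C f \<longleftrightarrow> (\<exists>g. inverse_pair C f g)"

definition Inv :: "('o, 'm, 'z) category_scheme \<Rightarrow> 'm \<Rightarrow> 'm" where
  "Inv C f = (THE g. inverse_pair C f g)"

record ('o, 'm, 'p, 'n) cat_functor =
  Map_ob :: "'o \<Rightarrow> 'p"
  Map_arr :: "'m \<Rightarrow> 'n"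

locale cat_functor =
  source: category C + target: category D
  for C :: "('o, 'm, 'y) category_scheme" and D :: "('p, 'n, 'z) category_scheme" +
  fixes F :: "('o, 'm, 'p, 'n) cat_functor"
  assumes Map_ob_in: "A \<in> Obj C \<Longrightarrow> Map_ob F A \<in> Obj D"
    and Map_arr_in: "f \<in> Hom C A B \<Longrightarrow> Map_arr F f \<in> Hom D (Map_ob F A) (Map_ob F B)"
    and Map_Id: "A \<in> Obj C \<Longrightarrow> Map_arr F (Id C A) = Id D (Map_ob F A)"
    and Map_Comp: "f \<in> Hom C A B \<Longrightarrow> g \<in> Hom C B E \<Longrightarrow>
      Map_arr F (Comp C g f) = Comp D (Map_arr F g) (Map_arr F f)"

definition id_functor :: "('o, 'm, 'o, 'm) cat_functor" where
  "id_functor = \<lparr>Map_ob = (\<lambda>A. A), Map_arr = (\<lambda>f. f)\<rparr>"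

definition comp_functor ::
    "('p, 'n, 'q, 'k) cat_functor \<Rightarrow> ('o, 'm, 'p, 'n) cat_functor \<Rightarrow> ('o, 'm, 'q, 'k) cat_functor" where
  "comp_functor G F = \<lparr>Map_ob = Map_ob G \<circ> Map_ob F, Map_arr = Map_arr G \<circ> Map_arr F\<rparr>"

locale natural_iso =
  F: cat_functor C D F + G: cat_functor C D G
  for C :: "('o, 'm, 'y) category_scheme" and D :: "('p, 'n, 'z) category_scheme" and F G +
  fixes t :: "'o \<Rightarrow> 'n"
  assumes component_in: "A \<in> Obj C \<Longrightarrow> t A \<in> Hom D (Map_ob F A) (Map_ob G A)"
    and component_iso: "A \<in> Obj C \<Longrightarrow> iso D (t A)"
    and naturality: "f \<in> Hom C A B \<Longrightarrow>
      Comp D (t B) (Map_arr F f) = Comp D (Map_arr G f) (t A)"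

definition equivalent_categories ::
    "('o, 'm, 'y) category_scheme \<Rightarrow> ('p, 'n, 'z) category_scheme \<Rightarrow> bool" where
  "equivalent_categories C D \<longleftrightarrow>
     (\<exists>F G \<eta> \<epsilon>. cat_functor C D F \<and> cat_functor D C G \<and>
        natural_iso C C id_functor (comp_functor G F) \<eta> \<and>
        natural_iso D D (comp_functor F G) id_functor \<epsilon>)"


section \<open>Symmetric monoidal closed categories\<close>

record ('o, 'm) smc_category = "('o, 'm) category" +
  Unit :: 'o
  Tensor :: "'o \<Rightarrow> 'o \<Rightarrow> 'o" (infixr "\<otimes>\<index>" 70)
  Tensor_arr :: "'m \<Rightarrow> 'm \<Rightarrow> 'm" (infixr "\<boxtimes>\<index>" 70)
  Assoc :: "'o \<Rightarrow> 'o \<Rightarrow> 'o \<Rightarrow> 'm"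
  LUnit :: "'o \<Rightarrow> 'm"
  RUnit :: "'o \<Rightarrow> 'm"
  Sym :: "'o \<Rightarrow> 'o \<Rightarrow> 'm"
  IHom :: "'o \<Rightarrow> 'o \<Rightarrow> 'o"
  Ev :: "'o \<Rightarrow> 'o \<Rightarrow> 'm"

locale monoidal_category = category V for V (structure) +
  assumes Unit_in: "Unit V \<in> Obj V"
    and Tensor_in: "A \<in> Obj V \<Longrightarrow> B \<in> Obj V \<Longrightarrow> A \<otimes> B \<in> Obj V"
    and Tensor_arr_in: "f \<in> Hom V A B \<Longrightarrow> g \<in> Hom V A' B' \<Longrightarrow>
      f \<boxtimes> g \<in> Hom V (A \<otimes> A') (B \<otimes> B')"
    and Tensor_Id: "A \<in> Obj V \<Longrightarrow> B \<in> Obj V \<Longrightarrow> Id V A \<boxtimes> Id V B = Id V (A \<otimes> B)"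
    and Tensor_Comp: "f \<in> Hom V A B \<Longrightarrow> g \<in> Hom V B D \<Longrightarrow>
      f' \<in> Hom V A' B' \<Longrightarrow> g' \<in> Hom V B' D' \<Longrightarrow>
      (g \<cdot> f) \<boxtimes> (g' \<cdot> f') = (g \<boxtimes> g') \<cdot> (f \<boxtimes> f')"
    and Assoc_in: "A \<in> Obj V \<Longrightarrow> B \<in> Obj V \<Longrightarrow> D \<in> Obj V \<Longrightarrow>
      Assoc V A B D \<in> Hom V ((A \<otimes> B) \<otimes> D) (A \<otimes> (B \<otimes> D))"
    and Assoc_iso: "A \<in> Obj V \<Longrightarrow> B \<in> Obj V \<Longrightarrow> D \<in> Obj V \<Longrightarrow> iso V (Assoc V A B D)"
    and Assoc_natural: "f \<in> Hom V A A' \<Longrightarrow> g \<in> Hom V B B' \<Longrightarrow> h \<in> Hom V D D' \<Longrightarrow>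
      Assoc V A' B' D' \<cdot> ((f \<boxtimes> g) \<boxtimes> h) = (f \<boxtimes> (g \<boxtimes> h)) \<cdot> Assoc V A B D"
    and LUnit_in: "A \<in> Obj V \<Longrightarrow> LUnit V A \<in> Hom V (Unit V \<otimes> A) A"
    and LUnit_iso: "A \<in> Obj V \<Longrightarrow> iso V (LUnit V A)"
    and LUnit_natural: "f \<in> Hom V A B \<Longrightarrow> LUnit V B \<cdot> (Id V (Unit V) \<boxtimes> f) = f \<cdot> LUnit V A"
    and RUnit_in: "A \<in> Obj V \<Longrightarrow> RUnit V A \<in> Hom V (A \<otimes> Unit V) A"
    and RUnit_iso: "A \<in> Obj V \<Longrightarrow> iso V (RUnit V A)"
    and RUnit_natural: "f \<in> Hom V A B \<Longrightarrow> RUnit V B \<cdot> (f \<boxtimes> Id V (Unit V)) = f \<cdot> RUnit V A"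
    and pentagon: "A \<in> Obj V \<Longrightarrow> B \<in> Obj V \<Longrightarrow> D \<in> Obj V \<Longrightarrow> E \<in> Obj V \<Longrightarrow>
      Assoc V A B (D \<otimes> E) \<cdot> Assoc V (A \<otimes> B) D E =
      (Id V A \<boxtimes> Assoc V B D E) \<cdot> Assoc V A (B \<otimes> D) E \<cdot> (Assoc V A B D \<boxtimes> Id V E)"
    and triangle: "A \<in> Obj V \<Longrightarrow> B \<in> Obj V \<Longrightarrow>
      (Id V A \<boxtimes> LUnit V B) \<cdot> Assoc V A (Unit V) B = RUnit V A \<boxtimes> Id V B"

locale symmetric_monoidal_category = monoidal_category +
  assumes Sym_in: "A \<in> Obj V \<Longrightarrow> B \<in> Obj V \<Longrightarrow> Sym V A B \<in> Hom V (A \<otimes> B) (B \<otimes> A)"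
    and Sym_natural: "f \<in> Hom V A A' \<Longrightarrow> g \<in> Hom V B B' \<Longrightarrow>
      Sym V A' B' \<cdot> (f \<boxtimes> g) = (g \<boxtimes> f) \<cdot> Sym V A B"
    and Sym_Sym: "A \<in> Obj V \<Longrightarrow> B \<in> Obj V \<Longrightarrow> Sym V B A \<cdot> Sym V A B = Id V (A \<otimes> B)"
    and hexagon: "A \<in> Obj V \<Longrightarrow> B \<in> Obj V \<Longrightarrow> D \<in> Obj V \<Longrightarrow>
      Assoc V B D A \<cdot> Sym V A (B \<otimes> D) \<cdot> Assoc V A B D =
      (Id V B \<boxtimes> Sym V A D) \<cdot> Assoc V B A D \<cdot> (Sym V A B \<boxtimes> Id V D)"

locale symmetric_monoidal_closed_category = symmetric_monoidal_category +
  assumes IHom_in: "A \<in> Obj V \<Longrightarrow> B \<in> Obj V \<Longrightarrow> IHom V A B \<in> Obj V"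
    and Ev_in: "A \<in> Obj V \<Longrightarrow> B \<in> Obj V \<Longrightarrow> Ev V A B \<in> Hom V (IHom V A B \<otimes> A) B"
    and Ev_universal: "X \<in> Obj V \<Longrightarrow> A \<in> Obj V \<Longrightarrow> B \<in> Obj V \<Longrightarrow> f \<in> Hom V (X \<otimes> A) B \<Longrightarrow>
      \<exists>!g. g \<in> Hom V X (IHom V A B) \<and> Ev V A B \<cdot> (g \<boxtimes> Id V A) = f"


section \<open>Enriched categories, functors and natural transformations\<close>

text \<open>
  All families indexed by objects are extensional (\<open>\<Pi>\<^sub>E\<close>), so that HOL equality of
  \<open>V\<close>-categories, \<open>V\<close>-functors and \<open>V\<close>-natural transformations is the mathematical one.
  Composition is indexed so that \<open>VComp C A B D\<close> is the arrow
  \<open>C(B,D) \<otimes> C(A,B) \<rightarrow> C(A,D)\<close> of \<open>V\<close>.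
\<close>

record ('c, 'o, 'm) vcategory =
  VOb :: "'c set"
  VHom :: "'c \<Rightarrow> 'c \<Rightarrow> 'o"
  VComp :: "'c \<Rightarrow> 'c \<Rightarrow> 'c \<Rightarrow> 'm"
  VId :: "'c \<Rightarrow> 'm"

locale vcategory =
  fixes V :: "('o, 'm) smc_category" (structure) and C :: "('c, 'o, 'm) vcategory"
  assumes VHom_in: "VHom C \<in> VOb C \<rightarrow>\<^sub>E VOb C \<rightarrow>\<^sub>E Obj V"
    and VComp_in: "VComp C \<in> (\<Pi>\<^sub>E A\<in>VOb C. \<Pi>\<^sub>E B\<in>VOb C. \<Pi>\<^sub>E D\<in>VOb C.
      Hom V (VHom C B D \<otimes> VHom C A B) (VHom C A D))"
    and VId_in: "VId C \<in> (\<Pi>\<^sub>E A\<in>VOb C. Hom V (Unit V) (VHom C A A))"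
    and VComp_assoc: "A \<in> VOb C \<Longrightarrow> B \<in> VOb C \<Longrightarrow> D \<in> VOb C \<Longrightarrow> E \<in> VOb C \<Longrightarrow>
      VComp C A B E \<cdot> (VComp C B D E \<boxtimes> Id V (VHom C A B)) =
      VComp C A D E \<cdot> (Id V (VHom C D E) \<boxtimes> VComp C A B D) \<cdot>
        Assoc V (VHom C D E) (VHom C B D) (VHom C A B)"
    and VId_VComp: "A \<in> VOb C \<Longrightarrow> B \<in> VOb C \<Longrightarrow>
      VComp C A B B \<cdot> (VId C B \<boxtimes> Id V (VHom C A B)) = LUnit V (VHom C A B)"
    and VComp_VId: "A \<in> VOb C \<Longrightarrow> B \<in> VOb C \<Longrightarrow>
      VComp C A A B \<cdot> (Id V (VHom C A B) \<boxtimes> VId C A) = RUnit V (VHom C A B)"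

record ('c, 'd, 'm) vfunctor =
  VMap_ob :: "'c \<Rightarrow> 'd"
  VMap_hom :: "'c \<Rightarrow> 'c \<Rightarrow> 'm"

locale vfunctor =
  source: vcategory V C + target: vcategory V D
  for V :: "('o, 'm) smc_category" (structure)
    and C :: "('c, 'o, 'm) vcategory" and D :: "('d, 'o, 'm) vcategory" +
  fixes F :: "('c, 'd, 'm) vfunctor"
  assumes VMap_ob_in: "VMap_ob F \<in> VOb C \<rightarrow>\<^sub>E VOb D"
    and VMap_hom_in: "VMap_hom F \<in> (\<Pi>\<^sub>E A\<in>VOb C. \<Pi>\<^sub>E B\<in>VOb C.
      Hom V (VHom C A B) (VHom D (VMap_ob F A) (VMap_ob F B)))"
    and VMap_VComp: "A \<in> VOb C \<Longrightarrow> B \<in> VOb C \<Longrightarrow> E \<in> VOb C \<Longrightarrow>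
      VMap_hom F A E \<cdot> VComp C A B E =
      VComp D (VMap_ob F A) (VMap_ob F B) (VMap_ob F E) \<cdot> (VMap_hom F B E \<boxtimes> VMap_hom F A B)"
    and VMap_VId: "A \<in> VOb C \<Longrightarrow> VMap_hom F A A \<cdot> VId C A = VId D (VMap_ob F A)"

locale vnat =
  F: vfunctor V C D F + G: vfunctor V C D G
  for V :: "('o, 'm) smc_category" (structure)
    and C :: "('c, 'o, 'm) vcategory" and D :: "('d, 'o, 'm) vcategory" and F G +
  fixes \<alpha> :: "'c \<Rightarrow> 'm"
  assumes component_in: "\<alpha> \<in> (\<Pi>\<^sub>E A\<in>VOb C. Hom V (Unit V) (VHom D (VMap_ob F A) (VMap_ob G A)))"
    and vnaturality: "A \<in> VOb C \<Longrightarrow> B \<in> VOb C \<Longrightarrow>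
      VComp D (VMap_ob F A) (VMap_ob F B) (VMap_ob G B) \<cdot> (\<alpha> B \<boxtimes> VMap_hom F A B) \<cdot>
        Inv V (LUnit V (VHom C A B)) =
      VComp D (VMap_ob F A) (VMap_ob G A) (VMap_ob G B) \<cdot> (VMap_hom G A B \<boxtimes> \<alpha> A) \<cdot>
        Inv V (RUnit V (VHom C A B))"

context
  fixes V :: "('o, 'm) smc_category" (structure)
begin

definition vfunctor_id :: "('c, 'o, 'm) vcategory \<Rightarrow> ('c, 'c, 'm) vfunctor" where
  "vfunctor_id C = \<lparr>VMap_ob = (\<lambda>A\<in>VOb C. A),
     VMap_hom = (\<lambda>A\<in>VOb C. \<lambda>B\<in>VOb C. Id V (VHom C A B))\<rparr>"

text \<open>The composite of \<open>F\<close>, whose source is \<open>C\<close>, followed by \<open>G\<close>.\<close>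

definition vfunctor_comp ::
    "('c, 'o, 'm) vcategory \<Rightarrow> ('d, 'e, 'm) vfunctor \<Rightarrow> ('c, 'd, 'm) vfunctor \<Rightarrow> ('c, 'e, 'm) vfunctor" where
  "vfunctor_comp C G F = \<lparr>VMap_ob = (\<lambda>A\<in>VOb C. VMap_ob G (VMap_ob F A)),
     VMap_hom = (\<lambda>A\<in>VOb C. \<lambda>B\<in>VOb C.
       VMap_hom G (VMap_ob F A) (VMap_ob F B) \<cdot> VMap_hom F A B)\<rparr>"

definition vnat_id ::
    "('c, 'o, 'm) vcategory \<Rightarrow> ('d, 'o, 'm) vcategory \<Rightarrow> ('c, 'd, 'm) vfunctor \<Rightarrow> 'c \<Rightarrow> 'm" where
  "vnat_id C D F = (\<lambda>A\<in>VOb C. VId D (VMap_ob F A))"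

text \<open>The vertical composite of \<open>\<alpha> : F \<rightarrow> G\<close> and \<open>\<beta> : G \<rightarrow> H\<close>, for \<open>F, G, H : C \<rightarrow> D\<close>.\<close>

definition vnat_comp ::
    "('c, 'o, 'm) vcategory \<Rightarrow> ('d, 'o, 'm) vcategory \<Rightarrow>
     ('c, 'd, 'm) vfunctor \<Rightarrow> ('c, 'd, 'm) vfunctor \<Rightarrow> ('c, 'd, 'm) vfunctor \<Rightarrow>
     ('c \<Rightarrow> 'm) \<Rightarrow> ('c \<Rightarrow> 'm) \<Rightarrow> 'c \<Rightarrow> 'm" where
  "vnat_comp C D F G H \<beta> \<alpha> = (\<lambda>A\<in>VOb C.
     VComp D (VMap_ob F A) (VMap_ob G A) (VMap_ob H A) \<cdot> (\<beta> A \<boxtimes> \<alpha> A) \<cdot> Inv V (LUnit V (Unit V)))"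

text \<open>\<open>\<alpha>S\<close>, where \<open>S\<close> has source \<open>C\<close>.\<close>

definition vnat_pre ::
    "('c, 'o, 'm) vcategory \<Rightarrow> ('d \<Rightarrow> 'm) \<Rightarrow> ('c, 'd, 'm) vfunctor \<Rightarrow> 'c \<Rightarrow> 'm" where
  "vnat_pre C \<alpha> S = (\<lambda>A\<in>VOb C. \<alpha> (VMap_ob S A))"

text \<open>\<open>T\<alpha>\<close>, where \<open>\<alpha> : F \<rightarrow> G\<close> and \<open>F, G\<close> have source \<open>C\<close>.\<close>

definition vnat_post ::
    "('c, 'o, 'm) vcategory \<Rightarrow> ('d, 'e, 'm) vfunctor \<Rightarrow> ('c, 'd, 'm) vfunctor \<Rightarrow> ('c, 'd, 'm) vfunctor \<Rightarrow>
     ('c \<Rightarrow> 'm) \<Rightarrow> 'c \<Rightarrow> 'm" where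
  "vnat_post C T F G \<alpha> = (\<lambda>A\<in>VOb C. VMap_hom T (VMap_ob F A) (VMap_ob G A) \<cdot> \<alpha> A)"

definition vnat_iso ::
    "('c, 'o, 'm) vcategory \<Rightarrow> ('d, 'o, 'm) vcategory \<Rightarrow>
     ('c, 'd, 'm) vfunctor \<Rightarrow> ('c, 'd, 'm) vfunctor \<Rightarrow> ('c \<Rightarrow> 'm) \<Rightarrow> bool" where
  "vnat_iso C D F G \<alpha> \<longleftrightarrow> vnat V C D F G \<alpha> \<and>
     (\<exists>\<beta>. vnat V C D G F \<beta> \<and>
       vnat_comp C D F G F \<beta> \<alpha> = vnat_id C D F \<and>
       vnat_comp C D G F G \<alpha> \<beta> = vnat_id C D G)"


section \<open>\<open>V\<close> as a \<open>V\<close>-category, opposites and representable \<open>V\<close>-functors\<close>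

definition vcurry :: "'o \<Rightarrow> 'o \<Rightarrow> 'o \<Rightarrow> 'm \<Rightarrow> 'm" where
  "vcurry X A B f = (THE g. g \<in> Hom V X (IHom V A B) \<and> Ev V A B \<cdot> (g \<boxtimes> Id V A) = f)"

definition vself :: "('o, 'o, 'm) vcategory" where
  "vself = \<lparr>VOb = Obj V,
     VHom = (\<lambda>A\<in>Obj V. \<lambda>B\<in>Obj V. IHom V A B),
     VComp = (\<lambda>A\<in>Obj V. \<lambda>B\<in>Obj V. \<lambda>D\<in>Obj V.
       vcurry (IHom V B D \<otimes> IHom V A B) A D
         (Ev V B D \<cdot> (Id V (IHom V B D) \<boxtimes> Ev V A B) \<cdot> Assoc V (IHom V B D) (IHom V A B) A)),
     VId = (\<lambda>A\<in>Obj V. vcurry (Unit V) A A (LUnit V A))\<rparr>"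

definition vop :: "('c, 'o, 'm) vcategory \<Rightarrow> ('c, 'o, 'm) vcategory" where
  "vop C = \<lparr>VOb = VOb C,
     VHom = (\<lambda>A\<in>VOb C. \<lambda>B\<in>VOb C. VHom C B A),
     VComp = (\<lambda>A\<in>VOb C. \<lambda>B\<in>VOb C. \<lambda>D\<in>VOb C.
       VComp C D B A \<cdot> Sym V (VHom C D B) (VHom C B A)),
     VId = VId C\<rparr>"

text \<open>The representable \<open>V\<close>-functor \<open>C(X,-)\<close> from \<open>C\<close> to \<open>vself\<close>.\<close>

definition vrep :: "('c, 'o, 'm) vcategory \<Rightarrow> 'c \<Rightarrow> ('c, 'o, 'm) vfunctor" where
  "vrep C X = \<lparr>VMap_ob = (\<lambda>Y\<in>VOb C. VHom C X Y),
     VMap_hom = (\<lambda>Y\<in>VOb C. \<lambda>Z\<in>VOb C.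
       vcurry (VHom C Y Z) (VHom C X Y) (VHom C X Z) (VComp C X Y Z))\<rparr>"


section \<open>Cotensors\<close>

text \<open>The arrow \<open>A \<rightarrow> B\<close> of \<open>V\<close> named by an arrow \<open>Unit V \<rightarrow> IHom V A B\<close>.\<close>

definition unname :: "'o \<Rightarrow> 'o \<Rightarrow> 'm \<Rightarrow> 'm" where
  "unname A B e = Ev V A B \<cdot> (e \<boxtimes> Id V A) \<cdot> Inv V (LUnit V A)"

text \<open>
  \<open>\<theta>\<close> exhibits \<open>P\<close> as a cotensor \<open>[W,X]\<close> in \<open>C\<close>: it is an isomorphism
  \<open>C(D,P) \<cong> [W, C(D,X)]\<close>, \<open>V\<close>-natural in \<open>D\<close>, i.e. between \<open>V\<close>-functors on \<open>vop C\<close>.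
\<close>

definition cotensor_iso ::
    "('c, 'o, 'm) vcategory \<Rightarrow> 'o \<Rightarrow> 'c \<Rightarrow> 'c \<Rightarrow> ('c \<Rightarrow> 'm) \<Rightarrow> bool" where
  "cotensor_iso C W X P \<theta> \<longleftrightarrow> W \<in> Obj V \<and> X \<in> VOb C \<and> P \<in> VOb C \<and>
     vnat_iso (vop C) vself
       (vrep (vop C) P)
       (vfunctor_comp (vop C) (vrep vself W) (vrep (vop C) X)) \<theta>"

text \<open>
  The counit \<open>W \<rightarrow> C(P,X)\<close> of a cotensor corresponds to the image of the identity of \<open>P\<close>
  under \<open>\<theta> P : C(P,P) \<rightarrow> [W, C(P,X)]\<close>.
\<close>

definition cotensor_counit ::
    "('c, 'o, 'm) vcategory \<Rightarrow> 'o \<Rightarrow> 'c \<Rightarrow> 'c \<Rightarrow> ('c \<Rightarrow> 'm) \<Rightarrow> 'm" where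
  "cotensor_counit C W X P \<theta> =
     unname W (VHom C P X)
       (unname (VHom C P P) (IHom V W (VHom C P X)) (\<theta> P) \<cdot> VId C P)"

definition is_cotensor :: "('c, 'o, 'm) vcategory \<Rightarrow> 'o \<Rightarrow> 'c \<Rightarrow> 'c \<Rightarrow> 'm \<Rightarrow> bool" where
  "is_cotensor C W X P \<gamma> \<longleftrightarrow>
     (\<exists>\<theta>. cotensor_iso C W X P \<theta> \<and> cotensor_counit C W X P \<theta> = \<gamma>)"

definition preserves_cotensors ::
    "('c, 'o, 'm) vcategory \<Rightarrow> ('d, 'o, 'm) vcategory \<Rightarrow> ('c, 'd, 'm) vfunctor \<Rightarrow> bool" where
  "preserves_cotensors C D F \<longleftrightarrow>
     (\<forall>W X P \<gamma>. is_cotensor C W X P \<gamma> \<longrightarrow>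
        is_cotensor D W (VMap_ob F X) (VMap_ob F P) (VMap_hom F P X \<cdot> \<gamma>))"

end


section \<open>The category of theories\<close>

record ('o, 'm) vtheory =
  Theory_cat :: "('o, 'o, 'm) vcategory"
  Theory_fun :: "('o, 'o, 'm) vfunctor"

locale vtheory = vfunctor V "vop V (vself V)" "Theory_cat T" "Theory_fun T"
  for V :: "('o, 'm) smc_category" (structure) and T :: "('o, 'm) vtheory" +
  assumes theory_objects: "VOb (Theory_cat T) = Obj V"
    and identity_on_objects: "A \<in> Obj V \<Longrightarrow> VMap_ob (Theory_fun T) A = A"
    and preserves: "preserves_cotensors V (vop V (vself V)) (Theory_cat T) (Theory_fun T)"

definition theory_morphism ::
    "('o, 'm) smc_category \<Rightarrow> ('o, 'm) vtheory \<Rightarrow> ('o, 'm) vtheory \<Rightarrow> ('o, 'o, 'm) vfunctor \<Rightarrow> bool" where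
  "theory_morphism V T U M \<longleftrightarrow> vfunctor V (Theory_cat T) (Theory_cat U) M \<and>
     vfunctor_comp V (vop V (vself V)) M (Theory_fun T) = Theory_fun U"

text \<open>Arrows are recorded together with their source and target.\<close>

definition Th :: "('o, 'm) smc_category \<Rightarrow>
    (('o, 'm) vtheory, ('o, 'm) vtheory \<times> ('o, 'o, 'm) vfunctor \<times> ('o, 'm) vtheory) category" where
  "Th V = \<lparr>Obj = {T. vtheory V T},
     Arr = {(T, M, U). vtheory V T \<and> vtheory V U \<and> theory_morphism V T U M},
     Dom = (\<lambda>(T, M, U). T),
     Cod = (\<lambda>(T, M, U). U),
     Id = (\<lambda>T. (T, vfunctor_id V (Theory_cat T), T)),
     Comp = (\<lambda>(U', N, W) (T, M, U). (T, vfunctor_comp V (Theory_cat T) N M, W))\<rparr>"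


section \<open>The category of \<open>V\<close>-monads on a \<open>V\<close>-category\<close>

record ('c, 'm) vmonad =
  Endo :: "('c, 'c, 'm) vfunctor"
  Eta :: "'c \<Rightarrow> 'm"
  Mu :: "'c \<Rightarrow> 'm"

locale vmonad =
  endo: vfunctor V C C "Endo T" +
  eta: vnat V C C "vfunctor_id V C" "Endo T" "Eta T" +
  mu: vnat V C C "vfunctor_comp V C (Endo T) (Endo T)" "Endo T" "Mu T"
  for V :: "('o, 'm) smc_category" (structure)
    and C :: "('c, 'o, 'm) vcategory" and T :: "('c, 'm) vmonad" +
  assumes mu_Teta:
      "vnat_comp V C C (Endo T) (vfunctor_comp V C (Endo T) (Endo T)) (Endo T)
         (Mu T) (vnat_post V C (Endo T) (vfunctor_id V C) (Endo T) (Eta T)) =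
       vnat_id C C (Endo T)"
    and mu_etaT:
      "vnat_comp V C C (Endo T) (vfunctor_comp V C (Endo T) (Endo T)) (Endo T)
         (Mu T) (vnat_pre C (Eta T) (Endo T)) =
       vnat_id C C (Endo T)"
    and mu_assoc:
      "vnat_comp V C C
         (vfunctor_comp V C (Endo T) (vfunctor_comp V C (Endo T) (Endo T)))
         (vfunctor_comp V C (Endo T) (Endo T)) (Endo T)
         (Mu T) (vnat_post V C (Endo T) (vfunctor_comp V C (Endo T) (Endo T)) (Endo T) (Mu T)) =
       vnat_comp V C C
         (vfunctor_comp V C (Endo T) (vfunctor_comp V C (Endo T) (Endo T)))
         (vfunctor_comp V C (Endo T) (Endo T)) (Endo T)
         (Mu T) (vnat_pre C (Mu T) (Endo T))"

text \<open>The transformation \<open>SS \<rightarrow> TT\<close> in the second law is \<open>T\<alpha> \<circ> \<alpha>S\<close>.\<close>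

definition monad_morphism ::
    "('o, 'm) smc_category \<Rightarrow> ('c, 'o, 'm) vcategory \<Rightarrow>
     ('c, 'm) vmonad \<Rightarrow> ('c, 'm) vmonad \<Rightarrow> ('c \<Rightarrow> 'm) \<Rightarrow> bool" where
  "monad_morphism V C S T \<alpha> \<longleftrightarrow> vnat V C C (Endo S) (Endo T) \<alpha> \<and>
     vnat_comp V C C (vfunctor_id V C) (Endo S) (Endo T) \<alpha> (Eta S) = Eta T \<and>
     vnat_comp V C C (vfunctor_comp V C (Endo S) (Endo S)) (Endo S) (Endo T) \<alpha> (Mu S) =
     vnat_comp V C C (vfunctor_comp V C (Endo S) (Endo S)) (vfunctor_comp V C (Endo T) (Endo T)) (Endo T)
       (Mu T)
       (vnat_comp V C C (vfunctor_comp V C (Endo S) (Endo S)) (vfunctor_comp V C (Endo T) (Endo S))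
          (vfunctor_comp V C (Endo T) (Endo T))
          (vnat_post V C (Endo T) (Endo S) (Endo T) \<alpha>)
          (vnat_pre C \<alpha> (Endo S)))"

definition Mnd :: "('o, 'm) smc_category \<Rightarrow> ('c, 'o, 'm) vcategory \<Rightarrow>
    (('c, 'm) vmonad, ('c, 'm) vmonad \<times> ('c \<Rightarrow> 'm) \<times> ('c, 'm) vmonad) category" where
  "Mnd V C = \<lparr>Obj = {T. vmonad V C T},
     Arr = {(S, \<alpha>, T). vmonad V C S \<and> vmonad V C T \<and> monad_morphism V C S T \<alpha>},
     Dom = (\<lambda>(S, \<alpha>, T). S),
     Cod = (\<lambda>(S, \<alpha>, T). T),
     Id = (\<lambda>T. (T, vnat_id C C (Endo T), T)),
     Comp = (\<lambda>(T', \<beta>, U) (S, \<alpha>, T). (S, vnat_comp V C C (Endo S) (Endo T) (Endo U) \<beta> \<alpha>, U))\<rparr>"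

end

theory Submission
  imports Defs
begin

text \<open>
  Write \<open>V\<close> for the base, \<open>I\<close> for its unit object and \<open>[A,B]\<close> for its internal hom. The opposite of
  a theory is an identity-on-objects \<open>V\<close>-functor \<open>F : V \<rightarrow> K\<close> that preserves tensors. Since every
  object \<open>A\<close> is the tensor of \<open>A\<close> with \<open>I\<close>, preservation of this tensor says that \<open>f \<mapsto> (a \<mapsto> f \<circ> F a)\<close> is
  an isomorphism \<open>K(A,D) \<cong> [A, K(I,D)]\<close>. So \<open>F\<close> is left adjoint to \<open>K(I,-)\<close>, and as \<open>F\<close> is the identity on
  objects, \<open>K\<close> is the Kleisli \<open>V\<close>-category of the monad \<open>D \<mapsto> K(I,D)\<close>. Conversely the Kleisli
  \<open>V\<close>-category of a monad \<open>S\<close> has homs \<open>[A, S D]\<close>, and its free functor preserves tensors because composing a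
  Kleisli morphism with a free one is composing in \<open>V\<close>.

  The proof shows that the assignment of its Kleisli theory to a monad is a fully faithful and
  essentially surjective functor. Let \<open>c\<^sub>D : S D \<rightarrow> D\<close> be the identity of \<open>S D\<close> read as a Kleisli
  morphism. Every Kleisli morphism \<open>f\<close> into \<open>D\<close> is \<open>c\<^sub>D\<close> composed with a free morphism, so a morphism of
  theories \<open>P\<close> is determined by the arrows \<open>P c\<^sub>D\<close>; these are the components of a monad
  morphism (\<open>kmap_inject\<close>, \<open>kmap_surj\<close>). Essential surjectivity is the isomorphism above, which is an
  isomorphism of theories (\<open>vmonad_tmonad\<close>, \<open>vfunctor_cmp\<close>, \<open>cmp_F\<close>).

  What remains is to keep the coherence isomorphisms of \<open>V\<close> out of these arguments. An arrow
  \<open>X\<^sub>1 \<otimes> (X\<^sub>2 \<otimes> \<dots> (X\<^sub>n \<otimes> I)) \<rightarrow> C(A,B)\<close> is treated as a generalised morphism \<open>A \<rightarrow> B\<close> of grade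
  \<open>[X\<^sub>1, \<dots>, X\<^sub>n]\<close>; grades are concatenated under composition. Because concatenation of lists is strictly
  associative and unital, the generalised morphisms of a \<open>V\<close>-category form an ordinary category
  (\<open>gcomp_assoc\<close>), \<open>V\<close>-functors act as ordinary functors, and \<open>V\<close>-naturality is commutation with ordinary
  squares. As generic elements are among the generalised ones, the enriched axioms can be recovered
  (\<open>vcategoryI\<close>, \<open>vfunctorI\<close>, \<open>vnatI\<close>), and all diagrams become equations between composites.
\<close>

section \<open>Isomorphisms and equivalences of categories\<close>

lemma in_Hom: "f \<in> Hom C A B \<longleftrightarrow> f \<in> Arr C \<and> Dom C f = A \<and> Cod C f = B"
  by (simp add: Hom_def)

context category
begin

lemma Obj_Dom [simp]: "f \<in> Arr C \<Longrightarrow> Dom C f \<in> Obj C"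
  and Obj_Cod [simp]: "f \<in> Arr C \<Longrightarrow> Cod C f \<in> Obj C"
  by (simp_all add: Dom_in Cod_in)

lemma Id_simps [simp]:
  assumes "A \<in> Obj C"
  shows "Id C A \<in> Arr C" "Dom C (Id C A) = A" "Cod C (Id C A) = A"
  using Id_in[OF assms] by (simp_all add: in_Hom)

lemma Comp_simps [simp]:
  assumes "f \<in> Arr C" "g \<in> Arr C" "Dom C g = Cod C f"
  shows "g \<cdot> f \<in> Arr C" "Dom C (g \<cdot> f) = Dom C f" "Cod C (g \<cdot> f) = Cod C g"
  using Comp_in[of f "Dom C f" "Cod C f" g "Cod C g"] assms by (simp_all add: in_Hom)

lemma Comp_Id_simp [simp]: "f \<in> Arr C \<Longrightarrow> A = Dom C f \<Longrightarrow> f \<cdot> Id C A = f"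
  using Comp_Id by (simp add: in_Hom)

lemma Id_Comp_simp [simp]: "f \<in> Arr C \<Longrightarrow> B = Cod C f \<Longrightarrow> Id C B \<cdot> f = f"
  using Id_Comp by (simp add: in_Hom)

lemma Comp_assoc_simp [simp]:
  assumes "f \<in> Arr C" "g \<in> Arr C" "h \<in> Arr C" "Dom C g = Cod C f" "Dom C h = Cod C g"
  shows "(h \<cdot> g) \<cdot> f = h \<cdot> (g \<cdot> f)"
  using assms by (intro Comp_assoc[of _ "Dom C f" "Cod C f" _ "Cod C g" _ "Cod C h"])
    (simp_all add: in_Hom)

lemma Comp_prefix:
  assumes "g \<cdot> f = h" "k \<in> Arr C" "f \<in> Arr C" "g \<in> Arr C" "Dom C f = Cod C k" "Dom C g = Cod C f"
  shows "g \<cdot> (f \<cdot> k) = h \<cdot> k"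
  using Comp_assoc_simp[of k f g] assms by simp

lemma inverse_pair_unique:
  assumes "inverse_pair C f g" "inverse_pair C f h"
  shows "g = h"
proof -
  have *: "f \<in> Arr C" "g \<in> Arr C" "h \<in> Arr C" "Dom C g = Cod C f" "Cod C g = Dom C f"
    "Dom C h = Cod C f" "Cod C h = Dom C f"
    using assms by (simp_all add: inverse_pair_def in_Hom)
  have "(h \<cdot> f) \<cdot> g = h \<cdot> (f \<cdot> g)" using * by (intro Comp_assoc_simp) simp_all
  moreover have "h \<cdot> f = Id C (Dom C f)" "f \<cdot> g = Id C (Cod C f)"
    using assms by (simp_all add: inverse_pair_def)
  ultimately show ?thesis using * by (metis Comp_Id_simp Id_Comp_simp)
qed

lemma inverse_pair_Inv: "iso C f \<Longrightarrow> inverse_pair C f (Inv C f)"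
  unfolding iso_def Inv_def using inverse_pair_unique by (blast intro: theI)

lemma iso_Arr: "iso C f \<Longrightarrow> f \<in> Arr C"
  by (auto simp: iso_def inverse_pair_def)

lemma Inv_simps [simp]:
  assumes "iso C f"
  shows "Inv C f \<in> Arr C" "Dom C (Inv C f) = Cod C f" "Cod C (Inv C f) = Dom C f"
    "f \<cdot> Inv C f = Id C (Cod C f)" "Inv C f \<cdot> f = Id C (Dom C f)"
  using inverse_pair_Inv[OF assms] by (simp_all add: inverse_pair_def in_Hom)

lemma Inv_cancel [simp]:
  assumes "iso C f" "k \<in> Arr C"
  shows "Cod C k = Cod C f \<Longrightarrow> f \<cdot> (Inv C f \<cdot> k) = k"
    and "Cod C k = Dom C f \<Longrightarrow> Inv C f \<cdot> (f \<cdot> k) = k"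
  using assms iso_Arr[OF assms(1)] by (simp_all add: Comp_prefix[of f "Inv C f" _ k]
    Comp_prefix[of "Inv C f" f _ k])

lemma inverse_pairI:
  assumes "f \<in> Arr C" "g \<in> Arr C" "Dom C g = Cod C f" "Cod C g = Dom C f"
    "g \<cdot> f = Id C (Dom C f)" "f \<cdot> g = Id C (Cod C f)"
  shows "inverse_pair C f g"
  using assms by (simp add: inverse_pair_def in_Hom)

lemma inverse_pair_Comp:
  assumes "inverse_pair C f f'" "inverse_pair C g g'" "Dom C g = Cod C f"
  shows "inverse_pair C (g \<cdot> f) (f' \<cdot> g')"
proof -
  have *: "f \<in> Arr C" "g \<in> Arr C" "f' \<in> Arr C" "g' \<in> Arr C"
    "Dom C f' = Cod C f" "Cod C f' = Dom C f" "Dom C g' = Cod C g" "Cod C g' = Dom C g"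
    and eqs: "f' \<cdot> f = Id C (Dom C f)" "f \<cdot> f' = Id C (Cod C f)"
      "g' \<cdot> g = Id C (Dom C g)" "g \<cdot> g' = Id C (Cod C g)"
    using assms by (simp_all add: inverse_pair_def in_Hom)
  have "g' \<cdot> g \<cdot> f = f" and "f \<cdot> f' \<cdot> g' = g'"
    using * eqs assms(3) by (simp_all add: Comp_prefix)
  then show ?thesis
    using * eqs assms(3) by (intro inverse_pairI) simp_all
qed

lemma iso_Comp: "iso C f \<Longrightarrow> iso C g \<Longrightarrow> Dom C g = Cod C f \<Longrightarrow> iso C (g \<cdot> f)"
  unfolding iso_def using inverse_pair_Comp by blast

lemma iso_Inv: "iso C f \<Longrightarrow> iso C (Inv C f)"
  unfolding iso_def[of _ "Inv C f"] by (intro exI[of _ f] inverse_pairI) (simp_all add: iso_Arr)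

lemma iso_Id: "A \<in> Obj C \<Longrightarrow> iso C (Id C A)"
  unfolding iso_def by (intro exI[of _ "Id C A"] inverse_pairI) simp_all

lemma iso_epi:
  assumes "iso C f" "g \<in> Arr C" "h \<in> Arr C" "Dom C g = Cod C f" "Dom C h = Cod C f"
    "g \<cdot> f = h \<cdot> f"
  shows "g = h"
proof -
  have "(g \<cdot> f) \<cdot> Inv C f = (h \<cdot> f) \<cdot> Inv C f" using assms(6) by simp
  then show ?thesis using assms(1-5) iso_Arr[OF assms(1)] by simp
qed

lemma iso_mono:
  assumes "iso C f" "g \<in> Arr C" "h \<in> Arr C" "Cod C g = Dom C f" "Cod C h = Dom C f"
    "f \<cdot> g = f \<cdot> h"
  shows "g = h"
proof -
  have "Inv C f \<cdot> (f \<cdot> g) = Inv C f \<cdot> (f \<cdot> h)" using assms(6) by simp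
  then show ?thesis using assms(1-5) by simp
qed

end

lemma cat_functor_simps:
  assumes "cat_functor C D F" "f \<in> Arr C"
  shows "Map_arr F f \<in> Arr D" "Dom D (Map_arr F f) = Map_ob F (Dom C f)"
    "Cod D (Map_arr F f) = Map_ob F (Cod C f)"
  using cat_functor.Map_arr_in[OF assms(1), of f] assms(2) by (simp_all add: in_Hom)

text \<open>
  With choice, a fully faithful and essentially surjective functor \<open>G : D \<rightarrow> C\<close> has a
  pseudo-inverse: \<open>F A\<close> is an object with a chosen isomorphism \<open>u A : A \<rightarrow> G (F A)\<close>, and \<open>F f\<close>
  is the only arrow that \<open>G\<close> sends to the conjugate of \<open>f\<close> by these isomorphisms.
\<close>

lemma equivalent_categories_if_ff_eso:
  assumes G: "cat_functor D C G"
    and faithful: "\<And>f g. f \<in> Arr D \<Longrightarrow> g \<in> Arr D \<Longrightarrow> Dom D f = Dom D g \<Longrightarrow> Cod D f = Cod D g \<Longrightarrow>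
      Map_arr G f = Map_arr G g \<Longrightarrow> f = g"
    and full: "\<And>A B h. A \<in> Obj D \<Longrightarrow> B \<in> Obj D \<Longrightarrow> h \<in> Hom C (Map_ob G A) (Map_ob G B) \<Longrightarrow>
      \<exists>f \<in> Hom D A B. Map_arr G f = h"
    and eso: "\<And>A. A \<in> Obj C \<Longrightarrow> \<exists>B \<in> Obj D. \<exists>u \<in> Hom C A (Map_ob G B). iso C u"
  shows "equivalent_categories C D"
proof -
  interpret G: cat_functor D C G by fact
  note [simp] = cat_functor_simps[OF G] G.Map_ob_in
  have "\<forall>A \<in> Obj C. \<exists>p. fst p \<in> Obj D \<and> snd p \<in> Hom C A (Map_ob G (fst p)) \<and> iso C (snd p)"
    using eso by fastforce
  then obtain p where
    p: "\<And>A. A \<in> Obj C \<Longrightarrow> fst (p A) \<in> Obj D \<and> snd (p A) \<in> Hom C A (Map_ob G (fst (p A))) \<and> iso C (snd (p A))"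
    by metis
  define ob where "ob A = fst (p A)" for A
  define u where "u A = snd (p A)" for A
  have [simp]: "ob A \<in> Obj D" "u A \<in> Arr C" "Dom C (u A) = A" "Cod C (u A) = Map_ob G (ob A)"
    "iso C (u A)" if "A \<in> Obj C" for A
    using p[OF that] by (simp_all add: in_Hom ob_def u_def)
  define lift where "lift A B h = (SOME f. f \<in> Hom D A B \<and> Map_arr G f = h)" for A B h
  have lift: "lift A B h \<in> Hom D A B \<and> Map_arr G (lift A B h) = h"
    if "A \<in> Obj D" "B \<in> Obj D" "h \<in> Arr C" "Dom C h = Map_ob G A" "Cod C h = Map_ob G B" for A B h
  proof -
    have "\<exists>f. f \<in> Hom D A B \<and> Map_arr G f = h"
      using full[OF that(1,2), of h] that(3-5) by (auto simp: in_Hom)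
    then show ?thesis unfolding lift_def by (rule someI_ex)
  qed
  have [simp]: "lift A B h \<in> Arr D" "Dom D (lift A B h) = A" "Cod D (lift A B h) = B"
    "Map_arr G (lift A B h) = h"
    if "A \<in> Obj D" "B \<in> Obj D" "h \<in> Arr C" "Dom C h = Map_ob G A" "Cod C h = Map_ob G B" for A B h
    using lift[OF that] by (simp_all add: in_Hom)
  have map_comp [simp]: "Map_arr G (Comp D g f) = Comp C (Map_arr G g) (Map_arr G f)"
    if "f \<in> Arr D" "g \<in> Arr D" "Dom D g = Cod D f" for f g
    using that by (intro G.Map_Comp[of _ "Dom D f" "Cod D f" _ "Cod D g"]) (simp_all add: in_Hom)
  note [simp] = G.Map_Id
  define conj where "conj f = Comp C (u (Cod C f)) (Comp C f (Inv C (u (Dom C f))))" for f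
  have [simp]: "conj f \<in> Arr C" "Dom C (conj f) = Map_ob G (ob (Dom C f))"
    "Cod C (conj f) = Map_ob G (ob (Cod C f))" if "f \<in> Arr C" for f
    using that by (simp_all add: conj_def)
  define F where "F = \<lparr>Map_ob = ob, Map_arr = (\<lambda>f. lift (ob (Dom C f)) (ob (Cod C f)) (conj f))\<rparr>"
  have F_arr: "Map_arr F f = lift (ob (Dom C f)) (ob (Cod C f)) (conj f)"
    and F_ob [simp]: "Map_ob F = ob" for f by (simp_all add: F_def)
  have F: "cat_functor C D F"
  proof
    show "Map_ob F A \<in> Obj D" if "A \<in> Obj C" for A using that by simp
    show "Map_arr F f \<in> Hom D (Map_ob F A) (Map_ob F B)" if "f \<in> Hom C A B" for f A B
      using that by (auto simp: in_Hom F_arr)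
    show "Map_arr F (Id C A) = Id D (Map_ob F A)" if "A \<in> Obj C" for A
      using that by (intro faithful) (simp_all add: F_arr conj_def)
    show "Map_arr F (Comp C g f) = Comp D (Map_arr F g) (Map_arr F f)"
      if "f \<in> Hom C A B" "g \<in> Hom C B E" for f g A B E
      using that by (intro faithful) (auto simp add: F_arr conj_def in_Hom)
  qed
  note [simp] = cat_functor_simps[OF F]
  have "natural_iso C C id_functor (comp_functor G F) u"
  proof
    show "u B \<cdot>\<^bsub>C\<^esub> Map_arr id_functor f = Map_arr (comp_functor G F) f \<cdot>\<^bsub>C\<^esub> u A"
      if "f \<in> Hom C A B" for f A B
      using that by (auto simp: id_functor_def comp_functor_def F_arr conj_def in_Hom)
  qed (auto simp: id_functor_def comp_functor_def in_Hom F_arr conj_def)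
  moreover
  define \<epsilon> where "\<epsilon> B = lift (ob (Map_ob G B)) B (Inv C (u (Map_ob G B)))" for B
  have [simp]: "\<epsilon> B \<in> Arr D" "Dom D (\<epsilon> B) = ob (Map_ob G B)" "Cod D (\<epsilon> B) = B"
    "Map_arr G (\<epsilon> B) = Inv C (u (Map_ob G B))" if "B \<in> Obj D" for B
    using that by (simp_all add: \<epsilon>_def)
  have "natural_iso D D (comp_functor F G) id_functor \<epsilon>"
  proof
    show "Map_arr (comp_functor F G) (Id D A) = Id D (Map_ob (comp_functor F G) A)"
      if "A \<in> Obj D" for A
      using that cat_functor.Map_Id[OF F] by (simp add: comp_functor_def)
    show "Map_arr (comp_functor F G) (Comp D g f)
        = Comp D (Map_arr (comp_functor F G) g) (Map_arr (comp_functor F G) f)"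
      if "f \<in> Hom D A B" "g \<in> Hom D B E" for f g A B E
      using that cat_functor.Map_Comp[OF F, of "Map_arr G f" "Map_ob G A" "Map_ob G B" "Map_arr G g"]
      by (auto simp: comp_functor_def in_Hom)
    show "iso D (\<epsilon> B)" if "B \<in> Obj D" for B
      unfolding iso_def
      using that
      by (intro exI[of _ "lift B (ob (Map_ob G B)) (u (Map_ob G B))"] G.source.inverse_pairI)
        (auto intro!: faithful)
    show "\<epsilon> B \<cdot>\<^bsub>D\<^esub> Map_arr (comp_functor F G) f = Map_arr id_functor f \<cdot>\<^bsub>D\<^esub> \<epsilon> A"
      if "f \<in> Hom D A B" for f A B
      using that by (intro faithful) (auto simp: comp_functor_def id_functor_def in_Hom F_arr conj_def)
  qed (auto simp: id_functor_def comp_functor_def in_Hom)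
  ultimately show ?thesis unfolding equivalent_categories_def using F G by blast
qed


section \<open>Coherence in monoidal categories\<close>

context monoidal_category
begin

lemma Assoc_simps [simp]:
  assumes "A \<in> Obj V" "B \<in> Obj V" "D \<in> Obj V"
  shows "Assoc V A B D \<in> Arr V" "Dom V (Assoc V A B D) = (A \<otimes> B) \<otimes> D"
    "Cod V (Assoc V A B D) = A \<otimes> (B \<otimes> D)" "iso V (Assoc V A B D)"
  using Assoc_in[OF assms] Assoc_iso[OF assms] by (simp_all add: in_Hom)

lemma LUnit_simps [simp]:
  assumes "A \<in> Obj V"
  shows "LUnit V A \<in> Arr V" "Dom V (LUnit V A) = Unit V \<otimes> A" "Cod V (LUnit V A) = A"
    "iso V (LUnit V A)"
  using LUnit_in[OF assms] LUnit_iso[OF assms] by (simp_all add: in_Hom)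

lemma RUnit_simps [simp]:
  assumes "A \<in> Obj V"
  shows "RUnit V A \<in> Arr V" "Dom V (RUnit V A) = A \<otimes> Unit V" "Cod V (RUnit V A) = A"
    "iso V (RUnit V A)"
  using RUnit_in[OF assms] RUnit_iso[OF assms] by (simp_all add: in_Hom)

lemma Tensor_arr_simps [simp]:
  assumes "f \<in> Arr V" "g \<in> Arr V"
  shows "f \<boxtimes> g \<in> Arr V" "Dom V (f \<boxtimes> g) = Dom V f \<otimes> Dom V g"
    "Cod V (f \<boxtimes> g) = Cod V f \<otimes> Cod V g"
  using Tensor_arr_in[of f "Dom V f" "Cod V f" g "Dom V g" "Cod V g"] assms
  by (simp_all add: in_Hom)

declare Tensor_in [simp] Unit_in [simp] Tensor_Id [simp]

lemma interchange [simp]: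
  assumes "f \<in> Arr V" "g \<in> Arr V" "f' \<in> Arr V" "g' \<in> Arr V"
    "Dom V g = Cod V f" "Dom V g' = Cod V f'"
  shows "(g \<boxtimes> g') \<cdot> (f \<boxtimes> f') = (g \<cdot> f) \<boxtimes> (g' \<cdot> f')"
  using Tensor_Comp[of f "Dom V f" "Cod V f" g "Cod V g" f' "Dom V f'" "Cod V f'" g' "Cod V g'"]
    assms by (simp add: in_Hom)

lemma interchange_prefix [simp]:
  assumes "f \<in> Arr V" "g \<in> Arr V" "f' \<in> Arr V" "g' \<in> Arr V" "k \<in> Arr V"
    "Dom V g = Cod V f" "Dom V g' = Cod V f'" "Cod V k = Dom V f \<otimes> Dom V f'"
  shows "(g \<boxtimes> g') \<cdot> ((f \<boxtimes> f') \<cdot> k) = ((g \<cdot> f) \<boxtimes> (g' \<cdot> f')) \<cdot> k"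
  using assms by (intro Comp_prefix) simp_all

lemma Assoc_nat:
  assumes "f \<in> Arr V" "g \<in> Arr V" "h \<in> Arr V"
  shows "Assoc V (Cod V f) (Cod V g) (Cod V h) \<cdot> ((f \<boxtimes> g) \<boxtimes> h)
    = (f \<boxtimes> (g \<boxtimes> h)) \<cdot> Assoc V (Dom V f) (Dom V g) (Dom V h)"
  using assms by (intro Assoc_natural) (simp_all add: in_Hom)

lemma Assoc_nat_prefix:
  assumes "f \<in> Arr V" "g \<in> Arr V" "h \<in> Arr V" "k \<in> Arr V"
    "Cod V k = (Dom V f \<otimes> Dom V g) \<otimes> Dom V h"
  shows "Assoc V (Cod V f) (Cod V g) (Cod V h) \<cdot> (((f \<boxtimes> g) \<boxtimes> h) \<cdot> k)
    = (f \<boxtimes> (g \<boxtimes> h)) \<cdot> (Assoc V (Dom V f) (Dom V g) (Dom V h) \<cdot> k)"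
  using assms Comp_prefix[OF Assoc_nat[of f g h], of k] by simp

lemma LUnit_nat: "f \<in> Arr V \<Longrightarrow> LUnit V (Cod V f) \<cdot> (Id V (Unit V) \<boxtimes> f) = f \<cdot> LUnit V (Dom V f)"
  by (rule LUnit_natural) (simp add: in_Hom)

lemma RUnit_nat: "f \<in> Arr V \<Longrightarrow> RUnit V (Cod V f) \<cdot> (f \<boxtimes> Id V (Unit V)) = f \<cdot> RUnit V (Dom V f)"
  by (rule RUnit_natural) (simp add: in_Hom)

lemma iso_Tensor [simp]:
  assumes "iso V f" "iso V g"
  shows "iso V (f \<boxtimes> g)"
proof -
  note [simp] = iso_Arr[OF assms(1)] iso_Arr[OF assms(2)]
  show ?thesis
    unfolding iso_def using assms
    by (intro exI[of _ "Inv V f \<boxtimes> Inv V g"] inverse_pairI) simp_all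
qed

declare iso_Inv [simp] iso_Id [simp] iso_Comp [simp]

lemma Unit_tensor_faithful:
  assumes "f \<in> Arr V" "g \<in> Arr V" "Dom V f = Dom V g" "Cod V f = Cod V g"
    "Id V (Unit V) \<boxtimes> f = Id V (Unit V) \<boxtimes> g"
  shows "f = g"
proof -
  have *: "f \<cdot> LUnit V (Dom V f) = g \<cdot> LUnit V (Dom V f)"
    using LUnit_nat[of f] LUnit_nat[of g] assms by metis
  show ?thesis by (rule iso_epi[OF _ _ _ _ _ *]) (use assms in simp_all)
qed

lemma tensor_Unit_faithful:
  assumes "f \<in> Arr V" "g \<in> Arr V" "Dom V f = Dom V g" "Cod V f = Cod V g"
    "f \<boxtimes> Id V (Unit V) = g \<boxtimes> Id V (Unit V)"
  shows "f = g"
proof -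
  have *: "f \<cdot> RUnit V (Dom V f) = g \<cdot> RUnit V (Dom V f)"
    using RUnit_nat[of f] RUnit_nat[of g] assms by metis
  show ?thesis by (rule iso_epi[OF _ _ _ _ _ *]) (use assms in simp_all)
qed

text \<open>
  The next three lemmas are Kelly's. Tensoring with the unit is faithful, so an equation may be
  proved after tensoring; there the pentagon and naturality bring it into the form of the triangle.
\<close>

lemma LUnit_Tensor:
  assumes [simp]: "A \<in> Obj V" "B \<in> Obj V"
  shows "LUnit V (A \<otimes> B) \<cdot> Assoc V (Unit V) A B = LUnit V A \<boxtimes> Id V B"
proof (rule Unit_tensor_faithful)
  let ?I = "Unit V" and ?a = "Assoc V" and ?i = "Id V"
  let ?c = "?a ?I (?I \<otimes> A) B \<cdot> (?a ?I ?I A \<boxtimes> ?i B)"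
  have "(?i ?I \<boxtimes> (LUnit V (A \<otimes> B) \<cdot> ?a ?I A B)) \<cdot> ?c
      = (?i ?I \<boxtimes> LUnit V (A \<otimes> B)) \<cdot> ((?i ?I \<boxtimes> ?a ?I A B) \<cdot> ?c)"
    by simp
  also have "\<dots> = (?i ?I \<boxtimes> LUnit V (A \<otimes> B)) \<cdot> (?a ?I ?I (A \<otimes> B) \<cdot> ?a (?I \<otimes> ?I) A B)"
    using pentagon[of ?I ?I A B] by simp
  also have "\<dots> = (RUnit V ?I \<boxtimes> ?i (A \<otimes> B)) \<cdot> ?a (?I \<otimes> ?I) A B"
    using triangle[of ?I "A \<otimes> B"] by (intro Comp_prefix) simp_all
  also have "\<dots> = ?a ?I A B \<cdot> ((RUnit V ?I \<boxtimes> ?i A) \<boxtimes> ?i B)"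
    using Assoc_nat[of "RUnit V ?I" "?i A" "?i B"] by simp
  also have "\<dots> = ?a ?I A B \<cdot> (((?i ?I \<boxtimes> LUnit V A) \<boxtimes> ?i B) \<cdot> (?a ?I ?I A \<boxtimes> ?i B))"
    using triangle[of ?I A] by simp
  also have "\<dots> = (?i ?I \<boxtimes> (LUnit V A \<boxtimes> ?i B)) \<cdot> ?c"
    using Assoc_nat_prefix[of "?i ?I" "LUnit V A" "?i B" "?a ?I ?I A \<boxtimes> ?i B"] by simp
  finally have *: "(?i ?I \<boxtimes> (LUnit V (A \<otimes> B) \<cdot> ?a ?I A B)) \<cdot> ?c
      = (?i ?I \<boxtimes> (LUnit V A \<boxtimes> ?i B)) \<cdot> ?c" .
  show "?i ?I \<boxtimes> (LUnit V (A \<otimes> B) \<cdot> ?a ?I A B) = ?i ?I \<boxtimes> (LUnit V A \<boxtimes> ?i B)"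
    by (rule iso_epi[OF _ _ _ _ _ *]) simp_all
qed simp_all

lemma RUnit_Tensor:
  assumes [simp]: "A \<in> Obj V" "B \<in> Obj V"
  shows "(Id V A \<boxtimes> RUnit V B) \<cdot> Assoc V A B (Unit V) = RUnit V (A \<otimes> B)"
proof (rule tensor_Unit_faithful)
  let ?I = "Unit V" and ?a = "Assoc V" and ?i = "Id V"
  let ?c = "?a A (B \<otimes> ?I) ?I \<cdot> (?a A B ?I \<boxtimes> ?i ?I)"
  have "?a A B ?I \<cdot> (((?i A \<boxtimes> RUnit V B) \<cdot> ?a A B ?I) \<boxtimes> ?i ?I)
      = ?a A B ?I \<cdot> (((?i A \<boxtimes> RUnit V B) \<boxtimes> ?i ?I) \<cdot> (?a A B ?I \<boxtimes> ?i ?I))"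
    by simp
  also have "\<dots> = (?i A \<boxtimes> (RUnit V B \<boxtimes> ?i ?I)) \<cdot> ?c"
    using Assoc_nat_prefix[of "?i A" "RUnit V B" "?i ?I" "?a A B ?I \<boxtimes> ?i ?I"] by simp
  also have "\<dots> = (?i A \<boxtimes> (?i B \<boxtimes> LUnit V ?I)) \<cdot> ((?i A \<boxtimes> ?a B ?I ?I) \<cdot> ?c)"
    using triangle[of B ?I] by simp
  also have "\<dots> = (?i A \<boxtimes> (?i B \<boxtimes> LUnit V ?I)) \<cdot> (?a A B (?I \<otimes> ?I) \<cdot> ?a (A \<otimes> B) ?I ?I)"
    using pentagon[of A B ?I ?I] by simp
  also have "\<dots> = ?a A B ?I \<cdot> ((?i (A \<otimes> B) \<boxtimes> LUnit V ?I) \<cdot> ?a (A \<otimes> B) ?I ?I)"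
    using Assoc_nat_prefix[of "?i A" "?i B" "LUnit V ?I" "?a (A \<otimes> B) ?I ?I"] by simp
  also have "\<dots> = ?a A B ?I \<cdot> (RUnit V (A \<otimes> B) \<boxtimes> ?i ?I)"
    using triangle[of "A \<otimes> B" ?I] by simp
  finally have *: "?a A B ?I \<cdot> (((?i A \<boxtimes> RUnit V B) \<cdot> ?a A B ?I) \<boxtimes> ?i ?I)
      = ?a A B ?I \<cdot> (RUnit V (A \<otimes> B) \<boxtimes> ?i ?I)" .
  show "((?i A \<boxtimes> RUnit V B) \<cdot> ?a A B ?I) \<boxtimes> ?i ?I = RUnit V (A \<otimes> B) \<boxtimes> ?i ?I"
    by (rule iso_mono[OF _ _ _ _ _ *]) simp_all
qed simp_all

lemma LUnit_Unit: "LUnit V (Unit V) = RUnit V (Unit V)"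
proof (rule tensor_Unit_faithful)
  let ?I = "Unit V"
  have *: "LUnit V ?I \<cdot> (Id V ?I \<boxtimes> LUnit V ?I) = LUnit V ?I \<cdot> LUnit V (?I \<otimes> ?I)"
    using LUnit_nat[of "LUnit V ?I"] by simp
  have "Id V ?I \<boxtimes> LUnit V ?I = LUnit V (?I \<otimes> ?I)"
    by (rule iso_mono[OF _ _ _ _ _ *]) simp_all
  then show "LUnit V ?I \<boxtimes> Id V ?I = RUnit V ?I \<boxtimes> Id V ?I"
    using LUnit_Tensor[of ?I ?I] triangle[of ?I ?I] by simp
qed simp_all

end


section \<open>Generalised elements\<close>

text \<open>
  An element of \<open>A\<close> is an arrow into \<open>A\<close> from the right-nested tensor product of a list of objects, its
  grade. The list is kept as data since it cannot be recovered from the product.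
\<close>

record ('o, 'm) elt =
  Grade :: "'o list"
  Val :: 'm

context monoidal_category
begin

primrec tens where
  "tens [] = Unit V"
| "tens (x # xs) = x \<otimes> tens xs"

primrec tens_split where
  "tens_split [] ys = Inv V (LUnit V (tens ys))"
| "tens_split (x # xs) ys = Inv V (Assoc V x (tens xs) (tens ys)) \<cdot> (Id V x \<boxtimes> tens_split xs ys)"

lemma tens_Obj [simp]: "set xs \<subseteq> Obj V \<Longrightarrow> tens xs \<in> Obj V"
  by (induction xs) simp_all

lemma tens_split_simps [simp]:
  assumes "set xs \<subseteq> Obj V" "set ys \<subseteq> Obj V"
  shows "tens_split xs ys \<in> Arr V" "Dom V (tens_split xs ys) = tens (xs @ ys)"
    "Cod V (tens_split xs ys) = tens xs \<otimes> tens ys" "iso V (tens_split xs ys)"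
  using assms by (induction xs) simp_all

lemma tens_split_Nil:
  assumes "set xs \<subseteq> Obj V"
  shows "RUnit V (tens xs) \<cdot> tens_split xs [] = Id V (tens xs)"
  using assms
proof (induction xs)
  case Nil
  then show ?case by (simp flip: LUnit_Unit)
next
  case (Cons x xs)
  then show ?case
    by (simp flip: RUnit_Tensor)
qed

lemma Inv_Assoc_nat_prefix:
  assumes "f \<in> Arr V" "g \<in> Arr V" "h \<in> Arr V" "k \<in> Arr V"
    "Cod V k = Dom V f \<otimes> (Dom V g \<otimes> Dom V h)"
  shows "((f \<boxtimes> g) \<boxtimes> h) \<cdot> (Inv V (Assoc V (Dom V f) (Dom V g) (Dom V h)) \<cdot> k)
    = Inv V (Assoc V (Cod V f) (Cod V g) (Cod V h)) \<cdot> ((f \<boxtimes> (g \<boxtimes> h)) \<cdot> k)"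
proof -
  let ?a = "Assoc V (Dom V f) (Dom V g) (Dom V h)" and ?b = "Assoc V (Cod V f) (Cod V g) (Cod V h)"
  note [simp] = assms
  have *: "?b \<cdot> (((f \<boxtimes> g) \<boxtimes> h) \<cdot> (Inv V ?a \<cdot> k)) = ?b \<cdot> (Inv V ?b \<cdot> ((f \<boxtimes> (g \<boxtimes> h)) \<cdot> k))"
    using Assoc_nat_prefix[of f g h "Inv V ?a \<cdot> k"] by simp
  show ?thesis by (rule iso_mono[OF _ _ _ _ _ *]) simp_all
qed

lemma pentagon_Inv:
  assumes [simp]: "A \<in> Obj V" "B \<in> Obj V" "D \<in> Obj V" "E \<in> Obj V"
    and [simp]: "k \<in> Arr V" "Cod V k = A \<otimes> (B \<otimes> (D \<otimes> E))"
  shows "(Inv V (Assoc V A B D) \<boxtimes> Id V E) \<cdot> (Inv V (Assoc V A (B \<otimes> D) E) \<cdot>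
      ((Id V A \<boxtimes> Inv V (Assoc V B D E)) \<cdot> k))
    = Inv V (Assoc V (A \<otimes> B) D E) \<cdot> (Inv V (Assoc V A B (D \<otimes> E)) \<cdot> k)" (is "?l = ?r")
proof -
  let ?p = "(Id V A \<boxtimes> Assoc V B D E) \<cdot> Assoc V A (B \<otimes> D) E \<cdot> (Assoc V A B D \<boxtimes> Id V E)"
  have "?p \<cdot> ?l = k" by simp
  moreover have "?p \<cdot> ?r = k"
    by (subst pentagon[symmetric]) simp_all
  ultimately have *: "?p \<cdot> ?l = ?p \<cdot> ?r" by simp
  show ?thesis by (rule iso_mono[OF _ _ _ _ _ *]) simp_all
qed

text \<open>
  The two ways of splitting a concatenation of three lists agree. The base case is Kelly's lemma for
  the left unit, the step is the pentagon.
\<close>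

lemma tens_split_assoc:
  assumes "set xs \<subseteq> Obj V" "set ys \<subseteq> Obj V" "set zs \<subseteq> Obj V"
  shows "(tens_split xs ys \<boxtimes> Id V (tens zs)) \<cdot> tens_split (xs @ ys) zs
    = Inv V (Assoc V (tens xs) (tens ys) (tens zs)) \<cdot>
        ((Id V (tens xs) \<boxtimes> tens_split ys zs) \<cdot> tens_split xs (ys @ zs))"
  using assms
proof (induction xs)
  case Nil
  let ?x = "tens ys" and ?y = "tens zs" and ?s = "tens_split ys zs" and ?I = "Unit V"
  have [simp]: "set ys \<subseteq> Obj V" "set zs \<subseteq> Obj V" using Nil by auto
  let ?a = "Assoc V ?I ?x ?y"
  have "LUnit V (?x \<otimes> ?y) \<cdot> (?a \<cdot> ((Inv V (LUnit V ?x) \<boxtimes> Id V ?y) \<cdot> ?s))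
      = (LUnit V ?x \<boxtimes> Id V ?y) \<cdot> ((Inv V (LUnit V ?x) \<boxtimes> Id V ?y) \<cdot> ?s)"
    using LUnit_Tensor[of ?x ?y] by (intro Comp_prefix) simp_all
  also have "\<dots> = ?s" by simp
  also have "\<dots> = ?s \<cdot> (LUnit V (tens (ys @ zs)) \<cdot> Inv V (LUnit V (tens (ys @ zs))))" by simp
  also have "\<dots> = LUnit V (?x \<otimes> ?y) \<cdot> ((Id V ?I \<boxtimes> ?s) \<cdot> Inv V (LUnit V (tens (ys @ zs))))"
    using LUnit_nat[of ?s] Comp_prefix[OF LUnit_nat[of ?s], of "Inv V (LUnit V (tens (ys @ zs)))"] by simp
  finally have *: "LUnit V (?x \<otimes> ?y) \<cdot> (?a \<cdot> ((Inv V (LUnit V ?x) \<boxtimes> Id V ?y) \<cdot> ?s))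
      = LUnit V (?x \<otimes> ?y) \<cdot> ((Id V ?I \<boxtimes> ?s) \<cdot> Inv V (LUnit V (tens (ys @ zs))))" .
  have "?a \<cdot> ((Inv V (LUnit V ?x) \<boxtimes> Id V ?y) \<cdot> ?s)
      = (Id V ?I \<boxtimes> ?s) \<cdot> Inv V (LUnit V (tens (ys @ zs)))"
    by (rule iso_mono[OF _ _ _ _ _ *]) simp_all
  then have "Inv V ?a \<cdot> (?a \<cdot> ((Inv V (LUnit V ?x) \<boxtimes> Id V ?y) \<cdot> ?s))
      = Inv V ?a \<cdot> ((Id V ?I \<boxtimes> ?s) \<cdot> Inv V (LUnit V (tens (ys @ zs))))" by simp
  then show ?case by simp
next
  case (Cons x xs)
  let ?X = "tens xs" and ?Y = "tens ys" and ?Z = "tens zs"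
  let ?r = "(Id V ?X \<boxtimes> tens_split ys zs) \<cdot> tens_split xs (ys @ zs)"
  have [simp]: "x \<in> Obj V" "set xs \<subseteq> Obj V" "set ys \<subseteq> Obj V" "set zs \<subseteq> Obj V" using Cons by auto
  have IH: "(tens_split xs ys \<boxtimes> Id V ?Z) \<cdot> tens_split (xs @ ys) zs = Inv V (Assoc V ?X ?Y ?Z) \<cdot> ?r"
    using Cons by simp
  have "(tens_split (x # xs) ys \<boxtimes> Id V ?Z) \<cdot> tens_split ((x # xs) @ ys) zs
      = (Inv V (Assoc V x ?X ?Y) \<boxtimes> Id V ?Z) \<cdot> (((Id V x \<boxtimes> tens_split xs ys) \<boxtimes> Id V ?Z) \<cdot>
          (Inv V (Assoc V x (tens (xs @ ys)) ?Z) \<cdot> (Id V x \<boxtimes> tens_split (xs @ ys) zs)))"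
    by simp
  also have "\<dots> = (Inv V (Assoc V x ?X ?Y) \<boxtimes> Id V ?Z) \<cdot> (Inv V (Assoc V x (?X \<otimes> ?Y) ?Z) \<cdot>
          ((Id V x \<boxtimes> (tens_split xs ys \<boxtimes> Id V ?Z)) \<cdot> (Id V x \<boxtimes> tens_split (xs @ ys) zs)))"
    using Inv_Assoc_nat_prefix[of "Id V x" "tens_split xs ys" "Id V ?Z" "Id V x \<boxtimes> tens_split (xs @ ys) zs"]
    by simp
  also have "\<dots> = (Inv V (Assoc V x ?X ?Y) \<boxtimes> Id V ?Z) \<cdot> (Inv V (Assoc V x (?X \<otimes> ?Y) ?Z) \<cdot>
          ((Id V x \<boxtimes> Inv V (Assoc V ?X ?Y ?Z)) \<cdot> (Id V x \<boxtimes> ?r)))"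
    using IH by simp
  also have "\<dots> = Inv V (Assoc V (x \<otimes> ?X) ?Y ?Z) \<cdot> (Inv V (Assoc V x ?X (?Y \<otimes> ?Z)) \<cdot> (Id V x \<boxtimes> ?r))"
    by (rule pentagon_Inv) simp_all
  also have "\<dots> = Inv V (Assoc V (x \<otimes> ?X) ?Y ?Z) \<cdot> (Inv V (Assoc V x ?X (?Y \<otimes> ?Z)) \<cdot>
      ((Id V x \<boxtimes> (Id V ?X \<boxtimes> tens_split ys zs)) \<cdot> (Id V x \<boxtimes> tens_split xs (ys @ zs))))"
    by simp
  also have "\<dots> = Inv V (Assoc V (x \<otimes> ?X) ?Y ?Z) \<cdot> (((Id V x \<boxtimes> Id V ?X) \<boxtimes> tens_split ys zs) \<cdot>
      (Inv V (Assoc V x ?X (tens (ys @ zs))) \<cdot> (Id V x \<boxtimes> tens_split xs (ys @ zs))))"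
    using Inv_Assoc_nat_prefix[of "Id V x" "Id V ?X" "tens_split ys zs" "Id V x \<boxtimes> tens_split xs (ys @ zs)"]
    by (simp del: Tensor_Id interchange interchange_prefix)
  finally show ?case by simp
qed

definition el :: "'a \<Rightarrow> ('a, 'b) elt \<Rightarrow> bool" where
  "el A e \<longleftrightarrow> set (Grade e) \<subseteq> Obj V \<and> Val e \<in> Hom V (tens (Grade e)) A"

definition act :: "'b \<Rightarrow> ('a, 'b) elt \<Rightarrow> ('a, 'b) elt" where
  "act m e = \<lparr>Grade = Grade e, Val = m \<cdot> Val e\<rparr>"

definition pair :: "('a, 'b) elt \<Rightarrow> ('a, 'b) elt \<Rightarrow> ('a, 'b) elt" where
  "pair a b = \<lparr>Grade = Grade a @ Grade b, Val = (Val a \<boxtimes> Val b) \<cdot> tens_split (Grade a) (Grade b)\<rparr>"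

definition unit_elt :: "('a, 'b) elt" where
  "unit_elt = \<lparr>Grade = [], Val = Id V (Unit V)\<rparr>"

definition gen :: "'a \<Rightarrow> ('a, 'b) elt" where
  "gen A = \<lparr>Grade = [A], Val = RUnit V A\<rparr>"

lemma el_Val:
  assumes "el A e"
  shows "set (Grade e) \<subseteq> Obj V" "Val e \<in> Arr V" "Dom V (Val e) = tens (Grade e)" "Cod V (Val e) = A"
  using assms by (simp_all add: el_def in_Hom)

lemma el_Obj: "el A e \<Longrightarrow> A \<in> Obj V"
  using Obj_Cod[OF el_Val(2)] el_Val(4) by metis

lemma el_act [simp]: "m \<in> Arr V \<Longrightarrow> el (Dom V m) e \<Longrightarrow> B = Cod V m \<Longrightarrow> el B (act m e)"
  by (simp add: el_def act_def in_Hom)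

lemma act_Comp [simp]:
  assumes "m \<in> Arr V" "n \<in> Arr V" "Dom V m = Cod V n" "el (Dom V n) e"
  shows "act (m \<cdot> n) e = act m (act n e)"
  using assms by (simp add: act_def el_def in_Hom)

lemma act_Id [simp]: "el A e \<Longrightarrow> act (Id V A) e = e"
  by (simp add: act_def el_def in_Hom)

lemma act_Inv [simp]:
  assumes "iso V m"
  shows "el (Dom V m) e \<Longrightarrow> act (Inv V m) (act m e) = e"
    and "el (Cod V m) e' \<Longrightarrow> act m (act (Inv V m) e') = e'"
  using assms iso_Arr[OF assms] by (simp_all add: act_def el_def in_Hom)

lemma el_pair [simp]: "el A a \<Longrightarrow> el B b \<Longrightarrow> el (A \<otimes> B) (pair a b)"
  by (simp add: el_def pair_def in_Hom)

lemma el_unit [simp]: "el (Unit V) unit_elt"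
  by (simp add: el_def unit_elt_def in_Hom)

lemma el_gen [simp]: "A \<in> Obj V \<Longrightarrow> el A (gen A)"
  by (simp add: el_def gen_def in_Hom)

lemma act_Tensor_arr [simp]:
  assumes "m \<in> Arr V" "n \<in> Arr V" "el (Dom V m) a" "el (Dom V n) b"
  shows "act (m \<boxtimes> n) (pair a b) = pair (act m a) (act n b)"
  using assms by (simp add: act_def pair_def el_def in_Hom)

text \<open>
  The associator is cancelled by the splitting of the grade (\<open>tens_split_assoc\<close>). Together with the
  analogous rules for the unit constraints this removes coherence isomorphisms from all later
  computations.
\<close>

lemma act_Assoc [simp]:
  assumes "el A a" "el B b" "el D d"
  shows "act (Assoc V A B D) (pair (pair a b) d) = pair a (pair b d)"
proof -
  note [simp] = el_Val[OF assms(1)] el_Val[OF assms(2)] el_Val[OF assms(3)]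
  let ?a = "Assoc V (tens (Grade a)) (tens (Grade b)) (tens (Grade d))"
  let ?s = "tens_split (Grade a @ Grade b) (Grade d)"
  let ?t = "tens_split (Grade a) (Grade b) \<boxtimes> Id V (tens (Grade d))"
  let ?u = "(Id V (tens (Grade a)) \<boxtimes> tens_split (Grade b) (Grade d)) \<cdot> tens_split (Grade a) (Grade b @ Grade d)"
  have [simp]: "A \<in> Obj V" "B \<in> Obj V" "D \<in> Obj V" using assms el_Obj by auto
  have "Assoc V A B D \<cdot> (((Val a \<boxtimes> Val b) \<cdot> tens_split (Grade a) (Grade b)) \<boxtimes> Val d) \<cdot> ?s
      = Assoc V A B D \<cdot> ((Val a \<boxtimes> Val b) \<boxtimes> Val d) \<cdot> (?t \<cdot> ?s)"
    by simp
  also have "\<dots> = (Val a \<boxtimes> (Val b \<boxtimes> Val d)) \<cdot> (?a \<cdot> (?t \<cdot> ?s))"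
    using Assoc_nat_prefix[of "Val a" "Val b" "Val d" "?t \<cdot> ?s"] by simp
  also have "?a \<cdot> (?t \<cdot> ?s) = ?u"
    by (simp add: tens_split_assoc)
  finally show ?thesis by (simp add: act_def pair_def)
qed

lemma act_LUnit [simp]:
  assumes "el A a"
  shows "act (LUnit V A) (pair unit_elt a) = a"
proof -
  note [simp] = el_Val[OF assms] el_Obj[OF assms]
  have "LUnit V A \<cdot> ((Id V (Unit V) \<boxtimes> Val a) \<cdot> Inv V (LUnit V (tens (Grade a))))
      = Val a \<cdot> LUnit V (tens (Grade a)) \<cdot> Inv V (LUnit V (tens (Grade a)))"
    using LUnit_nat[of "Val a"] Comp_prefix[OF LUnit_nat[of "Val a"], of "Inv V (LUnit V (tens (Grade a)))"]
    by simp
  then show ?thesis by (simp add: act_def pair_def unit_elt_def)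
qed

lemma act_RUnit [simp]:
  assumes "el A a"
  shows "act (RUnit V A) (pair a unit_elt) = a"
proof -
  note [simp] = el_Val[OF assms] el_Obj[OF assms]
  have "RUnit V A \<cdot> ((Val a \<boxtimes> Id V (Unit V)) \<cdot> tens_split (Grade a) [])
      = Val a \<cdot> RUnit V (tens (Grade a)) \<cdot> tens_split (Grade a) []"
    using RUnit_nat[of "Val a"] Comp_prefix[OF RUnit_nat[of "Val a"], of "tens_split (Grade a) []"]
    by simp
  then show ?thesis by (simp add: act_def pair_def unit_elt_def tens_split_Nil)
qed

lemma act_Inv_LUnit [simp]:
  assumes "el A a"
  shows "act (Inv V (LUnit V A)) a = pair unit_elt a"
proof -
  have "act (Inv V (LUnit V A)) (act (LUnit V A) (pair unit_elt a)) = pair unit_elt a"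
    using assms el_Obj[OF assms] by (intro act_Inv) simp_all
  then show ?thesis by (simp only: act_LUnit[OF assms])
qed

lemma act_Inv_RUnit [simp]:
  assumes "el A a"
  shows "act (Inv V (RUnit V A)) a = pair a unit_elt"
proof -
  have "act (Inv V (RUnit V A)) (act (RUnit V A) (pair a unit_elt)) = pair a unit_elt"
    using assms el_Obj[OF assms] by (intro act_Inv) simp_all
  then show ?thesis by (simp only: act_RUnit[OF assms])
qed

lemma iso_gen [simp]: "A \<in> Obj V \<Longrightarrow> iso V (Val (gen A))"
  by (simp add: gen_def)

lemma iso_unit [simp]: "iso V (Val unit_elt)"
  by (simp add: unit_elt_def)

lemma iso_pair [simp]:
  "el A a \<Longrightarrow> el B b \<Longrightarrow> iso V (Val a) \<Longrightarrow> iso V (Val b) \<Longrightarrow> iso V (Val (pair a b))"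
  by (simp add: pair_def el_def in_Hom)

text \<open>
  Elements whose arrow is invertible, such as the generic ones and their pairings, separate arrows
  because isomorphisms are epimorphisms.
\<close>

lemma arrow_eqI:
  assumes "act m e = act n e" "iso V (Val e)" "m \<in> Arr V" "n \<in> Arr V" "el (Dom V m) e" "el (Dom V n) e"
  shows "m = n"
proof (rule iso_epi[of "Val e"])
  show "m \<cdot> Val e = n \<cdot> Val e" using assms(1) by (simp add: act_def)
qed (use assms(2-) in \<open>simp_all add: el_def in_Hom\<close>)

end

context symmetric_monoidal_category
begin

lemma Sym_simps [simp]:
  assumes "A \<in> Obj V" "B \<in> Obj V"
  shows "Sym V A B \<in> Arr V" "Dom V (Sym V A B) = A \<otimes> B" "Cod V (Sym V A B) = B \<otimes> A"
  using Sym_in[OF assms] by (simp_all add: in_Hom)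

declare Sym_Sym [simp]

lemma Sym_Sym_prefix [simp]:
  "A \<in> Obj V \<Longrightarrow> B \<in> Obj V \<Longrightarrow> k \<in> Arr V \<Longrightarrow> Cod V k = A \<otimes> B \<Longrightarrow> Sym V B A \<cdot> (Sym V A B \<cdot> k) = k"
  using Comp_prefix[OF Sym_Sym[of A B], of k] by simp

lemma iso_Sym [simp]: "A \<in> Obj V \<Longrightarrow> B \<in> Obj V \<Longrightarrow> iso V (Sym V A B)"
  unfolding iso_def by (intro exI[of _ "Sym V B A"] inverse_pairI) simp_all

lemma Sym_nat:
  "f \<in> Arr V \<Longrightarrow> g \<in> Arr V \<Longrightarrow>
    Sym V (Cod V f) (Cod V g) \<cdot> (f \<boxtimes> g) = (g \<boxtimes> f) \<cdot> Sym V (Dom V f) (Dom V g)"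
  by (rule Sym_natural) (simp_all add: in_Hom)

lemma Sym_nat_prefix:
  "f \<in> Arr V \<Longrightarrow> g \<in> Arr V \<Longrightarrow> k \<in> Arr V \<Longrightarrow> Cod V k = Dom V f \<otimes> Dom V g \<Longrightarrow>
    Sym V (Cod V f) (Cod V g) \<cdot> ((f \<boxtimes> g) \<cdot> k) = (g \<boxtimes> f) \<cdot> (Sym V (Dom V f) (Dom V g) \<cdot> k)"
  using Comp_prefix[OF Sym_nat[of f g], of k] by simp

lemma LUnit_Sym:
  assumes [simp]: "A \<in> Obj V"
  shows "LUnit V A \<cdot> Sym V A (Unit V) = RUnit V A"
proof (rule tensor_Unit_faithful)
  let ?I = "Unit V" and ?a = "Assoc V" and ?s = "Sym V"
  have "?s A ?I \<cdot> (RUnit V A \<boxtimes> Id V ?I) = ?s A ?I \<cdot> ((Id V A \<boxtimes> LUnit V ?I) \<cdot> ?a A ?I ?I)"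
    using triangle[of A ?I] by simp
  also have "\<dots> = (LUnit V ?I \<boxtimes> Id V A) \<cdot> (?s A (?I \<otimes> ?I) \<cdot> ?a A ?I ?I)"
    using Sym_nat_prefix[of "Id V A" "LUnit V ?I" "?a A ?I ?I"] by simp
  also have "\<dots> = (LUnit V (?I \<otimes> A) \<cdot> ?a ?I ?I A) \<cdot> (?s A (?I \<otimes> ?I) \<cdot> ?a A ?I ?I)"
    using LUnit_Tensor[of ?I A] by simp
  also have "\<dots> = LUnit V (?I \<otimes> A) \<cdot> (?a ?I ?I A \<cdot> ?s A (?I \<otimes> ?I) \<cdot> ?a A ?I ?I)"
    by simp
  also have "\<dots> = LUnit V (?I \<otimes> A) \<cdot> ((Id V ?I \<boxtimes> ?s A ?I) \<cdot> (?a ?I A ?I \<cdot> (?s A ?I \<boxtimes> Id V ?I)))"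
    using hexagon[of A ?I ?I] by simp
  also have "\<dots> = ?s A ?I \<cdot> (LUnit V (A \<otimes> ?I) \<cdot> (?a ?I A ?I \<cdot> (?s A ?I \<boxtimes> Id V ?I)))"
    using Comp_prefix[OF LUnit_nat[of "?s A ?I"], of "?a ?I A ?I \<cdot> (?s A ?I \<boxtimes> Id V ?I)"] by simp
  also have "LUnit V (A \<otimes> ?I) \<cdot> (?a ?I A ?I \<cdot> (?s A ?I \<boxtimes> Id V ?I))
      = (LUnit V A \<boxtimes> Id V ?I) \<cdot> (?s A ?I \<boxtimes> Id V ?I)"
    using LUnit_Tensor[of A ?I] by (intro Comp_prefix) simp_all
  also have "\<dots> = (LUnit V A \<cdot> ?s A ?I) \<boxtimes> Id V ?I"
    by simp
  finally have *: "?s A ?I \<cdot> ((LUnit V A \<cdot> ?s A ?I) \<boxtimes> Id V ?I) = ?s A ?I \<cdot> (RUnit V A \<boxtimes> Id V ?I)"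
    by simp
  show "(LUnit V A \<cdot> ?s A ?I) \<boxtimes> Id V ?I = RUnit V A \<boxtimes> Id V ?I"
    by (rule iso_mono[OF _ _ _ _ _ *]) simp_all
qed simp_all

lemma RUnit_Sym:
  assumes [simp]: "A \<in> Obj V"
  shows "RUnit V A \<cdot> Sym V (Unit V) A = LUnit V A"
  by (simp flip: LUnit_Sym)

text \<open>
  Both sides reverse the order of three factors. The hexagon moves one factor past two others; the
  dual hexagon needed on the left is its inverse, rearranged.
\<close>

lemma Sym_reverse:
  assumes [simp]: "A \<in> Obj V" "B \<in> Obj V" "D \<in> Obj V"
  shows "(Id V D \<boxtimes> Sym V A B) \<cdot> Sym V (A \<otimes> B) D
    = Assoc V D B A \<cdot> (Sym V B D \<boxtimes> Id V A) \<cdot> Sym V A (B \<otimes> D) \<cdot> Assoc V A B D"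
proof -
  let ?a = "Assoc V" and ?s = "Sym V" and ?i = "Id V"
  have "(?i D \<boxtimes> ?s A B) \<cdot> ?s (A \<otimes> B) D \<cdot> Inv V (?a A B D) \<cdot> (?i A \<boxtimes> ?s D B) \<cdot> ?a A D B \<cdot> (?s D A \<boxtimes> ?i B)
      = (?i D \<boxtimes> ?s A B) \<cdot> ?s (A \<otimes> B) D \<cdot> Inv V (?a A B D) \<cdot> ?a A B D \<cdot> ?s D (A \<otimes> B) \<cdot> ?a D A B"
    using hexagon[of D A B] by simp
  also have "\<dots> = (?i D \<boxtimes> ?s A B) \<cdot> ?a D A B \<cdot> (?s A D \<boxtimes> ?i B) \<cdot> (?s D A \<boxtimes> ?i B)"
    by simp
  also have "\<dots> = (?a D B A \<cdot> ?s A (D \<otimes> B) \<cdot> ?a A D B) \<cdot> (?s D A \<boxtimes> ?i B)"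
    using hexagon[of A D B] by simp
  also have "\<dots> = ?a D B A \<cdot> (?s A (D \<otimes> B) \<cdot> ((?i A \<boxtimes> ?s B D) \<cdot> ((?i A \<boxtimes> ?s D B) \<cdot> ?a A D B \<cdot> (?s D A \<boxtimes> ?i B))))"
    by simp
  also have "\<dots> = ?a D B A \<cdot> ((?s B D \<boxtimes> ?i A) \<cdot> (?s A (B \<otimes> D) \<cdot> ((?i A \<boxtimes> ?s D B) \<cdot> ?a A D B \<cdot> (?s D A \<boxtimes> ?i B))))"
    using Sym_nat_prefix[of "?i A" "?s B D" "(?i A \<boxtimes> ?s D B) \<cdot> ?a A D B \<cdot> (?s D A \<boxtimes> ?i B)"]
    by (simp del: interchange interchange_prefix)
  finally have *: "((?i D \<boxtimes> ?s A B) \<cdot> ?s (A \<otimes> B) D) \<cdot> (Inv V (?a A B D) \<cdot> (?i A \<boxtimes> ?s D B) \<cdot> ?a A D B \<cdot> (?s D A \<boxtimes> ?i B))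
    = (?a D B A \<cdot> (?s B D \<boxtimes> ?i A) \<cdot> ?s A (B \<otimes> D) \<cdot> ?a A B D)
      \<cdot> (Inv V (?a A B D) \<cdot> (?i A \<boxtimes> ?s D B) \<cdot> ?a A D B \<cdot> (?s D A \<boxtimes> ?i B))"
    by simp
  show ?thesis by (rule iso_epi[OF _ _ _ _ _ *]) simp_all
qed

end


section \<open>Enriched categories through generalised morphisms\<close>

text \<open>
  A generalised morphism of a \<open>V\<close>-category is an element of one of its hom-objects. Source and target are
  stored, so that composites can be written without naming the objects.
\<close>

record ('c, 'o, 'm) gmor =
  Src :: 'c
  Tgt :: 'c
  Body :: "('o, 'm) elt"

locale smcc = symmetric_monoidal_closed_category V for V :: "('o, 'm) smc_category" (structure)
begin

definition mor :: "('c, 'o, 'm) vcategory \<Rightarrow> ('c, 'o, 'm) gmor \<Rightarrow> bool" where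
  "mor C f \<longleftrightarrow> Src f \<in> VOb C \<and> Tgt f \<in> VOb C \<and> el (VHom C (Src f) (Tgt f)) (Body f)"

definition gcomp :: "('c, 'o, 'm) gmor \<Rightarrow> ('c, 'o, 'm) vcategory \<Rightarrow> ('c, 'o, 'm) gmor \<Rightarrow> ('c, 'o, 'm) gmor"
    ("(_ \<odot>\<^bsub>_\<^esub>/ _)" [66, 0, 65] 65) where
  "g \<odot>\<^bsub>C\<^esub> f = \<lparr>Src = Src f, Tgt = Tgt g,
     Body = act (VComp C (Src f) (Src g) (Tgt g)) (pair (Body g) (Body f))\<rparr>"

definition pt :: "'c \<Rightarrow> 'c \<Rightarrow> 'm \<Rightarrow> ('c, 'o, 'm) gmor" where
  "pt A B m = \<lparr>Src = A, Tgt = B, Body = \<lparr>Grade = [], Val = m\<rparr>\<rparr>"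

definition gid :: "('c, 'o, 'm) vcategory \<Rightarrow> 'c \<Rightarrow> ('c, 'o, 'm) gmor" where
  "gid C A = pt A A (VId C A)"

definition gmap :: "('c, 'd, 'm) vfunctor \<Rightarrow> ('c, 'o, 'm) gmor \<Rightarrow> ('d, 'o, 'm) gmor" where
  "gmap F f = \<lparr>Src = VMap_ob F (Src f), Tgt = VMap_ob F (Tgt f),
     Body = act (VMap_hom F (Src f) (Tgt f)) (Body f)\<rparr>"

lemma gmor_eqI: "Src f = Src g \<Longrightarrow> Tgt f = Tgt g \<Longrightarrow> Body f = Body g \<Longrightarrow> f = (g :: ('c, 'o, 'm) gmor)"
  by (cases f, cases g) simp

lemma gcomp_simps [simp]: "Src (g \<odot>\<^bsub>C\<^esub> f) = Src f" "Tgt (g \<odot>\<^bsub>C\<^esub> f) = Tgt g"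
  by (simp_all add: gcomp_def)

lemma gid_simps [simp]: "Src (gid C A) = A" "Tgt (gid C A) = A"
  by (simp_all add: gid_def pt_def)

lemma pt_simps [simp]: "Src (pt A B m) = A" "Tgt (pt A B m) = B" "pt A B m = pt A B n \<longleftrightarrow> m = n"
  by (simp_all add: pt_def)

lemma gmap_simps [simp]: "Src (gmap F f) = VMap_ob F (Src f)" "Tgt (gmap F f) = VMap_ob F (Tgt f)"
  by (simp_all add: gmap_def)

lemma Body_pt: "m \<in> Arr V \<Longrightarrow> Dom V m = Unit V \<Longrightarrow> Body (pt A B m) = act m unit_elt"
  by (simp add: pt_def act_def unit_elt_def)

lemma mor_pt: "mor C (pt A B m) \<longleftrightarrow> A \<in> VOb C \<and> B \<in> VOb C \<and> m \<in> Hom V (Unit V) (VHom C A B)"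
  by (simp add: mor_def pt_def el_def in_Hom)

lemma mor_simps [simp]:
  "mor C f \<Longrightarrow> Src f \<in> VOb C" "mor C f \<Longrightarrow> Tgt f \<in> VOb C"
  "mor C f \<Longrightarrow> A = Src f \<Longrightarrow> B = Tgt f \<Longrightarrow> el (VHom C A B) (Body f)"
  by (simp_all add: mor_def)

lemma VId_simps [simp]:
  assumes "vcategory V C" "A \<in> VOb C"
  shows "VId C A \<in> Arr V" "Dom V (VId C A) = Unit V" "Cod V (VId C A) = VHom C A A"
proof -
  have "VId C A \<in> Hom V (Unit V) (VHom C A A)"
    using vcategory.VId_in[OF assms(1)] assms(2) by (auto simp: PiE_iff)
  then show "VId C A \<in> Arr V" "Dom V (VId C A) = Unit V" "Cod V (VId C A) = VHom C A A"
    by (simp_all add: in_Hom)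
qed

lemma vcategory_simps [simp]:
  assumes "vcategory V C" "A \<in> VOb C" "B \<in> VOb C"
  shows "VHom C A B \<in> Obj V"
    and "D \<in> VOb C \<Longrightarrow> VComp C A B D \<in> Arr V"
    and "D \<in> VOb C \<Longrightarrow> Dom V (VComp C A B D) = VHom C B D \<otimes> VHom C A B"
    and "D \<in> VOb C \<Longrightarrow> Cod V (VComp C A B D) = VHom C A D"
proof -
  interpret vcategory V C by fact
  show "VHom C A B \<in> Obj V" using VHom_in assms by (auto simp: PiE_iff)
  assume "D \<in> VOb C"
  then have "VComp C A B D \<in> Hom V (VHom C B D \<otimes> VHom C A B) (VHom C A D)"
    using VComp_in assms by (auto simp: PiE_iff)
  then show "VComp C A B D \<in> Arr V" "Dom V (VComp C A B D) = VHom C B D \<otimes> VHom C A B"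
    "Cod V (VComp C A B D) = VHom C A D"
    by (simp_all add: in_Hom)
qed

lemma mor_gcomp [simp]:
  "vcategory V C \<Longrightarrow> mor C f \<Longrightarrow> mor C g \<Longrightarrow> Src g = Tgt f \<Longrightarrow> mor C (g \<odot>\<^bsub>C\<^esub> f)"
  by (simp add: mor_def gcomp_def del: mor_simps)

lemma mor_gid [simp]: "vcategory V C \<Longrightarrow> A \<in> VOb C \<Longrightarrow> mor C (gid C A)"
  by (simp add: gid_def mor_pt in_Hom)

text \<open>
  The associator in the axiom of a \<open>V\<close>-category is absorbed by the pairing of elements, which leaves
  strict associativity.
\<close>

lemma gcomp_assoc [simp]:
  assumes "vcategory V C" "mor C f" "mor C g" "mor C h" "Src g = Tgt f" "Src h = Tgt g"
  shows "(h \<odot>\<^bsub>C\<^esub> g) \<odot>\<^bsub>C\<^esub> f = h \<odot>\<^bsub>C\<^esub> (g \<odot>\<^bsub>C\<^esub> f)"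
proof (rule gmor_eqI)
  let ?p = "pair (pair (Body h) (Body g)) (Body f)"
  let ?A = "Src f" and ?B = "Tgt f" and ?D = "Tgt g" and ?E = "Tgt h"
  have "act (VComp C ?A ?B ?E \<cdot> (VComp C ?B ?D ?E \<boxtimes> Id V (VHom C ?A ?B))) ?p
     = act (VComp C ?A ?D ?E \<cdot> (Id V (VHom C ?D ?E) \<boxtimes> VComp C ?A ?B ?D) \<cdot>
        Assoc V (VHom C ?D ?E) (VHom C ?B ?D) (VHom C ?A ?B)) ?p"
    using vcategory.VComp_assoc[OF assms(1), of ?A ?B ?D ?E] assms by simp
  then show "Body ((h \<odot>\<^bsub>C\<^esub> g) \<odot>\<^bsub>C\<^esub> f) = Body (h \<odot>\<^bsub>C\<^esub> (g \<odot>\<^bsub>C\<^esub> f))"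
    using assms by (simp add: gcomp_def)
qed simp_all

lemma gid_gcomp [simp]:
  assumes "vcategory V C" "mor C f" "A = Tgt f"
  shows "gid C A \<odot>\<^bsub>C\<^esub> f = f"
proof (rule gmor_eqI)
  let ?A = "Src f" and ?B = "Tgt f"
  have "act (VComp C ?A ?B ?B \<cdot> (VId C ?B \<boxtimes> Id V (VHom C ?A ?B))) (pair unit_elt (Body f))
      = act (LUnit V (VHom C ?A ?B)) (pair unit_elt (Body f))"
    using vcategory.VId_VComp[OF assms(1), of ?A ?B] assms by simp
  then show "Body (gid C A \<odot>\<^bsub>C\<^esub> f) = Body f"
    using assms by (simp add: gcomp_def gid_def Body_pt)
qed (use assms in simp_all)

lemma gcomp_gid [simp]:
  assumes "vcategory V C" "mor C f" "A = Src f"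
  shows "f \<odot>\<^bsub>C\<^esub> gid C A = f"
proof (rule gmor_eqI)
  let ?A = "Src f" and ?B = "Tgt f"
  have "act (VComp C ?A ?A ?B \<cdot> (Id V (VHom C ?A ?B) \<boxtimes> VId C ?A)) (pair (Body f) unit_elt)
      = act (RUnit V (VHom C ?A ?B)) (pair (Body f) unit_elt)"
    using vcategory.VComp_VId[OF assms(1), of ?A ?B] assms by simp
  then show "Body (f \<odot>\<^bsub>C\<^esub> gid C A) = Body f"
    using assms by (simp add: gcomp_def gid_def Body_pt)
qed (use assms in simp_all)

lemma gcomp_prefix:
  assumes "g \<odot>\<^bsub>C\<^esub> f = h" "vcategory V C" "mor C f" "mor C g" "mor C k" "Src g = Tgt f" "Src f = Tgt k"
  shows "g \<odot>\<^bsub>C\<^esub> (f \<odot>\<^bsub>C\<^esub> k) = h \<odot>\<^bsub>C\<^esub> k"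
  using gcomp_assoc[of C k f g] assms by simp

text \<open>
  Arrows out of a hom-object, or out of a tensor product of two, are determined by their action on
  generalised morphisms, because the generic ones are among these.
\<close>

lemma hom_arrow_eqI:
  assumes "m \<in> Hom V (VHom C A B) X" "n \<in> Hom V (VHom C A B) X" "A \<in> VOb C" "B \<in> VOb C"
    and *: "\<And>f. mor C f \<Longrightarrow> Src f = A \<Longrightarrow> Tgt f = B \<Longrightarrow> act m (Body f) = act n (Body f)"
  shows "m = n"
proof -
  have H: "VHom C A B \<in> Obj V" using assms(1) Dom_in[of m] by (metis in_Hom)
  let ?f = "\<lparr>Src = A, Tgt = B, Body = gen (VHom C A B)\<rparr>"
  show ?thesis
    using *[of ?f] H assms(1-4) by (intro arrow_eqI[of m "Body ?f" n]) (simp_all add: mor_def in_Hom del: mor_simps)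
qed

lemma hom_pair_arrow_eqI:
  assumes "m \<in> Hom V (VHom C B D \<otimes> VHom C A B) X" "n \<in> Hom V (VHom C B D \<otimes> VHom C A B) X"
    and "vcategory V C" "A \<in> VOb C" "B \<in> VOb C" "D \<in> VOb C"
    and *: "\<And>f g. mor C f \<Longrightarrow> mor C g \<Longrightarrow> Src f = A \<Longrightarrow> Tgt f = B \<Longrightarrow> Src g = B \<Longrightarrow> Tgt g = D \<Longrightarrow>
      act m (pair (Body g) (Body f)) = act n (pair (Body g) (Body f))"
  shows "m = n"
proof -
  let ?f = "\<lparr>Src = A, Tgt = B, Body = gen (VHom C A B)\<rparr>"
  let ?g = "\<lparr>Src = B, Tgt = D, Body = gen (VHom C B D)\<rparr>"
  show ?thesis
    using *[of ?f ?g] assms(1-6)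
    by (intro arrow_eqI[of m "pair (Body ?g) (Body ?f)" n])
      (simp_all add: mor_def in_Hom iso_pair[where A = "VHom C B D" and B = "VHom C A B"] del: mor_simps)
qed

text \<open>
  Each axiom of a \<open>V\<close>-category equates two arrows out of a tensor product of hom-objects, and the
  pairing of the generic morphisms separates such arrows.
\<close>

lemma vcategoryI:
  fixes C :: "('c, 'o, 'm) vcategory"
  assumes H: "VHom C \<in> VOb C \<rightarrow>\<^sub>E VOb C \<rightarrow>\<^sub>E Obj V"
    and M: "VComp C \<in> (\<Pi>\<^sub>E A\<in>VOb C. \<Pi>\<^sub>E B\<in>VOb C. \<Pi>\<^sub>E D\<in>VOb C.
      Hom V (VHom C B D \<otimes> VHom C A B) (VHom C A D))"
    and I: "VId C \<in> (\<Pi>\<^sub>E A\<in>VOb C. Hom V (Unit V) (VHom C A A))"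
    and assoc: "\<And>f g h. mor C f \<Longrightarrow> mor C g \<Longrightarrow> mor C h \<Longrightarrow> Src g = Tgt f \<Longrightarrow> Src h = Tgt g \<Longrightarrow>
      (h \<odot>\<^bsub>C\<^esub> g) \<odot>\<^bsub>C\<^esub> f = h \<odot>\<^bsub>C\<^esub> (g \<odot>\<^bsub>C\<^esub> f)"
    and lunit: "\<And>f. mor C f \<Longrightarrow> gid C (Tgt f) \<odot>\<^bsub>C\<^esub> f = f"
    and runit: "\<And>f. mor C f \<Longrightarrow> f \<odot>\<^bsub>C\<^esub> gid C (Src f) = f"
  shows "vcategory V C"
proof
  have [simp]: "VHom C A B \<in> Obj V" if "A \<in> VOb C" "B \<in> VOb C" for A B
    using H that by (auto simp: PiE_iff)
  have "VComp C A B D \<in> Hom V (VHom C B D \<otimes> VHom C A B) (VHom C A D)"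
    if "A \<in> VOb C" "B \<in> VOb C" "D \<in> VOb C" for A B D
    using M that by (auto simp: PiE_iff)
  then have [simp]: "VComp C A B D \<in> Arr V" "Dom V (VComp C A B D) = VHom C B D \<otimes> VHom C A B"
    "Cod V (VComp C A B D) = VHom C A D" if "A \<in> VOb C" "B \<in> VOb C" "D \<in> VOb C" for A B D
    using that by (simp_all add: in_Hom)
  have "VId C A \<in> Hom V (Unit V) (VHom C A A)" if "A \<in> VOb C" for A
    using I that by (auto simp: PiE_iff)
  then have [simp]: "VId C A \<in> Arr V" "Dom V (VId C A) = Unit V" "Cod V (VId C A) = VHom C A A"
    if "A \<in> VOb C" for A
    using that by (simp_all add: in_Hom)
  define u where "u A B = \<lparr>Src = A, Tgt = B, Body = gen (VHom C A B)\<rparr>" for A B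
  have u [simp]: "Src (u A B) = A" "Tgt (u A B) = B" "Body (u A B) = gen (VHom C A B)" for A B
    by (simp_all add: u_def)
  have [simp]: "mor C (u A B)" if "A \<in> VOb C" "B \<in> VOb C" for A B
    using that by (simp add: mor_def del: mor_simps)
  show "VComp C A B E \<cdot> (VComp C B D E \<boxtimes> Id V (VHom C A B)) =
      VComp C A D E \<cdot> (Id V (VHom C D E) \<boxtimes> VComp C A B D) \<cdot>
        Assoc V (VHom C D E) (VHom C B D) (VHom C A B)"
    if [simp]: "A \<in> VOb C" "B \<in> VOb C" "D \<in> VOb C" "E \<in> VOb C" for A B D E
  proof (rule arrow_eqI)
    let ?p = "pair (pair (gen (VHom C D E)) (gen (VHom C B D))) (gen (VHom C A B))"
    show "act (VComp C A B E \<cdot> (VComp C B D E \<boxtimes> Id V (VHom C A B))) ?p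
       = act (VComp C A D E \<cdot> (Id V (VHom C D E) \<boxtimes> VComp C A B D) \<cdot>
          Assoc V (VHom C D E) (VHom C B D) (VHom C A B)) ?p"
      using arg_cong[OF assoc[of "u A B" "u B D" "u D E"], of Body] by (simp add: gcomp_def)
    show "iso V (Val ?p)"
      by (simp add: iso_pair[where A = "VHom C D E \<otimes> VHom C B D" and B = "VHom C A B"]
          iso_pair[where A = "VHom C D E" and B = "VHom C B D"])
  qed simp_all
  show "VComp C A B B \<cdot> (VId C B \<boxtimes> Id V (VHom C A B)) = LUnit V (VHom C A B)"
    if [simp]: "A \<in> VOb C" "B \<in> VOb C" for A B
  proof (rule arrow_eqI)
    let ?p = "pair unit_elt (gen (VHom C A B))"
    show "act (VComp C A B B \<cdot> (VId C B \<boxtimes> Id V (VHom C A B))) ?p = act (LUnit V (VHom C A B)) ?p"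
      using arg_cong[OF lunit[of "u A B"], of Body] by (simp add: gcomp_def gid_def Body_pt)
    show "iso V (Val ?p)"
      by (simp add: iso_pair[where A = "Unit V" and B = "VHom C A B"])
  qed simp_all
  show "VComp C A A B \<cdot> (Id V (VHom C A B) \<boxtimes> VId C A) = RUnit V (VHom C A B)"
    if [simp]: "A \<in> VOb C" "B \<in> VOb C" for A B
  proof (rule arrow_eqI)
    let ?p = "pair (gen (VHom C A B)) unit_elt"
    show "act (VComp C A A B \<cdot> (Id V (VHom C A B) \<boxtimes> VId C A)) ?p = act (RUnit V (VHom C A B)) ?p"
      using arg_cong[OF runit[of "u A B"], of Body] by (simp add: gcomp_def gid_def Body_pt)
    show "iso V (Val ?p)"
      by (simp add: iso_pair[where B = "Unit V" and A = "VHom C A B"])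
  qed simp_all
qed (use H M I in simp_all)

lemma vfunctor_simps:
  assumes "vfunctor V C D F"
  shows "vcategory V C" "vcategory V D"
    and "A \<in> VOb C \<Longrightarrow> VMap_ob F A \<in> VOb D"
    and "A \<in> VOb C \<Longrightarrow> B \<in> VOb C \<Longrightarrow> VMap_hom F A B \<in> Arr V"
    and "A \<in> VOb C \<Longrightarrow> B \<in> VOb C \<Longrightarrow> Dom V (VMap_hom F A B) = VHom C A B"
    and "A \<in> VOb C \<Longrightarrow> B \<in> VOb C \<Longrightarrow> Cod V (VMap_hom F A B) = VHom D (VMap_ob F A) (VMap_ob F B)"
proof -
  interpret vfunctor V C D F by fact
  show "vcategory V C" "vcategory V D" by unfold_locales
  show "VMap_ob F A \<in> VOb D" if "A \<in> VOb C" using VMap_ob_in that by (auto simp: PiE_iff)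
  have *: "VMap_hom F A B \<in> Hom V (VHom C A B) (VHom D (VMap_ob F A) (VMap_ob F B))"
    if "A \<in> VOb C" "B \<in> VOb C" using VMap_hom_in that by (auto simp: PiE_iff)
  show "VMap_hom F A B \<in> Arr V" "Dom V (VMap_hom F A B) = VHom C A B"
    "Cod V (VMap_hom F A B) = VHom D (VMap_ob F A) (VMap_ob F B)"
    if "A \<in> VOb C" "B \<in> VOb C" using * that by (simp_all add: in_Hom)
qed

lemma mor_gmap: "vfunctor V C D F \<Longrightarrow> mor C f \<Longrightarrow> mor D (gmap F f)"
  by (simp add: mor_def gmap_def vfunctor_simps del: mor_simps)

lemma gmap_gcomp:
  assumes "vfunctor V C D F" "mor C f" "mor C g" "Src g = Tgt f"
  shows "gmap F (g \<odot>\<^bsub>C\<^esub> f) = gmap F g \<odot>\<^bsub>D\<^esub> gmap F f"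
proof (rule gmor_eqI)
  note [simp] = vfunctor_simps[OF assms(1)]
  have "act (VMap_hom F (Src f) (Tgt g) \<cdot> VComp C (Src f) (Tgt f) (Tgt g)) (pair (Body g) (Body f))
      = act (VComp D (VMap_ob F (Src f)) (VMap_ob F (Tgt f)) (VMap_ob F (Tgt g)) \<cdot>
        (VMap_hom F (Tgt f) (Tgt g) \<boxtimes> VMap_hom F (Src f) (Tgt f))) (pair (Body g) (Body f))"
    using vfunctor.VMap_VComp[OF assms(1)] assms by simp
  then show "Body (gmap F (g \<odot>\<^bsub>C\<^esub> f)) = Body (gmap F g \<odot>\<^bsub>D\<^esub> gmap F f)"
    using assms by (simp add: gcomp_def gmap_def)
qed simp_all

lemma gmap_gid:
  assumes "vfunctor V C D F" "A \<in> VOb C"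
  shows "gmap F (gid C A) = gid D (VMap_ob F A)"
  using vfunctor.VMap_VId[OF assms] by (simp add: gmap_def gid_def pt_def act_def)

lemma vfunctorI:
  assumes C: "vcategory V C" and D: "vcategory V D"
    and ob: "VMap_ob F \<in> VOb C \<rightarrow>\<^sub>E VOb D"
    and hom: "VMap_hom F \<in> (\<Pi>\<^sub>E A\<in>VOb C. \<Pi>\<^sub>E B\<in>VOb C.
      Hom V (VHom C A B) (VHom D (VMap_ob F A) (VMap_ob F B)))"
    and comp: "\<And>f g. mor C f \<Longrightarrow> mor C g \<Longrightarrow> Src g = Tgt f \<Longrightarrow>
      gmap F (g \<odot>\<^bsub>C\<^esub> f) = gmap F g \<odot>\<^bsub>D\<^esub> gmap F f"
    and ident: "\<And>A. A \<in> VOb C \<Longrightarrow> gmap F (gid C A) = gid D (VMap_ob F A)"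
  shows "vfunctor V C D F"
proof -
  have [simp]: "VMap_ob F A \<in> VOb D" if "A \<in> VOb C" for A using ob that by (auto simp: PiE_iff)
  have "VMap_hom F A B \<in> Hom V (VHom C A B) (VHom D (VMap_ob F A) (VMap_ob F B))"
    if "A \<in> VOb C" "B \<in> VOb C" for A B using hom that by (auto simp: PiE_iff)
  then have [simp]: "VMap_hom F A B \<in> Arr V" "Dom V (VMap_hom F A B) = VHom C A B"
    "Cod V (VMap_hom F A B) = VHom D (VMap_ob F A) (VMap_ob F B)"
    if "A \<in> VOb C" "B \<in> VOb C" for A B using that by (simp_all add: in_Hom)
  note [simp] = C D
  have "VMap_hom F A E \<cdot> VComp C A B E =
      VComp D (VMap_ob F A) (VMap_ob F B) (VMap_ob F E) \<cdot> (VMap_hom F B E \<boxtimes> VMap_hom F A B)"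
    if [simp]: "A \<in> VOb C" "B \<in> VOb C" "E \<in> VOb C" for A B E
  proof (rule hom_pair_arrow_eqI[of _ C B E A "VHom D (VMap_ob F A) (VMap_ob F E)"])
    fix f g assume [simp]: "mor C f" "mor C g" and *: "Src f = A" "Tgt f = B" "Src g = B" "Tgt g = E"
    show "act (VMap_hom F A E \<cdot> VComp C A B E) (pair (Body g) (Body f))
       = act (VComp D (VMap_ob F A) (VMap_ob F B) (VMap_ob F E) \<cdot> (VMap_hom F B E \<boxtimes> VMap_hom F A B))
           (pair (Body g) (Body f))"
      using arg_cong[OF comp[of f g], of Body] * by (simp add: gcomp_def gmap_def)
  qed (simp_all add: in_Hom)
  moreover have "VMap_hom F A A \<cdot> VId C A = VId D (VMap_ob F A)" if "A \<in> VOb C" for A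
    using ident[OF that] that by (simp add: gmap_def gid_def pt_def act_def)
  ultimately show ?thesis
    using C D ob hom unfolding vfunctor_def vfunctor_axioms_def by simp
qed

lemma vfunctor_eqI:
  assumes F: "vfunctor V C D F" and G: "vfunctor V C D G"
    and eq: "\<And>A. A \<in> VOb C \<Longrightarrow> VMap_ob F A = VMap_ob G A" "\<And>f. mor C f \<Longrightarrow> gmap F f = gmap G f"
  shows "F = G"
proof -
  note [simp] = vfunctor_simps[OF F] vfunctor_simps(3-6)[OF G] eq(1)
  have "VMap_ob F = VMap_ob G"
    using vfunctor.VMap_ob_in[OF F] vfunctor.VMap_ob_in[OF G] eq(1) by (rule PiE_ext)
  moreover have "VMap_hom F = VMap_hom G"
  proof (rule extensionalityI)
    show "VMap_hom F \<in> extensional (VOb C)" "VMap_hom G \<in> extensional (VOb C)"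
      using vfunctor.VMap_hom_in[OF F] vfunctor.VMap_hom_in[OF G] by (simp_all add: PiE_def)
    fix A assume [simp]: "A \<in> VOb C"
    show "VMap_hom F A = VMap_hom G A"
    proof (rule extensionalityI)
      show "VMap_hom F A \<in> extensional (VOb C)" "VMap_hom G A \<in> extensional (VOb C)"
        using vfunctor.VMap_hom_in[OF F] vfunctor.VMap_hom_in[OF G] by (simp_all add: PiE_iff)
      fix B assume [simp]: "B \<in> VOb C"
      show "VMap_hom F A B = VMap_hom G A B"
      proof (rule hom_arrow_eqI[of _ C A B "VHom D (VMap_ob F A) (VMap_ob F B)"])
        show "act (VMap_hom F A B) (Body f) = act (VMap_hom G A B) (Body f)"
          if "mor C f" "Src f = A" "Tgt f = B" for f
          using arg_cong[OF eq(2)[OF that(1)], of Body] that by (simp add: gmap_def)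
      qed (simp_all add: in_Hom)
    qed
  qed
  ultimately show ?thesis by simp
qed

lemma vfunctor_id_simps [simp]: "A \<in> VOb C \<Longrightarrow> VMap_ob (vfunctor_id V C) A = A"
  by (simp add: vfunctor_id_def)

lemma gmap_vfunctor_id [simp]: "mor C f \<Longrightarrow> gmap (vfunctor_id V C) f = f"
  by (intro gmor_eqI) (simp_all add: gmap_def vfunctor_id_def)

lemma vfunctor_vfunctor_id: "vcategory V C \<Longrightarrow> vfunctor V C C (vfunctor_id V C)"
  by (intro vfunctorI) (simp_all add: vfunctor_id_def in_Hom gmap_vfunctor_id[unfolded vfunctor_id_def])

lemma vfunctor_comp_simps [simp]:
  "A \<in> VOb C \<Longrightarrow> VMap_ob (vfunctor_comp V C G F) A = VMap_ob G (VMap_ob F A)"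
  by (simp add: vfunctor_comp_def)

lemma gmap_vfunctor_comp:
  assumes F: "vfunctor V C D F" and G: "vfunctor V D E G" and "mor C f"
  shows "gmap (vfunctor_comp V C G F) f = gmap G (gmap F f)"
  using assms(3) by (intro gmor_eqI)
    (simp_all add: gmap_def vfunctor_comp_def vfunctor_simps[OF F] vfunctor_simps[OF G])

lemma vfunctor_vfunctor_comp:
  assumes F: "vfunctor V C D F" and G: "vfunctor V D E G"
  shows "vfunctor V C E (vfunctor_comp V C G F)"
proof (rule vfunctorI)
  note [simp] = vfunctor_simps[OF F] vfunctor_simps[OF G] gmap_vfunctor_comp[OF F G]
    mor_gmap[OF F] gmap_gcomp[OF F] gmap_gcomp[OF G] gmap_gid[OF F] gmap_gid[OF G]
  show "vcategory V C" "vcategory V E" by simp_all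
  show "VMap_ob (vfunctor_comp V C G F) \<in> VOb C \<rightarrow>\<^sub>E VOb E" by (simp add: vfunctor_comp_def)
  show "VMap_hom (vfunctor_comp V C G F) \<in> (\<Pi>\<^sub>E A\<in>VOb C. \<Pi>\<^sub>E B\<in>VOb C. Hom V (VHom C A B)
      (VHom E (VMap_ob (vfunctor_comp V C G F) A) (VMap_ob (vfunctor_comp V C G F) B)))"
    by (simp add: vfunctor_comp_def in_Hom)
  fix f g assume "mor C f" "mor C g" "Src g = Tgt f"
  then show "gmap (vfunctor_comp V C G F) (g \<odot>\<^bsub>C\<^esub> f)
      = gmap (vfunctor_comp V C G F) g \<odot>\<^bsub>E\<^esub> gmap (vfunctor_comp V C G F) f"
    by simp
next
  note [simp] = vfunctor_simps[OF F] gmap_gid[OF F] gmap_gid[OF G] gmap_vfunctor_comp[OF F G]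
  fix A assume "A \<in> VOb C"
  then show "gmap (vfunctor_comp V C G F) (gid C A) = gid E (VMap_ob (vfunctor_comp V C G F) A)"
    by simp
qed

lemma vfunctor_comp_assoc:
  assumes F: "vfunctor V A B F" and G: "vfunctor V B C G" and H: "vfunctor V C D H"
  shows "vfunctor_comp V A (vfunctor_comp V B H G) F = vfunctor_comp V A H (vfunctor_comp V A G F)"
  by (rule vfunctor_eqI[OF vfunctor_vfunctor_comp[OF F vfunctor_vfunctor_comp[OF G H]]
        vfunctor_vfunctor_comp[OF vfunctor_vfunctor_comp[OF F G] H]])
    (simp_all add: gmap_vfunctor_comp[OF F vfunctor_vfunctor_comp[OF G H]] gmap_vfunctor_comp[OF F G]
      gmap_vfunctor_comp[OF vfunctor_vfunctor_comp[OF F G] H] gmap_vfunctor_comp[OF G H]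
      mor_gmap[OF F] vfunctor_simps[OF F])

lemma vfunctor_id_comp:
  assumes F: "vfunctor V C D F"
  shows "vfunctor_comp V C F (vfunctor_id V C) = F" "vfunctor_comp V C (vfunctor_id V D) F = F"
proof -
  note I = vfunctor_vfunctor_id[OF vfunctor_simps(1)[OF F]]
  note J = vfunctor_vfunctor_id[OF vfunctor_simps(2)[OF F]]
  show "vfunctor_comp V C F (vfunctor_id V C) = F"
    by (rule vfunctor_eqI[OF vfunctor_vfunctor_comp[OF I F] F]) (simp_all add: gmap_vfunctor_comp[OF I F])
  show "vfunctor_comp V C (vfunctor_id V D) F = F"
    by (rule vfunctor_eqI[OF vfunctor_vfunctor_comp[OF F J] F])
      (simp_all add: gmap_vfunctor_comp[OF F J] vfunctor_simps[OF F] mor_gmap[OF F])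
qed

text \<open>The component at \<open>A\<close> of a family \<open>\<alpha> : F \<rightarrow> G\<close>, as a generalised morphism of empty grade.\<close>

definition cpt :: "('c, 'd, 'm) vfunctor \<Rightarrow> ('c, 'd, 'm) vfunctor \<Rightarrow> ('c \<Rightarrow> 'm) \<Rightarrow> 'c \<Rightarrow> ('d, 'o, 'm) gmor" where
  "cpt F G \<alpha> A = pt (VMap_ob F A) (VMap_ob G A) (\<alpha> A)"

lemma cpt_simps [simp]: "Src (cpt F G \<alpha> A) = VMap_ob F A" "Tgt (cpt F G \<alpha> A) = VMap_ob G A"
  by (simp_all add: cpt_def)

lemma mor_cpt:
  assumes "vnat V C D F G \<alpha>" "A \<in> VOb C"
  shows "mor D (cpt F G \<alpha> A)"
proof -
  interpret vnat V C D F G \<alpha> by fact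
  have "\<alpha> A \<in> Hom V (Unit V) (VHom D (VMap_ob F A) (VMap_ob G A))"
    using component_in assms(2) by (auto simp: PiE_iff)
  then show ?thesis
    using assms(2) vfunctor_simps(3)[OF F.vfunctor_axioms] vfunctor_simps(3)[OF G.vfunctor_axioms]
    by (simp add: cpt_def mor_pt)
qed

text \<open>
  In the naturality condition the inverse unit constraint pairs a morphism with the unit element, on
  which the component then acts; this is composition with the component as a morphism of empty grade.
\<close>

lemma naturality_square:
  assumes F: "vfunctor V C D F" and G: "vfunctor V C D G"
    and \<alpha>: "\<And>A. A \<in> VOb C \<Longrightarrow> mor D (cpt F G \<alpha> A)" and f: "mor C f"
  shows "cpt F G \<alpha> (Tgt f) \<odot>\<^bsub>D\<^esub> gmap F f = \<lparr>Src = VMap_ob F (Src f), Tgt = VMap_ob G (Tgt f),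
      Body = act (VComp D (VMap_ob F (Src f)) (VMap_ob F (Tgt f)) (VMap_ob G (Tgt f)) \<cdot>
        (\<alpha> (Tgt f) \<boxtimes> VMap_hom F (Src f) (Tgt f)) \<cdot> Inv V (LUnit V (VHom C (Src f) (Tgt f)))) (Body f)\<rparr>"
      (is "_ = ?l")
    and "gmap G f \<odot>\<^bsub>D\<^esub> cpt F G \<alpha> (Src f) = \<lparr>Src = VMap_ob F (Src f), Tgt = VMap_ob G (Tgt f),
      Body = act (VComp D (VMap_ob F (Src f)) (VMap_ob G (Src f)) (VMap_ob G (Tgt f)) \<cdot>
        (VMap_hom G (Src f) (Tgt f) \<boxtimes> \<alpha> (Src f)) \<cdot> Inv V (RUnit V (VHom C (Src f) (Tgt f)))) (Body f)\<rparr>"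
      (is "_ = ?r")
proof -
  note [simp] = vfunctor_simps[OF F] vfunctor_simps[OF G]
  have *: "\<alpha> A \<in> Arr V" "Dom V (\<alpha> A) = Unit V" "Cod V (\<alpha> A) = VHom D (VMap_ob F A) (VMap_ob G A)"
    if "A \<in> VOb C" for A using \<alpha>[OF that] by (simp_all add: cpt_def mor_pt in_Hom)
  show "cpt F G \<alpha> (Tgt f) \<odot>\<^bsub>D\<^esub> gmap F f = ?l"
    using f by (intro gmor_eqI) (simp_all add: gcomp_def gmap_def cpt_def * Body_pt)
  show "gmap G f \<odot>\<^bsub>D\<^esub> cpt F G \<alpha> (Src f) = ?r"
    using f by (intro gmor_eqI) (simp_all add: gcomp_def gmap_def cpt_def * Body_pt)
qed

lemma cpt_natural:
  assumes \<alpha>: "vnat V C D F G \<alpha>" and f: "mor C f"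
  shows "cpt F G \<alpha> (Tgt f) \<odot>\<^bsub>D\<^esub> gmap F f = gmap G f \<odot>\<^bsub>D\<^esub> cpt F G \<alpha> (Src f)"
proof -
  interpret vnat V C D F G \<alpha> by fact
  show ?thesis
    using f vnaturality[of "Src f" "Tgt f"]
    by (simp add: naturality_square[OF F.vfunctor_axioms G.vfunctor_axioms mor_cpt[OF \<alpha>] f])
qed

lemma vnatI:
  assumes F: "vfunctor V C D F" and G: "vfunctor V C D G" and ext: "\<alpha> \<in> extensional (VOb C)"
    and \<alpha>: "\<And>A. A \<in> VOb C \<Longrightarrow> mor D (cpt F G \<alpha> A)"
    and nat: "\<And>f. mor C f \<Longrightarrow> cpt F G \<alpha> (Tgt f) \<odot>\<^bsub>D\<^esub> gmap F f = gmap G f \<odot>\<^bsub>D\<^esub> cpt F G \<alpha> (Src f)"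
  shows "vnat V C D F G \<alpha>"
proof -
  note [simp] = vfunctor_simps[OF F] vfunctor_simps[OF G]
  have *: "\<alpha> A \<in> Hom V (Unit V) (VHom D (VMap_ob F A) (VMap_ob G A))"
    if "A \<in> VOb C" for A using \<alpha>[OF that] by (simp add: cpt_def mor_pt)
  then have [simp]: "\<alpha> A \<in> Arr V" "Dom V (\<alpha> A) = Unit V" "Cod V (\<alpha> A) = VHom D (VMap_ob F A) (VMap_ob G A)"
    if "A \<in> VOb C" for A using that by (simp_all add: in_Hom)
  have "VComp D (VMap_ob F A) (VMap_ob F B) (VMap_ob G B) \<cdot> (\<alpha> B \<boxtimes> VMap_hom F A B) \<cdot>
        Inv V (LUnit V (VHom C A B)) =
      VComp D (VMap_ob F A) (VMap_ob G A) (VMap_ob G B) \<cdot> (VMap_hom G A B \<boxtimes> \<alpha> A) \<cdot>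
        Inv V (RUnit V (VHom C A B))" if [simp]: "A \<in> VOb C" "B \<in> VOb C" for A B
  proof (rule hom_arrow_eqI[of _ C A B "VHom D (VMap_ob F A) (VMap_ob G B)"])
    fix f assume f: "mor C f" "Src f = A" "Tgt f = B"
    show "act (VComp D (VMap_ob F A) (VMap_ob F B) (VMap_ob G B) \<cdot> (\<alpha> B \<boxtimes> VMap_hom F A B) \<cdot>
        Inv V (LUnit V (VHom C A B))) (Body f) =
      act (VComp D (VMap_ob F A) (VMap_ob G A) (VMap_ob G B) \<cdot> (VMap_hom G A B \<boxtimes> \<alpha> A) \<cdot>
        Inv V (RUnit V (VHom C A B))) (Body f)"
      using nat[OF f(1)] unfolding f(2,3)[symmetric]
      by (simp add: naturality_square[OF F G \<alpha> f(1)])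
  qed (simp_all add: in_Hom)
  moreover have "\<alpha> \<in> (\<Pi>\<^sub>E A\<in>VOb C. Hom V (Unit V) (VHom D (VMap_ob F A) (VMap_ob G A)))"
    using * ext by (simp add: PiE_iff)
  ultimately show ?thesis
    using F G unfolding vnat_def vnat_axioms_def by simp
qed

lemma vnat_extensional: "vnat V C D F G \<alpha> \<Longrightarrow> \<alpha> \<in> extensional (VOb C)"
  using vnat.component_in by (fastforce simp: PiE_iff)

lemma family_eqI:
  assumes "\<alpha> \<in> extensional (VOb C)" "\<beta> \<in> extensional (VOb C)"
    and "\<And>A. A \<in> VOb C \<Longrightarrow> cpt F G \<alpha> A = cpt F G \<beta> A"
  shows "\<alpha> = \<beta>"
  using assms by (intro extensionalityI[of _ "VOb C"]) (simp_all add: cpt_def)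

lemma vnat_id_extensional [simp]: "vnat_id C D F \<in> extensional (VOb C)"
  by (simp add: vnat_id_def)

lemma vnat_comp_extensional [simp]: "vnat_comp V C D F G H \<beta> \<alpha> \<in> extensional (VOb C)"
  by (simp add: vnat_comp_def)

lemma cpt_vnat_id: "A \<in> VOb C \<Longrightarrow> cpt F F (vnat_id C D F) A = gid D (VMap_ob F A)"
  by (simp add: cpt_def vnat_id_def gid_def)

lemma cpt_vnat_comp:
  "A \<in> VOb C \<Longrightarrow> cpt F H (vnat_comp V C D F G H \<beta> \<alpha>) A = cpt G H \<beta> A \<odot>\<^bsub>D\<^esub> cpt F G \<alpha> A"
  by (simp add: cpt_def vnat_comp_def gcomp_def pt_def act_def pair_def)

lemma vnat_vnat_id: "vfunctor V C D F \<Longrightarrow> vnat V C D F F (vnat_id C D F)"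
  by (rule vnatI) (simp_all add: cpt_vnat_id vfunctor_simps mor_gmap)

lemma vnat_vnat_comp:
  assumes \<alpha>: "vnat V C D F G \<alpha>" and \<beta>: "vnat V C D G H \<beta>"
  shows "vnat V C D F H (vnat_comp V C D F G H \<beta> \<alpha>)"
proof (rule vnatI)
  interpret a: vnat V C D F G \<alpha> by fact
  interpret b: vnat V C D G H \<beta> by fact
  show F: "vfunctor V C D F" and H: "vfunctor V C D H" by unfold_locales
  have G: "vfunctor V C D G" by unfold_locales
  note [simp] = vfunctor_simps[OF F] cpt_vnat_comp mor_cpt[OF \<alpha>] mor_cpt[OF \<beta>]
    mor_gmap[OF F] mor_gmap[OF G] mor_gmap[OF H]
  show "mor D (cpt F H (vnat_comp V C D F G H \<beta> \<alpha>) A)" if "A \<in> VOb C" for A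
    using that by simp
  fix f assume f [simp]: "mor C f"
  have "cpt G H \<beta> (Tgt f) \<odot>\<^bsub>D\<^esub> (cpt F G \<alpha> (Tgt f) \<odot>\<^bsub>D\<^esub> gmap F f)
      = (cpt G H \<beta> (Tgt f) \<odot>\<^bsub>D\<^esub> gmap G f) \<odot>\<^bsub>D\<^esub> cpt F G \<alpha> (Src f)"
    by (simp add: cpt_natural[OF \<alpha> f])
  also have "\<dots> = (gmap H f \<odot>\<^bsub>D\<^esub> cpt G H \<beta> (Src f)) \<odot>\<^bsub>D\<^esub> cpt F G \<alpha> (Src f)"
    by (simp only: cpt_natural[OF \<beta> f])
  finally show "cpt F H (vnat_comp V C D F G H \<beta> \<alpha>) (Tgt f) \<odot>\<^bsub>D\<^esub> gmap F f
      = gmap H f \<odot>\<^bsub>D\<^esub> cpt F H (vnat_comp V C D F G H \<beta> \<alpha>) (Src f)"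
    by simp
qed simp

end


section \<open>The base as an enriched category\<close>

context smcc
begin

abbreviation base_comp (infixr "\<bullet>" 65) where "g \<bullet> f \<equiv> g \<odot>\<^bsub>vself V\<^esub> f"

lemma IHom_simps [simp]:
  assumes "A \<in> Obj V" "B \<in> Obj V"
  shows "IHom V A B \<in> Obj V" "Ev V A B \<in> Arr V" "Dom V (Ev V A B) = IHom V A B \<otimes> A"
    "Cod V (Ev V A B) = B"
  using IHom_in[OF assms] Ev_in[OF assms] by (simp_all add: in_Hom)

lemma vcurry:
  assumes "X \<in> Obj V" "A \<in> Obj V" "m \<in> Arr V" "Dom V m = X \<otimes> A" "B = Cod V m"
  shows "vcurry V X A B m \<in> Hom V X (IHom V A B)"
    and "Ev V A B \<cdot> (vcurry V X A B m \<boxtimes> Id V A) = m"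
proof -
  have "\<exists>!g. g \<in> Hom V X (IHom V A B) \<and> Ev V A B \<cdot> (g \<boxtimes> Id V A) = m"
    using assms by (intro Ev_universal) (simp_all add: in_Hom)
  then have "vcurry V X A B m \<in> Hom V X (IHom V A B) \<and> Ev V A B \<cdot> (vcurry V X A B m \<boxtimes> Id V A) = m"
    unfolding vcurry_def by (rule theI')
  then show "vcurry V X A B m \<in> Hom V X (IHom V A B)"
    "Ev V A B \<cdot> (vcurry V X A B m \<boxtimes> Id V A) = m" by simp_all
qed

lemma vcurry_simps [simp]:
  assumes "X \<in> Obj V" "A \<in> Obj V" "m \<in> Arr V" "Dom V m = X \<otimes> A" "B = Cod V m"
  shows "vcurry V X A B m \<in> Arr V" "Dom V (vcurry V X A B m) = X" "Cod V (vcurry V X A B m) = IHom V A B"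
  using vcurry(1)[OF assms] by (simp_all add: in_Hom)

lemma Ev_vcurry [simp]:
  assumes "A \<in> Obj V" "m \<in> Arr V" "Dom V m = X \<otimes> A" "B = Cod V m" "el X x" "el A a"
  shows "act (Ev V A B) (pair (act (vcurry V X A B m) x) a) = act m (pair x a)"
proof -
  note [simp] = assms el_Obj[OF assms(5)]
  have "act (Ev V A B \<cdot> (vcurry V X A B m \<boxtimes> Id V A)) (pair x a) = act m (pair x a)"
    using vcurry(2)[of X A m B] by simp
  then show ?thesis by simp
qed

text \<open>
  Evaluation at the generic element of \<open>A\<close> is the original evaluation up to an isomorphism, so the
  uniqueness of transposes applies.
\<close>

lemma Ev_cancel:
  assumes "el (IHom V A B) f" "el (IHom V A B) g" "A \<in> Obj V" "B \<in> Obj V"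
    and eq: "act (Ev V A B) (pair f (gen A)) = act (Ev V A B) (pair g (gen A))"
  shows "f = g"
proof -
  note [simp] = assms(3,4) el_Val[OF assms(1)] el_Val[OF assms(2)]
  have "Grade f @ [A] = Grade g @ [A]" using eq by (simp add: act_def pair_def gen_def)
  then have G [simp]: "Grade g = Grade f" by simp
  let ?X = "tens (Grade f)"
  let ?u = "(Id V ?X \<boxtimes> RUnit V A) \<cdot> tens_split (Grade f) [A]"
  have *: "(Ev V A B \<cdot> (Val f \<boxtimes> Id V A)) \<cdot> ?u = (Ev V A B \<cdot> (Val g \<boxtimes> Id V A)) \<cdot> ?u"
    using eq by (simp add: act_def pair_def gen_def)
  have "Ev V A B \<cdot> (Val f \<boxtimes> Id V A) = Ev V A B \<cdot> (Val g \<boxtimes> Id V A)"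
    by (rule iso_epi[OF _ _ _ _ _ *]) simp_all
  moreover have "\<exists>!h. h \<in> Hom V ?X (IHom V A B) \<and> Ev V A B \<cdot> (h \<boxtimes> Id V A) = Ev V A B \<cdot> (Val g \<boxtimes> Id V A)"
    by (intro Ev_universal) (simp_all add: in_Hom)
  moreover have "Val f \<in> Hom V ?X (IHom V A B)" "Val g \<in> Hom V ?X (IHom V A B)" by (simp_all add: in_Hom)
  ultimately have "Val f = Val g" by metis
  then show ?thesis by simp
qed

lemma vself_simps [simp]:
  "VOb (vself V) = Obj V"
  "A \<in> Obj V \<Longrightarrow> B \<in> Obj V \<Longrightarrow> VHom (vself V) A B = IHom V A B"
  by (simp_all add: vself_def)

definition app :: "('o, 'o, 'm) gmor \<Rightarrow> ('o, 'm) elt \<Rightarrow> ('o, 'm) elt" where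
  "app f a = act (Ev V (Src f) (Tgt f)) (pair (Body f) a)"

lemma vself_mor [simp]:
  assumes "mor (vself V) f"
  shows "Src f \<in> Obj V" "Tgt f \<in> Obj V" "A = Src f \<Longrightarrow> B = Tgt f \<Longrightarrow> el (IHom V A B) (Body f)"
  using assms by (auto simp: mor_def)

lemma el_app [simp]: "mor (vself V) f \<Longrightarrow> el (Src f) a \<Longrightarrow> B = Tgt f \<Longrightarrow> el B (app f a)"
  by (simp add: app_def)

lemma mor_eqI:
  assumes "mor (vself V) f" "mor (vself V) g" "Src f = Src g" "Tgt f = Tgt g"
    and "\<And>a. el (Src g) a \<Longrightarrow> app f a = app g a"
  shows "f = g"
proof (rule gmor_eqI)
  show "Body f = Body g"
    by (rule Ev_cancel[of "Src g" "Tgt g"])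
      (use assms(5)[of "gen (Src g)"] assms(1-4) in \<open>simp_all add: app_def\<close>)
qed (use assms in simp_all)

lemma vself_VComp:
  assumes "A \<in> Obj V" "B \<in> Obj V" "D \<in> Obj V"
  shows "VComp (vself V) A B D \<in> Hom V (IHom V B D \<otimes> IHom V A B) (IHom V A D)"
    and "el (IHom V B D) g \<Longrightarrow> el (IHom V A B) f \<Longrightarrow> el A a \<Longrightarrow>
      act (Ev V A D) (pair (act (VComp (vself V) A B D) (pair g f)) a)
        = act (Ev V B D) (pair g (act (Ev V A B) (pair f a)))"
  using assms by (simp_all add: vself_def in_Hom)

lemma vself_VId:
  assumes "A \<in> Obj V"
  shows "VId (vself V) A \<in> Hom V (Unit V) (IHom V A A)"
    and "el A a \<Longrightarrow> act (Ev V A A) (pair (act (VId (vself V) A) unit_elt) a) = a"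
  using assms by (simp_all add: vself_def in_Hom)

lemma vself_gcomp_raw:
  assumes "mor (vself V) f" "mor (vself V) g" "Src g = Tgt f"
  shows "mor (vself V) (g \<bullet> f)"
    and "el (Src f) a \<Longrightarrow> app (g \<bullet> f) a = app g (app f a)"
proof -
  have "el (IHom V (Src f) (Tgt g)) (Body (g \<bullet> f))"
    using assms vself_VComp(1)[of "Src f" "Src g" "Tgt g"] by (simp add: gcomp_def in_Hom)
  then show "mor (vself V) (g \<bullet> f)"
    using assms by (simp add: mor_def[of _ "g \<bullet> f"])
  show "app (g \<bullet> f) a = app g (app f a)" if "el (Src f) a"
    using that assms vself_VComp(2)[of "Src f" "Src g" "Tgt g" "Body g" "Body f" a]
    by (simp add: app_def gcomp_def)
qed

lemma vself_gid_raw: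
  assumes "A \<in> Obj V"
  shows "mor (vself V) (gid (vself V) A)" and "el A a \<Longrightarrow> app (gid (vself V) A) a = a"
  using assms vself_VId[OF assms] by (simp_all add: gid_def mor_pt app_def Body_pt in_Hom)

lemma vcategory_vself [simp]: "vcategory V (vself V)"
proof (rule vcategoryI)
  show "VHom (vself V) \<in> VOb (vself V) \<rightarrow>\<^sub>E VOb (vself V) \<rightarrow>\<^sub>E Obj V"
    by (auto simp: vself_def)
  show "VComp (vself V) \<in> (\<Pi>\<^sub>E A\<in>VOb (vself V). \<Pi>\<^sub>E B\<in>VOb (vself V). \<Pi>\<^sub>E D\<in>VOb (vself V).
      Hom V (VHom (vself V) B D \<otimes> VHom (vself V) A B) (VHom (vself V) A D))"
    using vself_VComp(1) by (auto simp: vself_def)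
  show "VId (vself V) \<in> (\<Pi>\<^sub>E A\<in>VOb (vself V). Hom V (Unit V) (VHom (vself V) A A))"
    using vself_VId(1) by (auto simp: vself_def)
qed (rule mor_eqI; simp add: vself_gcomp_raw vself_gid_raw)+

text \<open>
  With \<open>mor_eqI\<close>, these two rules reduce equations in the base to equations between values at elements.
\<close>

lemma app_gcomp [simp]:
  "mor (vself V) f \<Longrightarrow> mor (vself V) g \<Longrightarrow> Src g = Tgt f \<Longrightarrow> el (Src f) a \<Longrightarrow>
    app (g \<bullet> f) a = app g (app f a)"
  by (rule vself_gcomp_raw)

lemma app_gid [simp]: "el A a \<Longrightarrow> app (gid (vself V) A) a = a"
  by (rule vself_gid_raw(2)[OF el_Obj])

definition gmk :: "'c \<Rightarrow> 'c \<Rightarrow> ('o, 'm) elt \<Rightarrow> ('c, 'o, 'm) gmor" where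
  "gmk A B e = \<lparr>Src = A, Tgt = B, Body = e\<rparr>"

lemma gmk_simps [simp]: "Src (gmk A B e) = A" "Tgt (gmk A B e) = B" "Body (gmk A B e) = e"
  by (simp_all add: gmk_def)

lemma gmk_Body [simp]: "A = Src f \<Longrightarrow> B = Tgt f \<Longrightarrow> gmk A B (Body f) = f"
  by (intro gmor_eqI) simp_all

lemma mor_gmk [simp]: "A \<in> VOb C \<Longrightarrow> B \<in> VOb C \<Longrightarrow> el (VHom C A B) e \<Longrightarrow> mor C (gmk A B e)"
  by (simp add: mor_def del: mor_simps vself_mor)

text \<open>
  Arrows of \<open>V\<close> and arrows of empty grade in \<open>vself V\<close> are the same thing: \<open>vname\<close> and
  \<open>unname\<close> are mutually inverse.
\<close>

definition vname :: "'m \<Rightarrow> 'm" where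
  "vname m = vcurry V (Unit V) (Dom V m) (Cod V m) (m \<cdot> LUnit V (Dom V m))"

lemma vname_in: "m \<in> Arr V \<Longrightarrow> vname m \<in> Hom V (Unit V) (IHom V (Dom V m) (Cod V m))"
  by (simp add: vname_def in_Hom)

lemma mor_vname [simp]:
  "m \<in> Arr V \<Longrightarrow> A = Dom V m \<Longrightarrow> B = Cod V m \<Longrightarrow> mor (vself V) (pt A B (vname m))"
  using vname_in by (simp add: mor_pt)

lemma app_vname [simp]:
  "m \<in> Arr V \<Longrightarrow> A = Dom V m \<Longrightarrow> B = Cod V m \<Longrightarrow> el A a \<Longrightarrow> app (pt A B (vname m)) a = act m a"
  using vname_in[of m] by (simp add: app_def Body_pt in_Hom vname_def)

lemma unname_simps:
  assumes "A \<in> Obj V" "B \<in> Obj V" "e \<in> Hom V (Unit V) (IHom V A B)"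
  shows "unname V A B e \<in> Arr V" "Dom V (unname V A B e) = A" "Cod V (unname V A B e) = B"
    and "el A a \<Longrightarrow> act (unname V A B e) a = app (pt A B e) a"
  using assms by (simp_all add: unname_def in_Hom app_def Body_pt)

text \<open>
  Elements of \<open>A\<close> correspond to morphisms from the unit to \<open>A\<close> of the same grade, by \<open>A \<cong> [I,A]\<close>. Under
  this correspondence application becomes postcomposition (\<open>gcomp_ptd\<close>), which makes elements available
  in the target of any \<open>V\<close>-functor defined on the base.
\<close>

definition from_unit :: "'o \<Rightarrow> 'm" where
  "from_unit A = vcurry V A (Unit V) A (RUnit V A)"

definition at_unit :: "'o \<Rightarrow> 'm" where
  "at_unit A = Ev V (Unit V) A \<cdot> Inv V (RUnit V (IHom V (Unit V) A))"

definition ptd :: "'o \<Rightarrow> ('o, 'm) elt \<Rightarrow> ('o, 'o, 'm) gmor" where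
  "ptd A a = gmk (Unit V) A (act (from_unit A) a)"

lemma from_unit_simps [simp]:
  assumes "A \<in> Obj V"
  shows "from_unit A \<in> Arr V" "Dom V (from_unit A) = A" "Cod V (from_unit A) = IHom V (Unit V) A"
  using assms by (simp_all add: from_unit_def)

lemma at_unit_simps [simp]:
  assumes "A \<in> Obj V"
  shows "at_unit A \<in> Arr V" "Dom V (at_unit A) = IHom V (Unit V) A" "Cod V (at_unit A) = A"
  using assms by (simp_all add: at_unit_def)

lemma ptd_simps [simp]: "Src (ptd A a) = Unit V" "Tgt (ptd A a) = A"
  "Body (ptd A a) = act (from_unit A) a"
  by (simp_all add: ptd_def)

lemma mor_ptd [simp]: "el A a \<Longrightarrow> mor (vself V) (ptd A a)"
  using el_Obj[of A a] by (simp add: ptd_def)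

lemma app_ptd [simp]: "el A a \<Longrightarrow> app (ptd A a) unit_elt = a"
  using el_Obj[of A a] by (simp add: app_def from_unit_def)

lemma act_at_unit: "mor (vself V) f \<Longrightarrow> Src f = Unit V \<Longrightarrow> act (at_unit (Tgt f)) (Body f) = app f unit_elt"
  by (simp add: at_unit_def app_def)

text \<open>
  A morphism out of the unit is determined by its value at the unit element: evaluating at \<open>a\<close> amounts
  to evaluating at the unit element and then absorbing \<open>a\<close> through the right unit constraint.
\<close>

lemma from_unit_mor_eqI:
  assumes "mor (vself V) f" "mor (vself V) g" "Src f = Unit V" "Src g = Unit V" "Tgt f = Tgt g"
    and eq: "app f unit_elt = app g unit_elt"
  shows "f = g"
proof (rule mor_eqI)
  show "app f a = app g a" if "el (Src g) a" for a
  proof -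
    note [simp] = that[unfolded assms(4)] assms(1-5)
    \<comment> \<open>The element \<open>a\<close> of the unit is moved past the unit element using \<open>LUnit_Unit\<close>.\<close>
    have key: "app h a = act (RUnit V (Tgt h)) (pair (app h unit_elt) a)"
      if h: "mor (vself V) h" "Src h = Unit V" for h
    proof -
      note [simp] = h
      have "act (RUnit V (Tgt h)) (pair (app h unit_elt) a)
          = act (RUnit V (Tgt h) \<cdot> (Ev V (Unit V) (Tgt h) \<boxtimes> Id V (Unit V))) (pair (pair (Body h) unit_elt) a)"
        by (simp add: app_def)
      also have "\<dots> = act (Ev V (Unit V) (Tgt h) \<cdot> RUnit V (IHom V (Unit V) (Tgt h) \<otimes> Unit V))
            (pair (pair (Body h) unit_elt) a)"
        using RUnit_nat[of "Ev V (Unit V) (Tgt h)"] by simp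
      also have "RUnit V (IHom V (Unit V) (Tgt h) \<otimes> Unit V)
          = (Id V (IHom V (Unit V) (Tgt h)) \<boxtimes> LUnit V (Unit V))
              \<cdot> Assoc V (IHom V (Unit V) (Tgt h)) (Unit V) (Unit V)"
        using RUnit_Tensor[of "IHom V (Unit V) (Tgt h)" "Unit V"] LUnit_Unit by simp
      also have "act (Ev V (Unit V) (Tgt h) \<cdot> ((Id V (IHom V (Unit V) (Tgt h)) \<boxtimes> LUnit V (Unit V))
              \<cdot> Assoc V (IHom V (Unit V) (Tgt h)) (Unit V) (Unit V))) (pair (pair (Body h) unit_elt) a)
          = app h a"
        by (simp add: app_def)
      finally show ?thesis by simp
    qed
    show ?thesis using key[of f] key[of g] eq by simp
  qed
qed (use assms in simp_all)

lemma gcomp_ptd: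
  assumes "mor (vself V) f" "el A a" "A = Src f"
  shows "f \<bullet> ptd A a = ptd (Tgt f) (app f a)"
  by (rule from_unit_mor_eqI) (use assms in simp_all)

lemma inverse_pair_from_unit:
  assumes [simp]: "A \<in> Obj V"
  shows "inverse_pair V (from_unit A) (at_unit A)"
proof (rule inverse_pairI)
  show "at_unit A \<cdot> from_unit A = Id V (Dom V (from_unit A))"
  proof (rule arrow_eqI[of _ "gen A"])
    show "act (at_unit A \<cdot> from_unit A) (gen A) = act (Id V (Dom V (from_unit A))) (gen A)"
      using act_at_unit[of "ptd A (gen A)"] by simp
  qed simp_all
  show "from_unit A \<cdot> at_unit A = Id V (Cod V (from_unit A))"
  proof (rule arrow_eqI)
    let ?g = "gmk (Unit V) A (gen (IHom V (Unit V) A))"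
    have "ptd A (app ?g unit_elt) = ?g"
      by (rule from_unit_mor_eqI) simp_all
    then have "act (from_unit A) (app ?g unit_elt) = Body ?g"
      using ptd_simps(3) by metis
    then show "act (from_unit A \<cdot> at_unit A) (gen (IHom V (Unit V) A))
        = act (Id V (Cod V (from_unit A))) (gen (IHom V (Unit V) A))"
      using act_at_unit[of ?g] by simp
  qed simp_all
qed simp_all

lemma vrep_simps [simp]:
  "Y \<in> VOb C \<Longrightarrow> VMap_ob (vrep V C X) Y = VHom C X Y"
  by (simp add: vrep_def)

lemma mor_gmap_vrep:
  assumes "vcategory V C" "X \<in> VOb C" "mor C f"
  shows "mor (vself V) (gmap (vrep V C X) f)"
  using assms by (simp add: gmap_def vrep_def mor_def del: mor_simps vself_mor)

lemma app_gmap_vrep: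
  assumes "vcategory V C" "mor C f" "mor C s" "Tgt s = Src f" "X = Src s"
  shows "app (gmap (vrep V C X) f) (Body s) = Body (f \<odot>\<^bsub>C\<^esub> s)"
  using assms by (simp add: gmap_def vrep_def app_def gcomp_def)

lemma vfunctor_vrep:
  assumes C [simp]: "vcategory V C" and X [simp]: "X \<in> VOb C"
  shows "vfunctor V C (vself V) (vrep V C X)"
proof (rule vfunctorI)
  show "VMap_ob (vrep V C X) \<in> VOb C \<rightarrow>\<^sub>E VOb (vself V)" by (simp add: vrep_def)
  show "VMap_hom (vrep V C X) \<in> (\<Pi>\<^sub>E A\<in>VOb C. \<Pi>\<^sub>E B\<in>VOb C.
      Hom V (VHom C A B) (VHom (vself V) (VMap_ob (vrep V C X) A) (VMap_ob (vrep V C X) B)))"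
    by (simp add: vrep_def in_Hom)
  note [simp] = mor_gmap_vrep[OF C X]
  fix f g assume f [simp]: "mor C f" "mor C g" "Src g = Tgt f"
  show "gmap (vrep V C X) (g \<odot>\<^bsub>C\<^esub> f) = gmap (vrep V C X) g \<bullet> gmap (vrep V C X) f"
  proof (rule mor_eqI)
    fix a assume "el (Src (gmap (vrep V C X) g \<bullet> gmap (vrep V C X) f)) a"
    then have a: "el (VHom C X (Src f)) a" by simp
    define s where "s = gmk X (Src f) a"
    have s: "mor C s" "Src s = X" "Tgt s = Src f" "a = Body s" using a by (simp_all add: s_def)
    then show "app (gmap (vrep V C X) (g \<odot>\<^bsub>C\<^esub> f)) a
        = app (gmap (vrep V C X) g \<bullet> gmap (vrep V C X) f) a"
      by (simp add: app_gmap_vrep)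
  qed simp_all
next
  note [simp] = mor_gmap_vrep[OF C X]
  fix A assume A [simp]: "A \<in> VOb C"
  show "gmap (vrep V C X) (gid C A) = gid (vself V) (VMap_ob (vrep V C X) A)"
  proof (rule mor_eqI)
    fix a assume "el (Src (gid (vself V) (VMap_ob (vrep V C X) A))) a"
    then have a: "el (VHom C X A) a" by simp
    define s where "s = gmk X A a"
    have "mor C s" "Src s = X" "Tgt s = A" "a = Body s" using a by (simp_all add: s_def)
    then show "app (gmap (vrep V C X) (gid C A)) a = app (gid (vself V) (VMap_ob (vrep V C X) A)) a"
      by (simp add: app_gmap_vrep)
  qed simp_all
qed simp_all

end


section \<open>Opposites\<close>

context smcc
begin

lemma vop_simps [simp]:
  "VOb (vop V C) = VOb C" "VId (vop V C) = VId C"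
  "A \<in> VOb C \<Longrightarrow> B \<in> VOb C \<Longrightarrow> VHom (vop V C) A B = VHom C B A"
  "A \<in> VOb C \<Longrightarrow> B \<in> VOb C \<Longrightarrow> D \<in> VOb C \<Longrightarrow>
    VComp (vop V C) A B D = VComp C D B A \<cdot> Sym V (VHom C D B) (VHom C B A)"
  by (simp_all add: vop_def)

text \<open>
  Associativity in the opposite reverses three factors in two ways; these agree by \<open>Sym_reverse\<close>.
\<close>

lemma vcategory_vop:
  assumes C [simp]: "vcategory V C"
  shows "vcategory V (vop V C)"
proof
  show "VHom (vop V C) \<in> VOb (vop V C) \<rightarrow>\<^sub>E VOb (vop V C) \<rightarrow>\<^sub>E Obj V"
    by (auto simp: vop_def)
  show "VComp (vop V C) \<in> (\<Pi>\<^sub>E A\<in>VOb (vop V C). \<Pi>\<^sub>E B\<in>VOb (vop V C). \<Pi>\<^sub>E D\<in>VOb (vop V C).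
      Hom V (VHom (vop V C) B D \<otimes> VHom (vop V C) A B) (VHom (vop V C) A D))"
    by (auto simp: vop_def in_Hom)
  show "VId (vop V C) \<in> (\<Pi>\<^sub>E A\<in>VOb (vop V C). Hom V (Unit V) (VHom (vop V C) A A))"
    using vcategory.VId_in[OF C] by (auto simp: PiE_iff)
  show "VComp (vop V C) A B E \<cdot> (VComp (vop V C) B D E \<boxtimes> Id V (VHom (vop V C) A B)) =
      VComp (vop V C) A D E \<cdot> (Id V (VHom (vop V C) D E) \<boxtimes> VComp (vop V C) A B D) \<cdot>
        Assoc V (VHom (vop V C) D E) (VHom (vop V C) B D) (VHom (vop V C) A B)"
    if "A \<in> VOb (vop V C)" "B \<in> VOb (vop V C)" "D \<in> VOb (vop V C)" "E \<in> VOb (vop V C)" for A B D E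
  proof -
    have [simp]: "A \<in> VOb C" "B \<in> VOb C" "D \<in> VOb C" "E \<in> VOb C" using that by simp_all
    let ?P = "VHom C E D" and ?Q = "VHom C D B" and ?R = "VHom C B A"
    let ?M = "VComp C" and ?s = "Sym V" and ?a = "Assoc V" and ?i = "Id V"
    have "?M E B A \<cdot> (?s (VHom C E B) ?R \<cdot> ((?M E D B \<cdot> ?s ?P ?Q) \<boxtimes> ?i ?R))
        = ?M E B A \<cdot> ((?i ?R \<boxtimes> (?M E D B \<cdot> ?s ?P ?Q)) \<cdot> ?s (?P \<otimes> ?Q) ?R)"
      using Sym_nat[of "?M E D B \<cdot> ?s ?P ?Q" "?i ?R"] by simp
    also have "\<dots> = ?M E B A \<cdot> ((?i ?R \<boxtimes> ?M E D B) \<cdot> ((?i ?R \<boxtimes> ?s ?P ?Q) \<cdot> ?s (?P \<otimes> ?Q) ?R))"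
      by simp
    also have "\<dots> = (?M E B A \<cdot> (?i ?R \<boxtimes> ?M E D B) \<cdot> ?a ?R ?Q ?P) \<cdot>
        ((?s ?Q ?R \<boxtimes> ?i ?P) \<cdot> (?s ?P (?Q \<otimes> ?R) \<cdot> ?a ?P ?Q ?R))"
      by (simp add: Sym_reverse del: interchange_prefix interchange)
    also have "\<dots> = (?M E D A \<cdot> (?M D B A \<boxtimes> ?i ?P)) \<cdot>
        ((?s ?Q ?R \<boxtimes> ?i ?P) \<cdot> (?s ?P (?Q \<otimes> ?R) \<cdot> ?a ?P ?Q ?R))"
      using vcategory.VComp_assoc[OF C, of E D B A] by simp
    also have "\<dots> = ?M E D A \<cdot> (((?M D B A \<cdot> ?s ?Q ?R) \<boxtimes> ?i ?P) \<cdot> (?s ?P (?Q \<otimes> ?R) \<cdot> ?a ?P ?Q ?R))"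
      by simp
    also have "\<dots> = ?M E D A \<cdot> (?s ?P (VHom C D A) \<cdot> ((?i ?P \<boxtimes> (?M D B A \<cdot> ?s ?Q ?R)) \<cdot> ?a ?P ?Q ?R))"
      using Sym_nat_prefix[of "?i ?P" "?M D B A \<cdot> ?s ?Q ?R" "?a ?P ?Q ?R"] by simp
    finally show ?thesis by simp
  qed
  show "VComp (vop V C) A B B \<cdot> (VId (vop V C) B \<boxtimes> Id V (VHom (vop V C) A B)) = LUnit V (VHom (vop V C) A B)"
    if "A \<in> VOb (vop V C)" "B \<in> VOb (vop V C)" for A B
  proof -
    have [simp]: "A \<in> VOb C" "B \<in> VOb C" using that by simp_all
    have "VComp C B B A \<cdot> (Sym V (VHom C B B) (VHom C B A) \<cdot> (VId C B \<boxtimes> Id V (VHom C B A)))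
        = VComp C B B A \<cdot> ((Id V (VHom C B A) \<boxtimes> VId C B) \<cdot> Sym V (Unit V) (VHom C B A))"
      using Sym_nat[of "VId C B" "Id V (VHom C B A)"] by simp
    also have "\<dots> = RUnit V (VHom C B A) \<cdot> Sym V (Unit V) (VHom C B A)"
      using vcategory.VComp_VId[OF C, of B A] by (intro Comp_prefix) simp_all
    finally show ?thesis by (simp add: RUnit_Sym)
  qed
  show "VComp (vop V C) A A B \<cdot> (Id V (VHom (vop V C) A B) \<boxtimes> VId (vop V C) A) = RUnit V (VHom (vop V C) A B)"
    if "A \<in> VOb (vop V C)" "B \<in> VOb (vop V C)" for A B
  proof -
    have [simp]: "A \<in> VOb C" "B \<in> VOb C" using that by simp_all
    have "VComp C B A A \<cdot> (Sym V (VHom C B A) (VHom C A A) \<cdot> (Id V (VHom C B A) \<boxtimes> VId C A))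
        = VComp C B A A \<cdot> ((VId C A \<boxtimes> Id V (VHom C B A)) \<cdot> Sym V (VHom C B A) (Unit V))"
      using Sym_nat[of "Id V (VHom C B A)" "VId C A"] by simp
    also have "\<dots> = LUnit V (VHom C B A) \<cdot> Sym V (VHom C B A) (Unit V)"
      using vcategory.VId_VComp[OF C, of B A] by (intro Comp_prefix) simp_all
    finally show ?thesis by (simp add: LUnit_Sym)
  qed
qed

lemma vop_vop [simp]:
  assumes C [simp]: "vcategory V C"
  shows "vop V (vop V C) = C"
proof -
  have "VHom (vop V (vop V C)) = VHom C"
  proof (rule ext, rule ext)
    fix A B
    show "VHom (vop V (vop V C)) A B = VHom C A B"
      using vcategory.VHom_in[OF C] by (auto simp: vop_def PiE_iff extensional_def)
  qed
  moreover have "VComp (vop V (vop V C)) = VComp C"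
  proof (rule ext, rule ext, rule ext)
    fix A B D
    show "VComp (vop V (vop V C)) A B D = VComp C A B D"
      using vcategory.VComp_in[OF C] by (auto simp: vop_def PiE_iff extensional_def)
  qed
  ultimately show ?thesis by (intro vcategory.equality) (simp_all add: vop_def[of _ "vop V C"])
qed

definition fop :: "('c, 'o, 'm) vcategory \<Rightarrow> ('c, 'd, 'm) vfunctor \<Rightarrow> ('c, 'd, 'm) vfunctor" where
  "fop C F = \<lparr>VMap_ob = VMap_ob F, VMap_hom = (\<lambda>A\<in>VOb C. \<lambda>B\<in>VOb C. VMap_hom F B A)\<rparr>"

lemma fop_simps [simp]:
  "VMap_ob (fop C F) = VMap_ob F"
  "A \<in> VOb C \<Longrightarrow> B \<in> VOb C \<Longrightarrow> VMap_hom (fop C F) A B = VMap_hom F B A"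
  "fop (vop V C) F = fop C F"
  by (simp_all add: fop_def)

lemma vfunctor_fop:
  assumes F: "vfunctor V C D F"
  shows "vfunctor V (vop V C) (vop V D) (fop C F)"
proof -
  note [simp] = vfunctor_simps[OF F]
  have "VMap_hom (fop C F) A E \<cdot> VComp (vop V C) A B E =
      VComp (vop V D) (VMap_ob (fop C F) A) (VMap_ob (fop C F) B) (VMap_ob (fop C F) E) \<cdot>
        (VMap_hom (fop C F) B E \<boxtimes> VMap_hom (fop C F) A B)"
    if [simp]: "A \<in> VOb C" "B \<in> VOb C" "E \<in> VOb C" for A B E
  proof -
    have "VMap_hom F E A \<cdot> (VComp C E B A \<cdot> Sym V (VHom C E B) (VHom C B A))
       = (VComp D (VMap_ob F E) (VMap_ob F B) (VMap_ob F A) \<cdot> (VMap_hom F B A \<boxtimes> VMap_hom F E B))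
          \<cdot> Sym V (VHom C E B) (VHom C B A)"
      using vfunctor.VMap_VComp[OF F, of E B A] by (intro Comp_prefix) simp_all
    also have "\<dots> = VComp D (VMap_ob F E) (VMap_ob F B) (VMap_ob F A) \<cdot>
        (Sym V (VHom D (VMap_ob F E) (VMap_ob F B)) (VHom D (VMap_ob F B) (VMap_ob F A)) \<cdot>
          (VMap_hom F E B \<boxtimes> VMap_hom F B A))"
      using Sym_nat[of "VMap_hom F E B" "VMap_hom F B A"] by simp
    finally show ?thesis by simp
  qed
  moreover have "VMap_hom (fop C F) \<in> (\<Pi>\<^sub>E A\<in>VOb C. \<Pi>\<^sub>E B\<in>VOb C.
      Hom V (VHom (vop V C) A B) (VHom (vop V D) (VMap_ob F A) (VMap_ob F B)))"
    by (simp add: fop_def in_Hom)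
  ultimately show ?thesis
    using vcategory_vop[of C] vcategory_vop[of D] vfunctor.VMap_ob_in[OF F] vfunctor.VMap_VId[OF F]
    unfolding vfunctor_def vfunctor_axioms_def by simp
qed

lemma fop_fop [simp]:
  assumes F: "vfunctor V C D F"
  shows "fop C (fop C F) = F"
proof -
  have "VMap_hom (fop C (fop C F)) = VMap_hom F"
  proof (rule ext, rule ext)
    fix A B
    show "VMap_hom (fop C (fop C F)) A B = VMap_hom F A B"
      using vfunctor.VMap_hom_in[OF F] by (auto simp: fop_def PiE_iff extensional_def)
  qed
  then show ?thesis by (intro vfunctor.equality) simp_all
qed

lemma fop_vfunctor_comp:
  assumes F: "vfunctor V C D F"
  shows "fop C (vfunctor_comp V C G F) = vfunctor_comp V (vop V C) (fop D G) (fop C F)"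
  using vfunctor_simps(3)[OF F] by (auto simp: fop_def vfunctor_comp_def vop_def fun_eq_iff restrict_def)

lemma fop_vfunctor_id: "fop C (vfunctor_id V C) = vfunctor_id V (vop V C)"
  by (auto simp: fop_def vfunctor_id_def vop_def fun_eq_iff restrict_def)


section \<open>Cotensors in an opposite category\<close>

text \<open>
  The arrow \<open>K(P,D) \<rightarrow> [W, K(X,D)]\<close> that sends \<open>f\<close> to \<open>w \<mapsto> f \<circ> \<gamma> w\<close>.
\<close>

definition tensor_cmp :: "('c, 'o, 'm) vcategory \<Rightarrow> 'o \<Rightarrow> 'c \<Rightarrow> 'c \<Rightarrow> 'm \<Rightarrow> 'c \<Rightarrow> 'm" where
  "tensor_cmp K W X P \<gamma> D = vcurry V (VHom K P D) W (VHom K X D)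
     (VComp K X P D \<cdot> (Id V (VHom K P D) \<boxtimes> \<gamma>))"

definition is_tensor :: "('c, 'o, 'm) vcategory \<Rightarrow> 'o \<Rightarrow> 'c \<Rightarrow> 'c \<Rightarrow> 'm \<Rightarrow> bool" where
  "is_tensor K W X P \<gamma> \<longleftrightarrow> W \<in> Obj V \<and> X \<in> VOb K \<and> P \<in> VOb K \<and> \<gamma> \<in> Hom V W (VHom K X P) \<and>
     (\<forall>D \<in> VOb K. iso V (tensor_cmp K W X P \<gamma> D))"

lemma tensor_cmp_simps [simp]:
  assumes "vcategory V K" "W \<in> Obj V" "X \<in> VOb K" "P \<in> VOb K" "D \<in> VOb K" "\<gamma> \<in> Hom V W (VHom K X P)"
  shows "tensor_cmp K W X P \<gamma> D \<in> Arr V" "Dom V (tensor_cmp K W X P \<gamma> D) = VHom K P D"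
    "Cod V (tensor_cmp K W X P \<gamma> D) = IHom V W (VHom K X D)"
  using assms by (simp_all add: tensor_cmp_def in_Hom)

lemma app_tensor_cmp:
  assumes "vcategory V K" "W \<in> Obj V" "X \<in> VOb K" "P = Src f" "D = Tgt f" "\<gamma> \<in> Hom V W (VHom K X P)"
    and "mor K f" "el W w"
  shows "app (gmk W (VHom K X D) (act (tensor_cmp K W X P \<gamma> D) (Body f))) w
    = Body (f \<odot>\<^bsub>K\<^esub> gmk X P (act \<gamma> w))"
  using assms by (simp add: tensor_cmp_def in_Hom app_def gcomp_def)

lemma app_unname:
  assumes "mor (vself V) (pt A B e)" "el A a"
  shows "act (unname V A B e) a = app (pt A B e) a" "unname V A B e \<in> Hom V A B"
  using unname_simps[of A B e] assms by (auto simp: mor_pt in_Hom)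

text \<open>
  Naturality of the inverse follows from that of \<open>\<alpha>\<close> by composing a square with inverse components on
  both sides.
\<close>

lemma vnat_isoI:
  assumes \<alpha>: "vnat V C D F G \<alpha>" and ext: "\<beta> \<in> extensional (VOb C)"
    and \<beta>: "\<And>A. A \<in> VOb C \<Longrightarrow> mor D (cpt G F \<beta> A)"
    and l: "\<And>A. A \<in> VOb C \<Longrightarrow> cpt G F \<beta> A \<odot>\<^bsub>D\<^esub> cpt F G \<alpha> A = gid D (VMap_ob F A)"
    and r: "\<And>A. A \<in> VOb C \<Longrightarrow> cpt F G \<alpha> A \<odot>\<^bsub>D\<^esub> cpt G F \<beta> A = gid D (VMap_ob G A)"
  shows "vnat_iso V C D F G \<alpha>"
proof -
  interpret vnat V C D F G \<alpha> by fact
  have F: "vfunctor V C D F" and G: "vfunctor V C D G" by unfold_locales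
  note [simp] = vfunctor_simps[OF F] vfunctor_simps[OF G] mor_cpt[OF \<alpha>] \<beta> mor_gmap[OF F] mor_gmap[OF G]
  have "vnat V C D G F \<beta>"
  proof (rule vnatI)
    fix f assume f [simp]: "mor C f"
    let ?a = "cpt F G \<alpha>" and ?b = "cpt G F \<beta>"
    have "?b (Tgt f) \<odot>\<^bsub>D\<^esub> gmap G f = ?b (Tgt f) \<odot>\<^bsub>D\<^esub> ((gmap G f \<odot>\<^bsub>D\<^esub> ?a (Src f)) \<odot>\<^bsub>D\<^esub> ?b (Src f))"
      by (simp add: r)
    also have "\<dots> = (?b (Tgt f) \<odot>\<^bsub>D\<^esub> ?a (Tgt f)) \<odot>\<^bsub>D\<^esub> (gmap F f \<odot>\<^bsub>D\<^esub> ?b (Src f))"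
      unfolding cpt_natural[OF \<alpha> f, symmetric] by simp
    also have "\<dots> = gmap F f \<odot>\<^bsub>D\<^esub> ?b (Src f)"
      by (simp only: l mor_simps f) simp
    finally show "?b (Tgt f) \<odot>\<^bsub>D\<^esub> gmap G f = gmap F f \<odot>\<^bsub>D\<^esub> ?b (Src f)" .
  qed (simp_all add: F G ext)
  moreover have "vnat_comp V C D F G F \<beta> \<alpha> = vnat_id C D F"
    by (rule family_eqI[of _ C _ F F]) (simp_all add: cpt_vnat_comp cpt_vnat_id l)
  moreover have "vnat_comp V C D G F G \<alpha> \<beta> = vnat_id C D G"
    by (rule family_eqI[of _ C _ G G]) (simp_all add: cpt_vnat_comp cpt_vnat_id r)
  ultimately show ?thesis unfolding vnat_iso_def using \<alpha> by blast
qed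

text \<open>
  This is the Yoneda lemma. A natural transformation \<open>\<theta> : K(P,-) \<rightarrow> [W, K(X,-)]\<close> is determined by
  the image \<open>\<gamma>\<close> of the identity, as \<open>\<theta> f = (w \<mapsto> f \<circ> \<gamma> w)\<close>; conversely this formula is natural
  for every \<open>\<gamma>\<close>. So a cotensor in \<open>K\<^sup>o\<^sup>p\<close> is an arrow \<open>\<gamma>\<close> for which the formula gives an isomorphism
  at every object.
\<close>

lemma is_cotensor_vop:
  assumes K [simp]: "vcategory V K"
  shows "is_cotensor V (vop V K) W X P \<gamma> \<longleftrightarrow> is_tensor K W X P \<gamma>"
proof
  assume "is_cotensor V (vop V K) W X P \<gamma>"
  then obtain \<theta> where [simp]: "W \<in> Obj V" "X \<in> VOb K" "P \<in> VOb K"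
    and iso: "vnat_iso V K (vself V) (vrep V K P) (vfunctor_comp V K (vrep V (vself V) W) (vrep V K X)) \<theta>"
    and counit: "cotensor_counit V (vop V K) W X P \<theta> = \<gamma>"
    unfolding is_cotensor_def cotensor_iso_def by auto
  let ?F = "vrep V K P" and ?G = "vfunctor_comp V K (vrep V (vself V) W) (vrep V K X)"
  have X: "vfunctor V K (vself V) (vrep V K X)" and F: "vfunctor V K (vself V) ?F"
    and W: "vfunctor V (vself V) (vself V) (vrep V (vself V) W)"
    by (simp_all add: vfunctor_vrep)
  note G = vfunctor_vfunctor_comp[OF X W]
  obtain \<beta> where \<theta>: "vnat V K (vself V) ?F ?G \<theta>" and \<beta>: "vnat V K (vself V) ?G ?F \<beta>"
    and l: "vnat_comp V K (vself V) ?F ?G ?F \<beta> \<theta> = vnat_id K (vself V) ?F"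
    and r: "vnat_comp V K (vself V) ?G ?F ?G \<theta> \<beta> = vnat_id K (vself V) ?G"
    using iso unfolding vnat_iso_def by blast
  define H where "H D = IHom V W (VHom K X D)" for D
  have H [simp]: "VMap_ob ?G D = H D" "H D \<in> Obj V" if "D \<in> VOb K" for D
    using that by (simp_all add: H_def)
  note [simp] = mor_cpt[OF \<theta>] mor_cpt[OF \<beta>]
  define t where "t D = unname V (VHom K P D) (H D) (\<theta> D)" for D
  define b where "b D = unname V (H D) (VHom K P D) (\<beta> D)" for D
  have mt: "mor (vself V) (pt (VHom K P D) (H D) (\<theta> D))" if "D \<in> VOb K" for D
    using mor_cpt[OF \<theta> that] that by (simp add: cpt_def H_def)
  have mb: "mor (vself V) (pt (H D) (VHom K P D) (\<beta> D))" if "D \<in> VOb K" for D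
    using mor_cpt[OF \<beta> that] that by (simp add: cpt_def H_def)
  have t [simp]: "t D \<in> Arr V" "Dom V (t D) = VHom K P D" "Cod V (t D) = H D"
    and b [simp]: "b D \<in> Arr V" "Dom V (b D) = H D" "Cod V (b D) = VHom K P D" if "D \<in> VOb K" for D
    using app_unname(2)[OF mt[OF that], of "gen (VHom K P D)"] app_unname(2)[OF mb[OF that], of "gen (H D)"] that
    by (simp_all add: t_def b_def in_Hom)
  have at: "act (t D) a = app (cpt ?F ?G \<theta> D) a" if "D \<in> VOb K" "el (VHom K P D) a" for D a
    using app_unname(1)[OF mt[OF that(1)] that(2)] that by (simp add: t_def cpt_def H_def)
  have ab: "act (b D) a = app (cpt ?G ?F \<beta> D) a" if "D \<in> VOb K" "el (H D) a" for D a
    using app_unname(1)[OF mb[OF that(1)] that(2)] that by (simp add: b_def cpt_def H_def)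
  have iso_t: "iso V (t D)" if D [simp]: "D \<in> VOb K" for D
    unfolding iso_def
  proof (intro exI inverse_pairI)
    have "cpt ?G ?F \<beta> D \<bullet> cpt ?F ?G \<theta> D = gid (vself V) (VMap_ob ?F D)"
      using cpt_vnat_comp[OF D, of ?F ?F "vself V" ?G \<beta> \<theta>] l by (simp add: cpt_vnat_id)
    then have "app (cpt ?G ?F \<beta> D) (app (cpt ?F ?G \<theta> D) (gen (VHom K P D))) = gen (VHom K P D)"
      using app_gcomp[of "cpt ?F ?G \<theta> D" "cpt ?G ?F \<beta> D" "gen (VHom K P D)"] by simp
    then show "b D \<cdot> t D = Id V (Dom V (t D))"
      by (intro arrow_eqI[of _ "gen (VHom K P D)"]) (simp_all add: at ab H_def)
    have "cpt ?F ?G \<theta> D \<bullet> cpt ?G ?F \<beta> D = gid (vself V) (VMap_ob ?G D)"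
      using cpt_vnat_comp[OF D, of ?G ?G "vself V" ?F \<theta> \<beta>] r by (simp add: cpt_vnat_id)
    then have "app (cpt ?F ?G \<theta> D) (app (cpt ?G ?F \<beta> D) (gen (H D))) = gen (H D)"
      using app_gcomp[of "cpt ?G ?F \<beta> D" "cpt ?F ?G \<theta> D" "gen (H D)"] by (simp add: H_def)
    then show "t D \<cdot> b D = Id V (Cod V (t D))"
      by (intro arrow_eqI[of _ "gen (H D)"]) (simp_all add: at ab H_def)
  qed simp_all
  have \<gamma>_def: "\<gamma> = unname V W (VHom K X P) (t P \<cdot> VId K P)"
    using counit by (simp add: cotensor_counit_def t_def H_def)
  have mi: "mor (vself V) (pt W (VHom K X P) (t P \<cdot> VId K P))"
    by (simp add: mor_pt in_Hom H_def)
  have \<gamma>: "\<gamma> \<in> Hom V W (VHom K X P)"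
    using app_unname(2)[OF mi, of "gen W"] by (simp add: \<gamma>_def)
  \<comment> \<open>The image of the identity of \<open>P\<close>; it is \<open>\<gamma>\<close>, regarded as a morphism of the base.\<close>
  define s where "s = gmk W (VHom K X P) (act (t P) (Body (gid K P)))"
  have s: "pt W (VHom K X P) (t P \<cdot> VId K P) = s"
    by (intro gmor_eqI) (simp_all add: s_def Body_pt gid_def H_def)
  have s_mor: "mor (vself V) s" using mi s by simp
  have s_app: "app s w = act \<gamma> w" if "el W w" for w
    using app_unname(1)[OF mi that] by (simp add: \<gamma>_def s)
  have "tensor_cmp K W X P \<gamma> D = t D" if D [simp]: "D \<in> VOb K" for D
  proof (rule hom_arrow_eqI[of _ K P D "H D"])
    fix f assume f [simp]: "mor K f" and [simp]: "Src f = P" "Tgt f = D"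
    have "app (cpt ?F ?G \<theta> D \<bullet> gmap ?F f) (Body (gid K P))
        = app (gmap ?G f \<bullet> cpt ?F ?G \<theta> P) (Body (gid K P))"
      using cpt_natural[OF \<theta> f] by simp
    moreover have "app (gmap ?F f) (Body (gid K P)) = Body f"
      by (simp add: app_gmap_vrep)
    moreover have "app (cpt ?F ?G \<theta> P) (Body (gid K P)) = Body s"
      by (simp add: s_def at)
    moreover have "el (VHom K P P) (Body (gid K P))" by simp
    ultimately have "act (t D) (Body f) = app (gmap ?G f) (Body s)"
      by (simp add: mor_gmap[OF F] mor_gmap[OF G] at)
    also have "\<dots> = app (gmap (vrep V (vself V) W) (gmap (vrep V K X) f)) (Body s)"
      by (simp add: gmap_vfunctor_comp[OF X W])
    also have "\<dots> = Body (gmap (vrep V K X) f \<bullet> s)"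
      using s_mor by (subst app_gmap_vrep) (simp_all add: s_def mor_gmap[OF X])
    also have "gmap (vrep V K X) f \<bullet> s
        = gmk W (VHom K X D) (act (tensor_cmp K W X P \<gamma> D) (Body f))"
    proof (rule mor_eqI)
      show "mor (vself V) (gmap (vrep V K X) f \<bullet> s)"
        using s_mor by (simp add: mor_gmap[OF X] s_def)
      show "mor (vself V) (gmk W (VHom K X D) (act (tensor_cmp K W X P \<gamma> D) (Body f)))"
        using \<gamma> by simp
      fix w assume "el (Src (gmk W (VHom K X D) (act (tensor_cmp K W X P \<gamma> D) (Body f)))) w"
      then have w [simp]: "el W w" by simp
      have "app (gmap (vrep V K X) f \<bullet> s) w = app (gmap (vrep V K X) f) (act \<gamma> w)"
        using s_mor by (subst app_gcomp) (simp_all add: mor_gmap[OF X] s_app[OF w, symmetric], simp_all add: s_def)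
      also have "\<dots> = app (gmap (vrep V K X) f) (Body (gmk X P (act \<gamma> w)))"
        by simp
      also have "\<dots> = Body (f \<odot>\<^bsub>K\<^esub> gmk X P (act \<gamma> w))"
        using \<gamma> by (subst app_gmap_vrep) (simp_all add: in_Hom)
      finally show "app (gmap (vrep V K X) f \<bullet> s) w
          = app (gmk W (VHom K X D) (act (tensor_cmp K W X P \<gamma> D) (Body f))) w"
        using \<gamma> by (simp add: app_tensor_cmp)
    qed (simp_all add: s_def)
    finally show "act (tensor_cmp K W X P \<gamma> D) (Body f) = act (t D) (Body f)"
      by simp
  qed (use \<gamma> in \<open>simp_all add: in_Hom H_def\<close>)
  then show "is_tensor K W X P \<gamma>"
    using \<gamma> iso_t by (simp add: is_tensor_def)
next
  assume "is_tensor K W X P \<gamma>"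
  then have [simp]: "W \<in> Obj V" "X \<in> VOb K" "P \<in> VOb K" and \<gamma> [simp]: "\<gamma> \<in> Hom V W (VHom K X P)"
    and iso [simp]: "\<And>D. D \<in> VOb K \<Longrightarrow> iso V (tensor_cmp K W X P \<gamma> D)"
    by (simp_all add: is_tensor_def)
  let ?F = "vrep V K P" and ?G = "vfunctor_comp V K (vrep V (vself V) W) (vrep V K X)"
  let ?t = "tensor_cmp K W X P \<gamma>"
  have X: "vfunctor V K (vself V) (vrep V K X)" and F: "vfunctor V K (vself V) ?F"
    and W: "vfunctor V (vself V) (vself V) (vrep V (vself V) W)"
    by (simp_all add: vfunctor_vrep)
  note G = vfunctor_vfunctor_comp[OF X W]
  note [simp] = mor_gmap[OF F] mor_gmap[OF G] mor_gmap[OF X] mor_gmap[OF W]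
  have \<gamma>a [simp]: "\<gamma> \<in> Arr V" "Dom V \<gamma> = W" "Cod V \<gamma> = VHom K X P"
    using \<gamma> by (simp_all add: in_Hom)
  define \<theta> where "\<theta> = (\<lambda>D\<in>VOb K. vname (?t D))"
  define \<beta> where "\<beta> = (\<lambda>D\<in>VOb K. vname (Inv V (?t D)))"
  have \<theta>: "cpt ?F ?G \<theta> D = pt (VHom K P D) (IHom V W (VHom K X D)) (vname (?t D))"
    and \<beta>: "cpt ?G ?F \<beta> D = pt (IHom V W (VHom K X D)) (VHom K P D) (vname (Inv V (?t D)))"
    if "D \<in> VOb K" for D
    using that by (simp_all add: cpt_def \<theta>_def \<beta>_def)
  have "vnat V K (vself V) ?F ?G \<theta>"
  proof (rule vnatI)
    fix f assume f [simp]: "mor K f"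
    show "cpt ?F ?G \<theta> (Tgt f) \<bullet> gmap ?F f = gmap ?G f \<bullet> cpt ?F ?G \<theta> (Src f)"
    proof (rule mor_eqI)
      fix a assume "el (Src (gmap ?G f \<bullet> cpt ?F ?G \<theta> (Src f))) a"
      then have a: "el (VHom K P (Src f)) a" by simp
      define s where "s = gmk P (Src f) a"
      have s [simp]: "mor K s" "Src s = P" "Tgt s = Src f" and a_def: "a = Body s"
        using a by (simp_all add: s_def)
      define u where "u = gmk W (VHom K X (Src f)) (act (?t (Src f)) (Body s))"
      have u [simp]: "mor (vself V) u" "Src u = W" "Tgt u = VHom K X (Src f)"
        by (simp_all add: u_def)
      have uw: "app u w = Body (s \<odot>\<^bsub>K\<^esub> gmk X P (act \<gamma> w))" if "el W w" for w
        using that unfolding u_def by (simp add: app_tensor_cmp)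
      have "app (gmap ?G f \<bullet> cpt ?F ?G \<theta> (Src f)) a
          = app (gmap (vrep V (vself V) W) (gmap (vrep V K X) f)) (Body u)"
        using a by (simp add: \<theta> gmap_vfunctor_comp[OF X W] a_def u_def)
      also have "\<dots> = Body (gmap (vrep V K X) f \<bullet> u)"
        by (simp add: app_gmap_vrep)
      also have "gmap (vrep V K X) f \<bullet> u
          = gmk W (VHom K X (Tgt f)) (act (?t (Tgt f)) (Body (f \<odot>\<^bsub>K\<^esub> s)))"
      proof (rule mor_eqI)
        fix w assume "el (Src (gmk W (VHom K X (Tgt f)) (act (?t (Tgt f)) (Body (f \<odot>\<^bsub>K\<^esub> s))))) w"
        then have [simp]: "el W w" by simp
        show "app (gmap (vrep V K X) f \<bullet> u) w
            = app (gmk W (VHom K X (Tgt f)) (act (?t (Tgt f)) (Body (f \<odot>\<^bsub>K\<^esub> s)))) w"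
          by (simp add: app_tensor_cmp uw app_gmap_vrep)
      qed simp_all
      finally show "app (cpt ?F ?G \<theta> (Tgt f) \<bullet> gmap ?F f) a
          = app (gmap ?G f \<bullet> cpt ?F ?G \<theta> (Src f)) a"
        using a by (simp add: \<theta> a_def app_gmap_vrep)
    qed (simp_all add: \<theta>)
  qed (simp_all add: F G \<theta>, simp_all add: \<theta>_def)
  then have "vnat_iso V K (vself V) ?F ?G \<theta>"
  proof (rule vnat_isoI)
    fix D assume [simp]: "D \<in> VOb K"
    show "mor (vself V) (cpt ?G ?F \<beta> D)" by (simp add: \<beta>)
    show "cpt ?G ?F \<beta> D \<bullet> cpt ?F ?G \<theta> D = gid (vself V) (VMap_ob ?F D)"
      by (rule mor_eqI) (simp_all add: \<beta> \<theta>)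
    show "cpt ?F ?G \<theta> D \<bullet> cpt ?G ?F \<beta> D = gid (vself V) (VMap_ob ?G D)"
      by (rule mor_eqI) (simp_all add: \<beta> \<theta>)
  qed (simp add: \<beta>_def)
  moreover have "cotensor_counit V (vop V K) W X P \<theta> = \<gamma>"
  proof -
    have m: "mor (vself V) (pt (VHom K P P) (IHom V W (VHom K X P)) (\<theta> P))"
      using mor_vname[of "?t P"] by (simp add: \<theta>_def)
    note u = app_unname[OF m]
    have "unname V (VHom K P P) (IHom V W (VHom K X P)) (\<theta> P) = ?t P"
      using u[of "gen (VHom K P P)"]
      by (intro arrow_eqI[of _ "gen (VHom K P P)"]) (simp_all add: in_Hom \<theta>_def)
    moreover have "unname V W (VHom K X P) (?t P \<cdot> VId K P) = \<gamma>"
    proof -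
      have m': "mor (vself V) (pt W (VHom K X P) (?t P \<cdot> VId K P))"
        by (simp add: mor_pt in_Hom)
      have eq: "pt W (VHom K X P) (?t P \<cdot> VId K P) = gmk W (VHom K X P) (act (?t P) (Body (gid K P)))"
        by (intro gmor_eqI) (simp_all add: Body_pt gid_def)
      show ?thesis
        using app_unname[OF m', of "gen W"]
        by (intro arrow_eqI[of _ "gen W"]) (simp_all add: in_Hom eq app_tensor_cmp)
    qed
    ultimately show ?thesis by (simp add: cotensor_counit_def)
  qed
  ultimately show "is_cotensor V (vop V K) W X P \<gamma>"
    unfolding is_cotensor_def cotensor_iso_def by (intro exI[of _ \<theta>]) simp
qed

end


section \<open>Monads and theories through generalised morphisms\<close>

context smcc
begin

lemma vnat_iff:
  "vnat V C D F G \<alpha> \<longleftrightarrow> vfunctor V C D F \<and> vfunctor V C D G \<and> \<alpha> \<in> extensional (VOb C) \<and>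
    (\<forall>A \<in> VOb C. mor D (cpt F G \<alpha> A)) \<and>
    (\<forall>f. mor C f \<longrightarrow> cpt F G \<alpha> (Tgt f) \<odot>\<^bsub>D\<^esub> gmap F f = gmap G f \<odot>\<^bsub>D\<^esub> cpt F G \<alpha> (Src f))"
  using vnatI[of C D F G \<alpha>] vnat_extensional[of C D F G \<alpha>] mor_cpt[of C D F G \<alpha>]
    cpt_natural[of C D F G \<alpha>] vnat_def[of V C D F G \<alpha>] by blast

lemma vnat_comp_eq_iff:
  assumes "\<gamma> \<in> extensional (VOb C)"
  shows "vnat_comp V C D F G H \<beta> \<alpha> = \<gamma> \<longleftrightarrow>
    (\<forall>A \<in> VOb C. cpt G H \<beta> A \<odot>\<^bsub>D\<^esub> cpt F G \<alpha> A = cpt F H \<gamma> A)"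
proof
  assume "\<forall>A \<in> VOb C. cpt G H \<beta> A \<odot>\<^bsub>D\<^esub> cpt F G \<alpha> A = cpt F H \<gamma> A"
  then show "vnat_comp V C D F G H \<beta> \<alpha> = \<gamma>"
    by (intro family_eqI[OF vnat_comp_extensional assms, of F H]) (simp add: cpt_vnat_comp)
qed (auto simp: cpt_vnat_comp)

definition eta_at :: "('c, 'm) vmonad \<Rightarrow> 'c \<Rightarrow> ('c, 'o, 'm) gmor" where
  "eta_at M A = pt A (VMap_ob (Endo M) A) (Eta M A)"

definition mu_at :: "('c, 'm) vmonad \<Rightarrow> 'c \<Rightarrow> ('c, 'o, 'm) gmor" where
  "mu_at M A = pt (VMap_ob (Endo M) (VMap_ob (Endo M) A)) (VMap_ob (Endo M) A) (Mu M A)"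

lemma eta_mu_simps [simp]:
  "Src (eta_at M A) = A" "Tgt (eta_at M A) = VMap_ob (Endo M) A"
  "Src (mu_at M A) = VMap_ob (Endo M) (VMap_ob (Endo M) A)" "Tgt (mu_at M A) = VMap_ob (Endo M) A"
  by (simp_all add: eta_at_def mu_at_def)

text \<open>
  The components of whiskered and of composite transformations are images and composites of
  components, so the enriched monad laws are the usual ones for \<open>\<eta>\<close> and \<open>\<mu>\<close>, read in the category of
  generalised morphisms.
\<close>

lemma vmonad_iff:
  "vmonad V C M \<longleftrightarrow> vfunctor V C C (Endo M) \<and> Eta M \<in> extensional (VOb C) \<and> Mu M \<in> extensional (VOb C) \<and>
    (\<forall>A \<in> VOb C. mor C (eta_at M A) \<and> mor C (mu_at M A)) \<and>
    (\<forall>f. mor C f \<longrightarrow> eta_at M (Tgt f) \<odot>\<^bsub>C\<^esub> f = gmap (Endo M) f \<odot>\<^bsub>C\<^esub> eta_at M (Src f)) \<and>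
    (\<forall>f. mor C f \<longrightarrow> mu_at M (Tgt f) \<odot>\<^bsub>C\<^esub> gmap (Endo M) (gmap (Endo M) f)
        = gmap (Endo M) f \<odot>\<^bsub>C\<^esub> mu_at M (Src f)) \<and>
    (\<forall>A \<in> VOb C. mu_at M A \<odot>\<^bsub>C\<^esub> gmap (Endo M) (eta_at M A) = gid C (VMap_ob (Endo M) A)) \<and>
    (\<forall>A \<in> VOb C. mu_at M A \<odot>\<^bsub>C\<^esub> eta_at M (VMap_ob (Endo M) A) = gid C (VMap_ob (Endo M) A)) \<and>
    (\<forall>A \<in> VOb C. mu_at M A \<odot>\<^bsub>C\<^esub> gmap (Endo M) (mu_at M A)
        = mu_at M A \<odot>\<^bsub>C\<^esub> mu_at M (VMap_ob (Endo M) A))"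
    (is "_ \<longleftrightarrow> vfunctor V C C ?E \<and> ?rest")
proof (cases "vfunctor V C C ?E")
  case E: True
  note [simp] = vfunctor_simps[OF E] gmap_vfunctor_comp[OF E E] E
  let ?I = "vfunctor_id V C" and ?EE = "vfunctor_comp V C ?E ?E"
  have I [simp]: "vfunctor V C C ?I" by (simp add: vfunctor_vfunctor_id)
  have EE [simp]: "vfunctor V C C ?EE" by (simp add: vfunctor_vfunctor_comp[OF E E])
  have \<eta>: "cpt ?I ?E (Eta M) A = eta_at M A" and \<mu>: "cpt ?EE ?E (Mu M) A = mu_at M A" if "A \<in> VOb C" for A
    using that by (simp_all add: cpt_def eta_at_def mu_at_def)
  have nat_eta: "vnat V C C ?I ?E (Eta M) \<longleftrightarrow> Eta M \<in> extensional (VOb C) \<and> (\<forall>A \<in> VOb C. mor C (eta_at M A)) \<and>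
      (\<forall>f. mor C f \<longrightarrow> eta_at M (Tgt f) \<odot>\<^bsub>C\<^esub> f = gmap ?E f \<odot>\<^bsub>C\<^esub> eta_at M (Src f))"
    by (simp add: vnat_iff \<eta>)
  have nat_mu: "vnat V C C ?EE ?E (Mu M) \<longleftrightarrow> Mu M \<in> extensional (VOb C) \<and> (\<forall>A \<in> VOb C. mor C (mu_at M A)) \<and>
      (\<forall>f. mor C f \<longrightarrow> mu_at M (Tgt f) \<odot>\<^bsub>C\<^esub> gmap ?E (gmap ?E f) = gmap ?E f \<odot>\<^bsub>C\<^esub> mu_at M (Src f))"
    by (simp add: vnat_iff \<mu>)
  have u1: "vnat_comp V C C ?E ?EE ?E (Mu M) (vnat_post V C ?E ?I ?E (Eta M)) = vnat_id C C ?E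
     \<longleftrightarrow> (\<forall>A \<in> VOb C. mu_at M A \<odot>\<^bsub>C\<^esub> gmap ?E (eta_at M A) = gid C (VMap_ob ?E A))"
  proof -
    have "cpt ?E ?EE (vnat_post V C ?E ?I ?E (Eta M)) A = gmap ?E (eta_at M A)" if "A \<in> VOb C" for A
      using that by (simp add: cpt_def vnat_post_def gmap_def pt_def act_def eta_at_def)
    then show ?thesis
      by (simp add: vnat_comp_eq_iff cpt_vnat_id \<mu>)
  qed
  have u2: "vnat_comp V C C ?E ?EE ?E (Mu M) (vnat_pre C (Eta M) ?E) = vnat_id C C ?E
     \<longleftrightarrow> (\<forall>A \<in> VOb C. mu_at M A \<odot>\<^bsub>C\<^esub> eta_at M (VMap_ob ?E A) = gid C (VMap_ob ?E A))"
  proof -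
    have "cpt ?E ?EE (vnat_pre C (Eta M) ?E) A = eta_at M (VMap_ob ?E A)" if "A \<in> VOb C" for A
      using that by (simp add: cpt_def vnat_pre_def eta_at_def)
    then show ?thesis
      by (simp add: vnat_comp_eq_iff cpt_vnat_id \<mu>)
  qed
  let ?EEE = "vfunctor_comp V C ?E ?EE"
  have as: "vnat_comp V C C ?EEE ?EE ?E (Mu M) (vnat_post V C ?E ?EE ?E (Mu M))
       = vnat_comp V C C ?EEE ?EE ?E (Mu M) (vnat_pre C (Mu M) ?E)
     \<longleftrightarrow> (\<forall>A \<in> VOb C. mu_at M A \<odot>\<^bsub>C\<^esub> gmap ?E (mu_at M A) = mu_at M A \<odot>\<^bsub>C\<^esub> mu_at M (VMap_ob ?E A))"
  proof -
    have "cpt ?EEE ?EE (vnat_post V C ?E ?EE ?E (Mu M)) A = gmap ?E (mu_at M A)"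
      "cpt ?EEE ?EE (vnat_pre C (Mu M) ?E) A = mu_at M (VMap_ob ?E A)" if "A \<in> VOb C" for A
      using that by (simp_all add: cpt_def vnat_post_def vnat_pre_def gmap_def pt_def act_def mu_at_def)
    then show ?thesis
      by (simp add: vnat_comp_eq_iff cpt_vnat_comp \<mu>)
  qed
  show ?thesis
    unfolding vmonad_def vmonad_axioms_def nat_eta nat_mu u1 u2 as by auto
next
  case False
  then show ?thesis unfolding vmonad_def by simp
qed

lemma vmonadD:
  assumes "vmonad V C M"
  shows "vfunctor V C C (Endo M)"
    and "A \<in> VOb C \<Longrightarrow> mor C (eta_at M A)" "A \<in> VOb C \<Longrightarrow> mor C (mu_at M A)"
    and "mor C f \<Longrightarrow> eta_at M (Tgt f) \<odot>\<^bsub>C\<^esub> f = gmap (Endo M) f \<odot>\<^bsub>C\<^esub> eta_at M (Src f)"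
    and "mor C f \<Longrightarrow> mu_at M (Tgt f) \<odot>\<^bsub>C\<^esub> gmap (Endo M) (gmap (Endo M) f)
      = gmap (Endo M) f \<odot>\<^bsub>C\<^esub> mu_at M (Src f)"
    and "A \<in> VOb C \<Longrightarrow> mu_at M A \<odot>\<^bsub>C\<^esub> gmap (Endo M) (eta_at M A) = gid C (VMap_ob (Endo M) A)"
    and "A \<in> VOb C \<Longrightarrow> mu_at M A \<odot>\<^bsub>C\<^esub> eta_at M (VMap_ob (Endo M) A) = gid C (VMap_ob (Endo M) A)"
    and "A \<in> VOb C \<Longrightarrow> mu_at M A \<odot>\<^bsub>C\<^esub> gmap (Endo M) (mu_at M A)
      = mu_at M A \<odot>\<^bsub>C\<^esub> mu_at M (VMap_ob (Endo M) A)"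
  using assms unfolding vmonad_iff by blast+

lemma monad_morphism_iff:
  assumes S: "vmonad V C S" and T: "vmonad V C T"
  shows "monad_morphism V C S T \<alpha> \<longleftrightarrow> vnat V C C (Endo S) (Endo T) \<alpha> \<and>
    (\<forall>A \<in> VOb C. cpt (Endo S) (Endo T) \<alpha> A \<odot>\<^bsub>C\<^esub> eta_at S A = eta_at T A) \<and>
    (\<forall>A \<in> VOb C. cpt (Endo S) (Endo T) \<alpha> A \<odot>\<^bsub>C\<^esub> mu_at S A
      = mu_at T A \<odot>\<^bsub>C\<^esub> (gmap (Endo T) (cpt (Endo S) (Endo T) \<alpha> A) \<odot>\<^bsub>C\<^esub>
          cpt (Endo S) (Endo T) \<alpha> (VMap_ob (Endo S) A)))"
proof -
  let ?S = "Endo S" and ?T = "Endo T" and ?I = "vfunctor_id V C"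
  let ?SS = "vfunctor_comp V C ?S ?S" and ?TS = "vfunctor_comp V C ?T ?S" and ?TT = "vfunctor_comp V C ?T ?T"
  note [simp] = vfunctor_simps[OF vmonadD(1)[OF S]] vfunctor_simps[OF vmonadD(1)[OF T]]
  have ext: "Eta T \<in> extensional (VOb C)" using T by (simp add: vmonad_iff)
  have c [simp]: "cpt ?I ?S (Eta S) A = eta_at S A" "cpt ?I ?T (Eta T) A = eta_at T A"
    "cpt ?SS ?S (Mu S) A = mu_at S A" "cpt ?TT ?T (Mu T) A = mu_at T A"
    "cpt ?TS ?TT (vnat_post V C ?T ?S ?T \<alpha>) A = gmap ?T (cpt ?S ?T \<alpha> A)"
    "cpt ?SS ?TS (vnat_pre C \<alpha> ?S) A = cpt ?S ?T \<alpha> (VMap_ob ?S A)" if "A \<in> VOb C" for A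
    using that
    by (simp_all add: cpt_def eta_at_def mu_at_def vnat_post_def vnat_pre_def gmap_def pt_def act_def)
  show ?thesis
    unfolding monad_morphism_def
    by (simp add: vnat_comp_eq_iff cpt_vnat_comp ext)
qed

lemma category_Mnd: "category (Mnd V C)"
proof
  have morph: "vmonad V C S" "vmonad V C T" "monad_morphism V C S T \<alpha>" "vnat V C C (Endo S) (Endo T) \<alpha>"
    if "(S, \<alpha>, T) \<in> Arr (Mnd V C)" for S \<alpha> T
    using that by (auto simp: Mnd_def monad_morphism_iff)
  have ex: "\<exists>\<alpha>. f = (S, \<alpha>, T) \<and> (S, \<alpha>, T) \<in> Arr (Mnd V C)" if "f \<in> Hom (Mnd V C) S T" for f S T
    using that by (auto simp: Mnd_def in_Hom)
  show "Dom (Mnd V C) f \<in> Obj (Mnd V C)" "Cod (Mnd V C) f \<in> Obj (Mnd V C)" if "f \<in> Arr (Mnd V C)" for f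
    using that by (auto simp: Mnd_def)
  show "Id (Mnd V C) S \<in> Hom (Mnd V C) S S" if "S \<in> Obj (Mnd V C)" for S
  proof -
    have S: "vmonad V C S" using that by (simp add: Mnd_def)
    note [simp] = vfunctor_simps[OF vmonadD(1)[OF S]] vmonadD(1-3)[OF S] gmap_gid[OF vmonadD(1)[OF S]]
    show ?thesis
      using S by (simp add: Mnd_def in_Hom monad_morphism_iff cpt_vnat_id vnat_vnat_id)
  qed
  show "Comp (Mnd V C) g f \<in> Hom (Mnd V C) S U"
    if hom: "f \<in> Hom (Mnd V C) S T" "g \<in> Hom (Mnd V C) T U" for f g S T U
  proof -
    obtain \<alpha> \<beta> where f: "f = (S, \<alpha>, T)" "f \<in> Arr (Mnd V C)" and g: "g = (T, \<beta>, U)" "g \<in> Arr (Mnd V C)"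
      using ex[OF hom(1)] ex[OF hom(2)] by blast
    note S = morph(1)[OF f(2)[unfolded f(1)]] and T = morph(2)[OF f(2)[unfolded f(1)]]
      and U = morph(2)[OF g(2)[unfolded g(1)]]
    note \<alpha>m = morph(3)[OF f(2)[unfolded f(1)]] and \<beta>m = morph(3)[OF g(2)[unfolded g(1)]]
    note \<alpha> = morph(4)[OF f(2)[unfolded f(1)]] and \<beta> = morph(4)[OF g(2)[unfolded g(1)]]
    note FS = vmonadD(1)[OF S] and FT = vmonadD(1)[OF T] and FU = vmonadD(1)[OF U]
    note [simp] = vfunctor_simps[OF FS] vfunctor_simps[OF FT] vfunctor_simps[OF FU]
      mor_gmap[OF FS] mor_gmap[OF FT] mor_gmap[OF FU] mor_cpt[OF \<alpha>] mor_cpt[OF \<beta>]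
      vmonadD(2,3)[OF S] vmonadD(2,3)[OF T] vmonadD(2,3)[OF U]
      gmap_gcomp[OF FU]
    let ?a = "cpt (Endo S) (Endo T) \<alpha>" and ?b = "cpt (Endo T) (Endo U) \<beta>"
    let ?S = "VMap_ob (Endo S)" and ?T = "VMap_ob (Endo T)"
    have ae: "?a A \<odot>\<^bsub>C\<^esub> eta_at S A = eta_at T A"
      and am: "?a A \<odot>\<^bsub>C\<^esub> mu_at S A = mu_at T A \<odot>\<^bsub>C\<^esub> (gmap (Endo T) (?a A) \<odot>\<^bsub>C\<^esub> ?a (?S A))"
      and be: "?b A \<odot>\<^bsub>C\<^esub> eta_at T A = eta_at U A"
      and bm: "?b A \<odot>\<^bsub>C\<^esub> mu_at T A = mu_at U A \<odot>\<^bsub>C\<^esub> (gmap (Endo U) (?b A) \<odot>\<^bsub>C\<^esub> ?b (?T A))"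
      if "A \<in> VOb C" for A
      using \<alpha>m[unfolded monad_morphism_iff[OF S T]] \<beta>m[unfolded monad_morphism_iff[OF T U]] that by auto
    have "(?b A \<odot>\<^bsub>C\<^esub> ?a A) \<odot>\<^bsub>C\<^esub> mu_at S A
        = mu_at U A \<odot>\<^bsub>C\<^esub> (gmap (Endo U) (?b A \<odot>\<^bsub>C\<^esub> ?a A) \<odot>\<^bsub>C\<^esub> (?b (?S A) \<odot>\<^bsub>C\<^esub> ?a (?S A)))"
      if A [simp]: "A \<in> VOb C" for A
    proof -
      have "(?b A \<odot>\<^bsub>C\<^esub> ?a A) \<odot>\<^bsub>C\<^esub> mu_at S A
          = (?b A \<odot>\<^bsub>C\<^esub> mu_at T A) \<odot>\<^bsub>C\<^esub> (gmap (Endo T) (?a A) \<odot>\<^bsub>C\<^esub> ?a (?S A))"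
        by (simp add: am)
      also have "\<dots> = mu_at U A \<odot>\<^bsub>C\<^esub> (gmap (Endo U) (?b A) \<odot>\<^bsub>C\<^esub>
          ((?b (?T A) \<odot>\<^bsub>C\<^esub> gmap (Endo T) (?a A)) \<odot>\<^bsub>C\<^esub> ?a (?S A)))"
        unfolding bm[OF A] by simp
      \<comment> \<open>Naturality of \<open>\<beta>\<close> at a component of \<open>\<alpha>\<close> interchanges the two middle factors.\<close>
      also have "?b (?T A) \<odot>\<^bsub>C\<^esub> gmap (Endo T) (?a A) = gmap (Endo U) (?a A) \<odot>\<^bsub>C\<^esub> ?b (?S A)"
        using cpt_natural[OF \<beta>, of "?a A"] by simp
      finally show ?thesis by simp
    qed
    then show ?thesis
      using S T U f(1) g(1) vnat_vnat_comp[OF \<alpha> \<beta>]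
      by (simp add: Mnd_def in_Hom monad_morphism_iff cpt_vnat_comp ae be)
  qed
  show "Comp (Mnd V C) f (Id (Mnd V C) S) = f" if hom: "f \<in> Hom (Mnd V C) S T" for f S T
  proof -
    obtain \<alpha> where f: "f = (S, \<alpha>, T)" "f \<in> Arr (Mnd V C)"
      using ex[OF hom] by blast
    note S = morph(1)[OF f(2)[unfolded f(1)]] and \<alpha> = morph(4)[OF f(2)[unfolded f(1)]]
    have "vnat_comp V C C (Endo S) (Endo S) (Endo T) \<alpha> (vnat_id C C (Endo S)) = \<alpha>"
      by (rule family_eqI[of _ C _ "Endo S" "Endo T"])
        (simp_all add: cpt_vnat_comp cpt_vnat_id mor_cpt[OF \<alpha>] vnat_extensional[OF \<alpha>]
          vfunctor_simps[OF vmonadD(1)[OF S]])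
    then show ?thesis by (simp add: f(1) Mnd_def)
  qed
  show "Comp (Mnd V C) (Id (Mnd V C) T) f = f" if hom: "f \<in> Hom (Mnd V C) S T" for f S T
  proof -
    obtain \<alpha> where f: "f = (S, \<alpha>, T)" "f \<in> Arr (Mnd V C)"
      using ex[OF hom] by blast
    note S = morph(1)[OF f(2)[unfolded f(1)]] and \<alpha> = morph(4)[OF f(2)[unfolded f(1)]]
    have "vnat_comp V C C (Endo S) (Endo T) (Endo T) (vnat_id C C (Endo T)) \<alpha> = \<alpha>"
      by (rule family_eqI[of _ C _ "Endo S" "Endo T"])
        (simp_all add: cpt_vnat_comp cpt_vnat_id mor_cpt[OF \<alpha>] vnat_extensional[OF \<alpha>]
          vfunctor_simps[OF vmonadD(1)[OF S]])
    then show ?thesis by (simp add: f(1) Mnd_def)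
  qed
  show "Comp (Mnd V C) (Comp (Mnd V C) h g) f = Comp (Mnd V C) h (Comp (Mnd V C) g f)"
    if hom: "f \<in> Hom (Mnd V C) S T" "g \<in> Hom (Mnd V C) T U" "h \<in> Hom (Mnd V C) U W" for f g h S T U W
  proof -
    obtain \<alpha> \<beta> \<gamma> where f: "f = (S, \<alpha>, T)" "f \<in> Arr (Mnd V C)" and g: "g = (T, \<beta>, U)" "g \<in> Arr (Mnd V C)"
      and h: "h = (U, \<gamma>, W)" "h \<in> Arr (Mnd V C)"
      using ex[OF hom(1)] ex[OF hom(2)] ex[OF hom(3)] by blast
    note \<alpha> = morph(4)[OF f(2)[unfolded f(1)]] and \<beta> = morph(4)[OF g(2)[unfolded g(1)]]
      and \<gamma> = morph(4)[OF h(2)[unfolded h(1)]]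
    note S = morph(1)[OF f(2)[unfolded f(1)]]
    have "vnat_comp V C C (Endo S) (Endo T) (Endo W) (vnat_comp V C C (Endo T) (Endo U) (Endo W) \<gamma> \<beta>) \<alpha>
        = vnat_comp V C C (Endo S) (Endo U) (Endo W) \<gamma> (vnat_comp V C C (Endo S) (Endo T) (Endo U) \<beta> \<alpha>)"
      by (rule family_eqI[of _ C _ "Endo S" "Endo W"])
        (simp_all add: cpt_vnat_comp mor_cpt[OF \<alpha>] mor_cpt[OF \<beta>] mor_cpt[OF \<gamma>]
          vfunctor_simps[OF vmonadD(1)[OF S]])
    then show ?thesis by (simp add: f(1) g(1) h(1) Mnd_def)
  qed
qed

text \<open>
  A theory \<open>\<tau> : V\<^sup>o\<^sup>p \<rightarrow> T\<close> is handled through its opposite \<open>F : V \<rightarrow> K\<close>, which preserves tensors.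
\<close>

definition theory_of :: "('o, 'o, 'm) vcategory \<Rightarrow> ('o, 'o, 'm) vfunctor \<Rightarrow> ('o, 'm) vtheory" where
  "theory_of K F = \<lparr>Theory_cat = vop V K, Theory_fun = fop (vself V) F\<rparr>"

definition cotheory :: "('o, 'o, 'm) vcategory \<Rightarrow> ('o, 'o, 'm) vfunctor \<Rightarrow> bool" where
  "cotheory K F \<longleftrightarrow> vfunctor V (vself V) K F \<and> VOb K = Obj V \<and> (\<forall>A \<in> Obj V. VMap_ob F A = A) \<and>
     (\<forall>W X P \<gamma>. is_tensor (vself V) W X P \<gamma> \<longrightarrow> is_tensor K W X P (VMap_hom F X P \<cdot> \<gamma>))"

lemma vtheory_theory_of:
  assumes "cotheory K F"
  shows "vtheory V (theory_of K F)"
proof -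
  have F: "vfunctor V (vself V) K F" and [simp]: "VOb K = Obj V"
    and ob: "\<And>A. A \<in> Obj V \<Longrightarrow> VMap_ob F A = A"
    and t: "\<And>W X P \<gamma>. is_tensor (vself V) W X P \<gamma> \<Longrightarrow> is_tensor K W X P (VMap_hom F X P \<cdot> \<gamma>)"
    using assms by (simp_all add: cotheory_def)
  have K: "vcategory V K" using F by (simp add: vfunctor_simps)
  have "preserves_cotensors V (vop V (vself V)) (vop V K) (fop (vself V) F)"
    unfolding preserves_cotensors_def is_cotensor_vop[OF K] is_cotensor_vop[OF vcategory_vself]
  proof (intro allI impI)
    fix W X P \<gamma> assume *: "is_tensor (vself V) W X P \<gamma>"
    then have "X \<in> Obj V" "P \<in> Obj V" by (simp_all add: is_tensor_def)
    then show "is_tensor K W (VMap_ob (fop (vself V) F) X) (VMap_ob (fop (vself V) F) P)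
        (VMap_hom (fop (vself V) F) P X \<cdot> \<gamma>)"
      using t[OF *] by (simp add: ob)
  qed
  then show ?thesis
    unfolding vtheory_def vtheory_axioms_def
    using vfunctor_fop[OF F] by (simp add: theory_of_def ob)
qed

text \<open>
  Opposites are involutive, so every theory arises in this way.
\<close>

lemma vtheory_cases:
  assumes "vtheory V T"
  obtains K F where "cotheory K F" "T = theory_of K F"
proof
  interpret vtheory V T by fact
  let ?K = "vop V (Theory_cat T)" and ?F = "fop (vself V) (Theory_fun T)"
  have \<tau>: "vfunctor V (vop V (vself V)) (Theory_cat T) (Theory_fun T)" by unfold_locales
  have T: "vcategory V (Theory_cat T)" by unfold_locales
  have F: "vfunctor V (vself V) ?K ?F" using vfunctor_fop[OF \<tau>] by simp
  show "T = theory_of ?K ?F"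
    unfolding theory_of_def using T fop_fop[OF \<tau>] by (intro vtheory.equality) simp_all
  have "is_tensor ?K W X P (VMap_hom ?F X P \<cdot> \<gamma>)" if *: "is_tensor (vself V) W X P \<gamma>" for W X P \<gamma>
  proof -
    have XP: "X \<in> Obj V" "P \<in> Obj V" using * by (simp_all add: is_tensor_def)
    have "is_cotensor V (vop V (vself V)) W X P \<gamma>" using * by (simp add: is_cotensor_vop)
    then have "is_cotensor V (vop V ?K) W X P (VMap_hom ?F X P \<cdot> \<gamma>)"
      using preserves XP T unfolding preserves_cotensors_def
      by (fastforce simp: identity_on_objects)
    then show ?thesis using is_cotensor_vop[OF vcategory_vop[OF T]] by simp
  qed
  then show "cotheory ?K ?F"
    using F by (simp add: cotheory_def theory_objects identity_on_objects)
qed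

lemma theory_morphism_theory_of:
  assumes F: "cotheory K F" and G: "cotheory L G"
  shows "theory_morphism V (theory_of K F) (theory_of L G) (fop K N) \<longleftrightarrow>
    vfunctor V (vop V K) (vop V L) (fop K N) \<and> fop (vself V) (vfunctor_comp V (vself V) N F) = fop (vself V) G"
proof -
  have "vfunctor V (vself V) K F" using F by (simp add: cotheory_def)
  then show ?thesis by (simp add: theory_morphism_def theory_of_def fop_vfunctor_comp)
qed

lemma category_Th: "category (Th V)"
proof
  have fn: "vfunctor V (vop V (vself V)) (Theory_cat T) (Theory_fun T)" if "vtheory V T" for T
    using that by (simp add: vtheory_def)
  have morph: "vtheory V T" "vtheory V U" "vfunctor V (Theory_cat T) (Theory_cat U) M"
    "vfunctor_comp V (vop V (vself V)) M (Theory_fun T) = Theory_fun U"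
    if "(T, M, U) \<in> Arr (Th V)" for T M U
    using that by (auto simp: Th_def theory_morphism_def)
  have ex: "\<exists>M. f = (T, M, U) \<and> (T, M, U) \<in> Arr (Th V)" if "f \<in> Hom (Th V) T U" for f T U
    using that by (auto simp: Th_def in_Hom)
  show "Dom (Th V) f \<in> Obj (Th V)" "Cod (Th V) f \<in> Obj (Th V)" if "f \<in> Arr (Th V)" for f
    using that by (auto simp: Th_def)
  show "Id (Th V) T \<in> Hom (Th V) T T" if "T \<in> Obj (Th V)" for T
    using that fn[of T] vfunctor_simps(2)[OF fn[of T]]
    by (simp add: Th_def in_Hom theory_morphism_def vfunctor_vfunctor_id vfunctor_id_comp)
  show "Comp (Th V) g f \<in> Hom (Th V) T W"
    if hom: "f \<in> Hom (Th V) T U" "g \<in> Hom (Th V) U W" for f g T U W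
  proof -
    obtain M N where f: "f = (T, M, U)" "(T, M, U) \<in> Arr (Th V)" and g: "g = (U, N, W)" "(U, N, W) \<in> Arr (Th V)"
      using ex[OF hom(1)] ex[OF hom(2)] by blast
    note a = morph[OF f(2)] and b = morph[OF g(2)]
    show ?thesis
      using a b by (simp add: f(1) g(1) Th_def in_Hom theory_morphism_def
          vfunctor_vfunctor_comp[OF a(3) b(3)] vfunctor_comp_assoc[OF fn[OF a(1)] a(3) b(3)])
  qed
  show "Comp (Th V) f (Id (Th V) T) = f" "Comp (Th V) (Id (Th V) U) f = f"
    if hom: "f \<in> Hom (Th V) T U" for f T U
  proof -
    obtain M where f: "f = (T, M, U)" "(T, M, U) \<in> Arr (Th V)" using ex[OF hom] by blast
    show "Comp (Th V) f (Id (Th V) T) = f" "Comp (Th V) (Id (Th V) U) f = f"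
      by (simp_all add: f(1) Th_def vfunctor_id_comp[OF morph(3)[OF f(2)]])
  qed
  show "Comp (Th V) (Comp (Th V) h g) f = Comp (Th V) h (Comp (Th V) g f)"
    if hom: "f \<in> Hom (Th V) T U" "g \<in> Hom (Th V) U W" "h \<in> Hom (Th V) W X" for f g h T U W X
  proof -
    obtain M N P where f: "f = (T, M, U)" "(T, M, U) \<in> Arr (Th V)" and g: "g = (U, N, W)" "(U, N, W) \<in> Arr (Th V)"
      and h: "h = (W, P, X)" "(W, P, X) \<in> Arr (Th V)"
      using ex[OF hom(1)] ex[OF hom(2)] ex[OF hom(3)] by blast
    show ?thesis
      by (simp add: f(1) g(1) h(1) Th_def
          vfunctor_comp_assoc[OF morph(3)[OF f(2)] morph(3)[OF g(2)] morph(3)[OF h(2)]])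
  qed
qed

end


section \<open>The theory of a monad\<close>

context smcc
begin

text \<open>
  Postcomposition with \<open>n\<close> on the hom-object \<open>C(A,B)\<close>. The hom-arrows of the free functor and of
  the functors induced by monad morphisms have this form.
\<close>

definition post :: "('c, 'o, 'm) vcategory \<Rightarrow> 'c \<Rightarrow> 'c \<Rightarrow> 'c \<Rightarrow> 'm \<Rightarrow> 'm" where
  "post C A B D n = VComp C A B D \<cdot> (n \<boxtimes> Id V (VHom C A B)) \<cdot> Inv V (LUnit V (VHom C A B))"

lemma post_simps [simp]:
  assumes "vcategory V C" "mor C (pt B D n)" "A \<in> VOb C"
  shows "post C A B D n \<in> Arr V" "Dom V (post C A B D n) = VHom C A B" "Cod V (post C A B D n) = VHom C A D"
  using assms by (simp_all add: post_def mor_pt in_Hom)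

lemma act_post:
  assumes "vcategory V C" "mor C (pt B D n)" "mor C f" "Src f = A" "Tgt f = B"
  shows "act (post C A B D n) (Body f) = Body (pt B D n \<odot>\<^bsub>C\<^esub> f)"
  using assms by (auto simp add: post_def mor_pt in_Hom gcomp_def Body_pt)

end

locale smcc_monad = smcc V for V :: "('o, 'm) smc_category" (structure) +
  fixes M :: "('o, 'm) vmonad"
  assumes monad: "vmonad V (vself V) M"
begin

abbreviation S where "S A \<equiv> VMap_ob (Endo M) A"
abbreviation E where "E f \<equiv> gmap (Endo M) f"
abbreviation \<eta> where "\<eta> A \<equiv> eta_at M A"
abbreviation \<mu> where "\<mu> A \<equiv> mu_at M A"

lemmas endo = vmonadD(1)[OF monad]

lemma S_Obj [simp]: "A \<in> Obj V \<Longrightarrow> S A \<in> Obj V"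
  using vfunctor_simps(3)[OF endo] by simp

lemma mor_eta_mu [simp]:
  "A \<in> Obj V \<Longrightarrow> mor (vself V) (\<eta> A)" "A \<in> Obj V \<Longrightarrow> mor (vself V) (\<mu> A)"
  using vmonadD(2,3)[OF monad] by simp_all

lemmas [simp] = mor_gmap[OF endo] gmap_gcomp[OF endo]

lemma E_gid [simp]: "A \<in> Obj V \<Longrightarrow> E (gid (vself V) A) = gid (vself V) (S A)"
  using gmap_gid[OF endo] by simp

lemma eta_nat: "mor (vself V) f \<Longrightarrow> \<eta> (Tgt f) \<bullet> f = E f \<bullet> \<eta> (Src f)"
  using vmonadD(4)[OF monad] by simp

lemma mu_nat: "mor (vself V) f \<Longrightarrow> \<mu> (Tgt f) \<bullet> E (E f) = E f \<bullet> \<mu> (Src f)"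
  using vmonadD(5)[OF monad] by simp

lemma mu_nat_prefix:
  "mor (vself V) f \<Longrightarrow> mor (vself V) k \<Longrightarrow> Tgt k = S (S (Src f)) \<Longrightarrow>
    \<mu> (Tgt f) \<bullet> E (E f) \<bullet> k = E f \<bullet> \<mu> (Src f) \<bullet> k"
  using gcomp_prefix[OF mu_nat[of f], of k] by simp

lemma mu_E_eta [simp]: "A \<in> Obj V \<Longrightarrow> \<mu> A \<bullet> E (\<eta> A) = gid (vself V) (S A)"
  and mu_eta [simp]: "A \<in> Obj V \<Longrightarrow> \<mu> A \<bullet> \<eta> (S A) = gid (vself V) (S A)"
  using vmonadD(6,7)[OF monad] by simp_all

lemma mu_unit_prefix [simp]:
  assumes "A \<in> Obj V" "mor (vself V) k" "Tgt k = S A"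
  shows "\<mu> A \<bullet> E (\<eta> A) \<bullet> k = k" "\<mu> A \<bullet> \<eta> (S A) \<bullet> k = k"
  using assms by (simp_all add: gcomp_prefix[OF mu_E_eta] gcomp_prefix[OF mu_eta])

lemma mu_assoc_prefix [simp]:
  assumes "A \<in> Obj V" "mor (vself V) k" "Tgt k = S (S (S A))"
  shows "\<mu> A \<bullet> E (\<mu> A) \<bullet> k = \<mu> A \<bullet> \<mu> (S A) \<bullet> k"
proof -
  have "\<mu> A \<bullet> E (\<mu> A) = \<mu> A \<bullet> \<mu> (S A)" using vmonadD(8)[OF monad] assms(1) by simp
  from gcomp_prefix[OF this, of k] show ?thesis using assms by simp
qed

text \<open>
  The Kleisli \<open>V\<close>-category. The left factor of the composition sends \<open>g\<close> to \<open>\<mu> \<circ> S g\<close>.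
\<close>

definition kcat :: "('o, 'o, 'm) vcategory" where
  "kcat = \<lparr>VOb = Obj V, VHom = (\<lambda>A\<in>Obj V. \<lambda>B\<in>Obj V. IHom V A (S B)),
     VComp = (\<lambda>A\<in>Obj V. \<lambda>B\<in>Obj V. \<lambda>D\<in>Obj V. VComp (vself V) A (S B) (S D) \<cdot>
       ((post (vself V) (S B) (S (S D)) (S D) (Mu M D) \<cdot> VMap_hom (Endo M) B (S D))
         \<boxtimes> Id V (IHom V A (S B)))),
     VId = Eta M\<rparr>"

lemma kcat_simps [simp]:
  "VOb kcat = Obj V" "VId kcat = Eta M"
  "A \<in> Obj V \<Longrightarrow> B \<in> Obj V \<Longrightarrow> VHom kcat A B = IHom V A (S B)"
  by (simp_all add: kcat_def)

text \<open>
  A Kleisli morphism \<open>A \<rightarrow> D\<close> and the morphism \<open>A \<rightarrow> S D\<close> of the base that it stands for have the same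
  underlying element and differ only in the recorded target.
\<close>

definition und :: "('o, 'o, 'm) gmor \<Rightarrow> ('o, 'o, 'm) gmor" where
  "und f = gmk (Src f) (S (Tgt f)) (Body f)"

lemma und_simps [simp]: "Src (und f) = Src f" "Tgt (und f) = S (Tgt f)" "Body (und f) = Body f"
  by (simp_all add: und_def)

lemma kcat_mor [simp]:
  assumes "mor kcat f"
  shows "Src f \<in> Obj V" "Tgt f \<in> Obj V" "mor (vself V) (und f)"
proof -
  show [simp]: "Src f \<in> Obj V" "Tgt f \<in> Obj V" using mor_simps(1,2)[OF assms] by simp_all
  have "el (IHom V (Src f) (S (Tgt f))) (Body f)" using mor_simps(3)[OF assms] by simp
  then show "mor (vself V) (und f)" by (simp add: und_def)
qed

lemma und_eqI: "und f = und g \<Longrightarrow> Tgt f = Tgt g \<Longrightarrow> f = g"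
  by (intro gmor_eqI) (auto simp: und_def gmk_def)

lemma und_gmk [simp]: "Src h = A \<Longrightarrow> Tgt h = S D \<Longrightarrow> und (gmk A D (Body h)) = h"
  by (simp add: und_def)

lemma mor_Mu: "A \<in> Obj V \<Longrightarrow> mor (vself V) (pt (S (S A)) (S A) (Mu M A))"
  using mor_eta_mu(2) by (simp add: mu_at_def)

lemma mor_Eta: "A \<in> Obj V \<Longrightarrow> mor (vself V) (pt A (S A) (Eta M A))"
  using mor_eta_mu(1) by (simp add: eta_at_def)

lemma kcat_VComp_eq:
  "A \<in> Obj V \<Longrightarrow> B \<in> Obj V \<Longrightarrow> D \<in> Obj V \<Longrightarrow> VComp kcat A B D = VComp (vself V) A (S B) (S D) \<cdot>
       ((post (vself V) (S B) (S (S D)) (S D) (Mu M D) \<cdot> VMap_hom (Endo M) B (S D)) \<boxtimes> Id V (IHom V A (S B)))"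
  by (simp add: kcat_def)

lemma kcat_VComp:
  assumes "A \<in> Obj V" "B \<in> Obj V" "D \<in> Obj V"
  shows "VComp kcat A B D \<in> Hom V (IHom V B (S D) \<otimes> IHom V A (S B)) (IHom V A (S D))"
  using assms mor_Mu[of D] by (simp add: kcat_VComp_eq in_Hom vfunctor_simps[OF endo])

lemma kcat_gcomp:
  assumes "mor kcat f" "mor kcat g" "Src g = Tgt f"
  shows "g \<odot>\<^bsub>kcat\<^esub> f = gmk (Src f) (Tgt g) (Body (\<mu> (Tgt g) \<bullet> E (und g) \<bullet> und f))"
proof (rule gmor_eqI)
  note [simp] = vfunctor_simps[OF endo] assms kcat_mor[OF assms(1)] kcat_mor[OF assms(2)]
  let ?A = "Src f" and ?B = "Tgt f" and ?D = "Tgt g"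
  have [simp]: "el (IHom V ?A (S ?B)) (Body f)" "el (IHom V ?B (S ?D)) (Body g)"
    using mor_simps(3)[OF assms(1)] mor_simps(3)[OF assms(2)] by simp_all
  have m [simp]: "mor (vself V) (pt (S (S ?D)) (S ?D) (Mu M ?D))" by (rule mor_Mu) simp
  have "act (post (vself V) (S ?B) (S (S ?D)) (S ?D) (Mu M ?D)) (Body (E (und g))) = Body (\<mu> ?D \<bullet> E (und g))"
    by (simp add: act_post mu_at_def)
  moreover have "Body (E (und g)) = act (VMap_hom (Endo M) ?B (S ?D)) (Body g)"
    by (simp add: gmap_def)
  ultimately have "act (post (vself V) (S ?B) (S (S ?D)) (S ?D) (Mu M ?D))
      (act (VMap_hom (Endo M) ?B (S ?D)) (Body g)) = Body (\<mu> ?D \<bullet> E (und g))" by simp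
  then have "Body (g \<odot>\<^bsub>kcat\<^esub> f) = Body ((\<mu> ?D \<bullet> E (und g)) \<bullet> und f)"
    by (simp add: gcomp_def[of _ kcat] gcomp_def[of _ _ "und f"] kcat_VComp_eq)
  then show "Body (g \<odot>\<^bsub>kcat\<^esub> f) = Body (gmk ?A ?D (Body (\<mu> ?D \<bullet> E (und g) \<bullet> und f)))"
    by simp
qed simp_all

lemma und_gcomp [simp]:
  "mor kcat f \<Longrightarrow> mor kcat g \<Longrightarrow> Src g = Tgt f \<Longrightarrow> und (g \<odot>\<^bsub>kcat\<^esub> f) = \<mu> (Tgt g) \<bullet> E (und g) \<bullet> und f"
  by (simp add: kcat_gcomp)

lemma kcat_gid: "gid kcat A = gmk A A (Body (\<eta> A))"
  by (intro gmor_eqI) (simp_all add: gid_def eta_at_def pt_def)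

lemma und_gid [simp]: "und (gid kcat A) = \<eta> A"
  by (simp add: kcat_gid)

lemma vcategory_kcat [simp]: "vcategory V kcat"
proof (rule vcategoryI)
  show "VHom kcat \<in> VOb kcat \<rightarrow>\<^sub>E VOb kcat \<rightarrow>\<^sub>E Obj V"
    by (auto simp: kcat_def)
  show "VComp kcat \<in> (\<Pi>\<^sub>E A\<in>VOb kcat. \<Pi>\<^sub>E B\<in>VOb kcat. \<Pi>\<^sub>E D\<in>VOb kcat.
      Hom V (VHom kcat B D \<otimes> VHom kcat A B) (VHom kcat A D))"
    using kcat_VComp by (auto simp: kcat_def)
  show "VId kcat \<in> (\<Pi>\<^sub>E A\<in>VOb kcat. Hom V (Unit V) (VHom kcat A A))"
    using mor_Eta monad by (auto simp: PiE_iff mor_pt vmonad_iff)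
  have mor [simp]: "mor kcat (g \<odot>\<^bsub>kcat\<^esub> f)" if "mor kcat f" "mor kcat g" "Src g = Tgt f" for f g
    using that by (simp add: kcat_gcomp)
  show "(h \<odot>\<^bsub>kcat\<^esub> g) \<odot>\<^bsub>kcat\<^esub> f = h \<odot>\<^bsub>kcat\<^esub> (g \<odot>\<^bsub>kcat\<^esub> f)"
    if [simp]: "mor kcat f" "mor kcat g" "mor kcat h" "Src g = Tgt f" "Src h = Tgt g" for f g h
    by (rule und_eqI) (use mu_nat_prefix[of "und h" "E (und g) \<bullet> und f"] in simp_all)
  have [simp]: "mor kcat (gid kcat A)" if "A \<in> Obj V" for A
    using that by (simp add: kcat_gid)
  show "gid kcat (Tgt f) \<odot>\<^bsub>kcat\<^esub> f = f" if [simp]: "mor kcat f" for f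
    by (rule und_eqI) simp_all
  show "f \<odot>\<^bsub>kcat\<^esub> gid kcat (Src f) = f" if [simp]: "mor kcat f" for f
    by (rule und_eqI) (simp_all flip: eta_nat[of "und f", simplified])
qed

text \<open>
  The free functor, \<open>f \<mapsto> \<eta> \<circ> f\<close>.
\<close>

definition kfun :: "('o, 'o, 'm) vfunctor" where
  "kfun = \<lparr>VMap_ob = (\<lambda>A\<in>Obj V. A),
     VMap_hom = (\<lambda>A\<in>Obj V. \<lambda>B\<in>Obj V. post (vself V) A B (S B) (Eta M B))\<rparr>"

lemma kfun_ob [simp]: "A \<in> Obj V \<Longrightarrow> VMap_ob kfun A = A"
  by (simp add: kfun_def)

lemma gmap_kfun: "mor (vself V) f \<Longrightarrow> gmap kfun f = gmk (Src f) (Tgt f) (Body (\<eta> (Tgt f) \<bullet> f))"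
  using mor_Eta[of "Tgt f"] by (intro gmor_eqI) (simp_all add: gmap_def kfun_def act_post eta_at_def)

lemma und_gmap_kfun [simp]: "mor (vself V) f \<Longrightarrow> und (gmap kfun f) = \<eta> (Tgt f) \<bullet> f"
  by (simp add: gmap_kfun)

lemma vfunctor_kfun: "vfunctor V (vself V) kcat kfun"
proof (rule vfunctorI)
  show "VMap_ob kfun \<in> VOb (vself V) \<rightarrow>\<^sub>E VOb kcat" by (simp add: kfun_def)
  show "VMap_hom kfun \<in> (\<Pi>\<^sub>E A\<in>VOb (vself V). \<Pi>\<^sub>E B\<in>VOb (vself V).
      Hom V (VHom (vself V) A B) (VHom kcat (VMap_ob kfun A) (VMap_ob kfun B)))"
    using mor_Eta by (simp add: kfun_def in_Hom)
  have [simp]: "mor kcat (gmap kfun f)" if "mor (vself V) f" for f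
    using that by (simp add: gmap_kfun)
  show "gmap kfun (g \<bullet> f) = gmap kfun g \<odot>\<^bsub>kcat\<^esub> gmap kfun f"
    if [simp]: "mor (vself V) f" "mor (vself V) g" "Src g = Tgt f" for f g
  proof (rule und_eqI)
    have "\<eta> (Tgt g) \<bullet> g \<bullet> f = (E g \<bullet> \<eta> (Tgt f)) \<bullet> f"
      using gcomp_prefix[OF eta_nat[of g], of f] by simp
    then show "und (gmap kfun (g \<bullet> f)) = und (gmap kfun g \<odot>\<^bsub>kcat\<^esub> gmap kfun f)"
      by simp
  qed simp
  show "gmap kfun (gid (vself V) A) = gid kcat (VMap_ob kfun A)" if "A \<in> VOb (vself V)" for A
    by (rule und_eqI) (use that in simp_all)
qed simp_all

lemma und_gcomp_gmap_kfun:
  assumes [simp]: "mor kcat f" "mor (vself V) v" "Tgt v = Src f"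
  shows "und (f \<odot>\<^bsub>kcat\<^esub> gmap kfun v) = und f \<bullet> v"
proof -
  have "und (f \<odot>\<^bsub>kcat\<^esub> gmap kfun v) = \<mu> (Tgt f) \<bullet> (E (und f) \<bullet> \<eta> (Src f)) \<bullet> v"
    using mor_gmap[OF vfunctor_kfun, of v] by simp
  also have "\<dots> = und f \<bullet> v"
    by (simp flip: eta_nat[of "und f", simplified])
  finally show ?thesis .
qed

text \<open>
  Composition in the Kleisli category with a morphism coming from \<open>V\<close> is composition in \<open>V\<close>, so
  the universal property of a tensor at \<open>D\<close> is the one in \<open>V\<close> at \<open>S D\<close>.
\<close>

lemma cotheory_kleisli: "cotheory kcat kfun"
  unfolding cotheory_def
proof (intro conjI allI impI ballI)
  fix W X P \<gamma> assume t: "is_tensor (vself V) W X P \<gamma>"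
  then have [simp]: "W \<in> Obj V" "X \<in> Obj V" "P \<in> Obj V" and "\<gamma> \<in> Hom V W (VHom (vself V) X P)"
    unfolding is_tensor_def vself_simps(1) by blast+
  then have \<gamma> [simp]: "\<gamma> \<in> Hom V W (IHom V X P)" by simp
  note [simp] = vfunctor_simps[OF vfunctor_kfun] mor_gmap[OF vfunctor_kfun]
  have \<gamma>a [simp]: "\<gamma> \<in> Arr V" "Dom V \<gamma> = W" "Cod V \<gamma> = IHom V X P" using \<gamma> by (simp_all add: in_Hom)
  let ?\<delta> = "VMap_hom kfun X P \<cdot> \<gamma>"
  have \<delta> [simp]: "?\<delta> \<in> Hom V W (IHom V X (S P))" by (simp add: in_Hom)
  have "tensor_cmp kcat W X P ?\<delta> D = tensor_cmp (vself V) W X P \<gamma> (S D)" if [simp]: "D \<in> Obj V" for D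
  proof (rule hom_arrow_eqI[of _ kcat P D "IHom V W (IHom V X (S D))"])
    fix f assume f [simp]: "mor kcat f" "Src f = P" "Tgt f = D"
    have "gmk W (IHom V X (S D)) (act (tensor_cmp kcat W X P ?\<delta> D) (Body f))
        = gmk W (IHom V X (S D)) (act (tensor_cmp (vself V) W X P \<gamma> (S D)) (Body (und f)))"
    proof (rule mor_eqI)
      fix w assume "el (Src (gmk W (IHom V X (S D)) (act (tensor_cmp (vself V) W X P \<gamma> (S D)) (Body (und f))))) w"
      then have w [simp]: "el W w" by simp
      let ?v = "gmk X P (act \<gamma> w)"
      have v [simp]: "mor (vself V) ?v" by simp
      have F: "gmk X P (act ?\<delta> w) = gmap kfun ?v"
        by (intro gmor_eqI) (simp_all add: gmap_def)
      have "app (gmk W (IHom V X (S D)) (act (tensor_cmp kcat W X P ?\<delta> D) (Body f))) w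
          = Body (f \<odot>\<^bsub>kcat\<^esub> gmk X P (act ?\<delta> w))"
        using app_tensor_cmp[of kcat W X P f D ?\<delta> w] by (simp del: act_Comp)
      also have "\<dots> = Body (und (f \<odot>\<^bsub>kcat\<^esub> gmap kfun ?v))"
        unfolding F und_simps ..
      also have "\<dots> = Body (und f \<bullet> ?v)"
        by (subst und_gcomp_gmap_kfun) simp_all
      also have "\<dots> = app (gmk W (IHom V X (S D)) (act (tensor_cmp (vself V) W X P \<gamma> (S D)) (Body (und f)))) w"
        using app_tensor_cmp[of "vself V" W X P "und f" "S D" \<gamma> w] by simp
      finally show "app (gmk W (IHom V X (S D)) (act (tensor_cmp kcat W X P ?\<delta> D) (Body f))) w
          = app (gmk W (IHom V X (S D)) (act (tensor_cmp (vself V) W X P \<gamma> (S D)) (Body (und f)))) w" .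
    qed (use mor_simps(3)[OF f(1)] in \<open>simp_all\<close>)
    then show "act (tensor_cmp kcat W X P ?\<delta> D) (Body f) = act (tensor_cmp (vself V) W X P \<gamma> (S D)) (Body f)"
      by (simp add: gmk_def)
  qed (simp_all add: in_Hom)
  then show "is_tensor kcat W X P ?\<delta>"
    using t \<delta> by (simp add: is_tensor_def)
qed (simp_all add: vfunctor_kfun)

definition kleisli :: "('o, 'm) vtheory" where
  "kleisli = theory_of kcat kfun"

lemma vtheory_kleisli: "vtheory V kleisli"
  unfolding kleisli_def by (rule vtheory_theory_of[OF cotheory_kleisli])

end


section \<open>Monad morphisms and morphisms of theories\<close>

locale smcc_monads = smcc V + M: smcc_monad V M + N: smcc_monad V N
  for V :: "('o, 'm) smc_category" (structure) and M N
begin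

text \<open>
  The functor \<open>f \<mapsto> \<alpha> \<circ> f\<close> between Kleisli \<open>V\<close>-categories.
\<close>

definition kmap :: "('o \<Rightarrow> 'm) \<Rightarrow> ('o, 'o, 'm) vfunctor" where
  "kmap \<alpha> = \<lparr>VMap_ob = (\<lambda>A\<in>Obj V. A),
     VMap_hom = (\<lambda>A\<in>Obj V. \<lambda>D\<in>Obj V. post (vself V) A (M.S D) (N.S D) (\<alpha> D))\<rparr>"

lemma kmap_ob [simp]: "A \<in> Obj V \<Longrightarrow> VMap_ob (kmap \<alpha>) A = A"
  by (simp add: kmap_def)

abbreviation at where "at \<alpha> D \<equiv> cpt (Endo M) (Endo N) \<alpha> D"

lemma gmap_kmap:
  assumes \<alpha>: "vnat V (vself V) (vself V) (Endo M) (Endo N) \<alpha>" and f [simp]: "mor M.kcat f"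
  shows "gmap (kmap \<alpha>) f = gmk (Src f) (Tgt f) (Body (at \<alpha> (Tgt f) \<bullet> M.und f))"
proof (rule gmor_eqI)
  have "mor (vself V) (pt (M.S (Tgt f)) (N.S (Tgt f)) (\<alpha> (Tgt f)))"
    using mor_cpt[OF \<alpha>, of "Tgt f"] by (simp add: cpt_def)
  then show "Body (gmap (kmap \<alpha>) f) = Body (gmk (Src f) (Tgt f) (Body (at \<alpha> (Tgt f) \<bullet> M.und f)))"
    using act_post[of "vself V" "M.S (Tgt f)" "N.S (Tgt f)" "\<alpha> (Tgt f)" "M.und f" "Src f"]
    by (simp add: gmap_def kmap_def cpt_def)
qed simp_all

lemma und_gmap_kmap:
  assumes \<alpha>: "vnat V (vself V) (vself V) (Endo M) (Endo N) \<alpha>" and f: "mor M.kcat f"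
  shows "N.und (gmap (kmap \<alpha>) f) = at \<alpha> (Tgt f) \<bullet> M.und f" "mor N.kcat (gmap (kmap \<alpha>) f)"
  using f mor_cpt[OF \<alpha>, of "Tgt f"] by (simp_all add: gmap_kmap[OF \<alpha> f])

lemma vfunctor_kmap:
  assumes "monad_morphism V (vself V) M N \<alpha>"
  shows "vfunctor V M.kcat N.kcat (kmap \<alpha>)"
    and "vfunctor_comp V (vself V) (kmap \<alpha>) M.kfun = N.kfun"
proof -
  have \<alpha>: "vnat V (vself V) (vself V) (Endo M) (Endo N) \<alpha>"
    and unit: "\<And>A. A \<in> Obj V \<Longrightarrow> at \<alpha> A \<bullet> M.\<eta> A = N.\<eta> A"
    and mult: "\<And>A. A \<in> Obj V \<Longrightarrow> at \<alpha> A \<bullet> M.\<mu> A = N.\<mu> A \<bullet> (N.E (at \<alpha> A) \<bullet> at \<alpha> (M.S A))"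
    using assms by (simp_all add: monad_morphism_iff[OF M.monad N.monad])
  have mor_a [simp]: "mor (vself V) (at \<alpha> A)" if "A \<in> Obj V" for A
    using mor_cpt[OF \<alpha>] that by simp
  note [simp] = und_gmap_kmap[OF \<alpha>]
  show H: "vfunctor V M.kcat N.kcat (kmap \<alpha>)"
  proof (rule vfunctorI)
    show "VMap_ob (kmap \<alpha>) \<in> VOb M.kcat \<rightarrow>\<^sub>E VOb N.kcat" by (simp add: kmap_def)
    show "VMap_hom (kmap \<alpha>) \<in> (\<Pi>\<^sub>E A\<in>VOb M.kcat. \<Pi>\<^sub>E B\<in>VOb M.kcat.
        Hom V (VHom M.kcat A B) (VHom N.kcat (VMap_ob (kmap \<alpha>) A) (VMap_ob (kmap \<alpha>) B)))"
      using mor_a by (simp add: kmap_def in_Hom cpt_def)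
    show "gmap (kmap \<alpha>) (g \<odot>\<^bsub>M.kcat\<^esub> f) = gmap (kmap \<alpha>) g \<odot>\<^bsub>N.kcat\<^esub> gmap (kmap \<alpha>) f"
      if [simp]: "mor M.kcat f" "mor M.kcat g" "Src g = Tgt f" for f g
    proof (rule N.und_eqI)
      let ?g = "M.und g" and ?f = "M.und f" and ?D = "Tgt g"
      have "at \<alpha> ?D \<bullet> M.\<mu> ?D \<bullet> M.E ?g \<bullet> ?f
          = (N.\<mu> ?D \<bullet> (N.E (at \<alpha> ?D) \<bullet> at \<alpha> (M.S ?D))) \<bullet> M.E ?g \<bullet> ?f"
        using gcomp_prefix[OF mult[of ?D], of "M.E ?g \<bullet> ?f"] by simp
      also have "\<dots> = N.\<mu> ?D \<bullet> N.E (at \<alpha> ?D) \<bullet> (at \<alpha> (M.S ?D) \<bullet> M.E ?g) \<bullet> ?f"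
        by simp
      also have "at \<alpha> (M.S ?D) \<bullet> M.E ?g = N.E ?g \<bullet> at \<alpha> (Tgt f)"
        using cpt_natural[OF \<alpha>, of ?g] by simp
      finally show "N.und (gmap (kmap \<alpha>) (g \<odot>\<^bsub>M.kcat\<^esub> f))
          = N.und (gmap (kmap \<alpha>) g \<odot>\<^bsub>N.kcat\<^esub> gmap (kmap \<alpha>) f)"
        by simp
    qed simp
    show "gmap (kmap \<alpha>) (gid M.kcat A) = gid N.kcat (VMap_ob (kmap \<alpha>) A)" if "A \<in> VOb M.kcat" for A
      by (rule N.und_eqI) (use that in \<open>simp_all add: unit\<close>)
  qed simp_all
  show "vfunctor_comp V (vself V) (kmap \<alpha>) M.kfun = N.kfun"
  proof (rule vfunctor_eqI[OF vfunctor_vfunctor_comp[OF M.vfunctor_kfun H] N.vfunctor_kfun])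
    fix f :: "('o, 'o, 'm) gmor" assume [simp]: "mor (vself V) f"
    note [simp] = mor_gmap[OF M.vfunctor_kfun]
    have "at \<alpha> (Tgt f) \<bullet> M.\<eta> (Tgt f) \<bullet> f = N.\<eta> (Tgt f) \<bullet> f"
      using gcomp_prefix[OF unit[of "Tgt f"], of f] by simp
    then have "gmap (kmap \<alpha>) (gmap M.kfun f) = gmap N.kfun f"
      by (intro N.und_eqI[of "gmap (kmap \<alpha>) (gmap M.kfun f)" "gmap N.kfun f"]) simp_all
    then show "gmap (vfunctor_comp V (vself V) (kmap \<alpha>) M.kfun) f = gmap N.kfun f"
      by (simp add: gmap_vfunctor_comp[OF M.vfunctor_kfun H])
  qed simp
qed

text \<open>
  The identity of \<open>S D\<close>, read as a Kleisli morphism from \<open>S D\<close> to \<open>D\<close>: the counit of the Kleisli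
  adjunction. Every Kleisli morphism into \<open>D\<close> is its composite with a morphism coming from \<open>V\<close>.
\<close>

definition cou :: "'o \<Rightarrow> ('o, 'o, 'm) gmor" where
  "cou D = gmk (M.S D) D (Body (gid (vself V) (M.S D)))"

lemma cou_simps [simp]:
  "Src (cou D) = M.S D" "Tgt (cou D) = D" "M.und (cou D) = gid (vself V) (M.S D)"
  "D \<in> Obj V \<Longrightarrow> mor M.kcat (cou D)"
  by (simp_all add: cou_def)

lemma kmap_inject:
  assumes \<alpha>: "vnat V (vself V) (vself V) (Endo M) (Endo N) \<alpha>"
    and \<beta>: "vnat V (vself V) (vself V) (Endo M) (Endo N) \<beta>" and "kmap \<alpha> = kmap \<beta>"
  shows "\<alpha> = \<beta>"
proof (rule family_eqI[OF vnat_extensional[OF \<alpha>] vnat_extensional[OF \<beta>]])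
  fix D assume "D \<in> VOb (vself V)"
  then have [simp]: "D \<in> Obj V" by simp
  have "at \<alpha> D = N.und (gmap (kmap \<alpha>) (cou D))" "at \<beta> D = N.und (gmap (kmap \<beta>) (cou D))"
    using und_gmap_kmap(1)[OF \<alpha>, of "cou D"] und_gmap_kmap(1)[OF \<beta>, of "cou D"]
      mor_cpt[OF \<alpha>, of D] mor_cpt[OF \<beta>, of D] by simp_all
  then show "at \<alpha> D = at \<beta> D" using assms(3) by simp
qed

text \<open>
  The transformation that induces \<open>P\<close> has as component at \<open>D\<close> the image under \<open>P\<close> of the counit at
  \<open>D\<close>, and all its properties express the fact that \<open>P\<close> preserves composites of counits and
  morphisms coming from \<open>V\<close>.
\<close>

lemma kmap_surj:
  assumes P: "vfunctor V M.kcat N.kcat P" and PF: "vfunctor_comp V (vself V) P M.kfun = N.kfun"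
  shows "\<exists>\<alpha>. monad_morphism V (vself V) M N \<alpha> \<and> kmap \<alpha> = P"
proof -
  note MF = M.vfunctor_kfun and NF = N.vfunctor_kfun
  note [simp] = mor_gmap[OF MF] mor_gmap[OF NF] mor_gmap[OF P]
  have ob [simp]: "VMap_ob P A = A" if "A \<in> Obj V" for A
    using arg_cong[OF PF, of "\<lambda>F. VMap_ob F A"] that by simp
  have PF_map [simp]: "gmap P (gmap M.kfun v) = gmap N.kfun v" if "mor (vself V) v" for v
    using gmap_vfunctor_comp[OF MF P, of v] that PF by simp
  note [simp] = gmap_gcomp[OF P] gmap_gid[OF P]
  define \<alpha> where "\<alpha> = (\<lambda>D\<in>Obj V. VMap_hom P (M.S D) D \<cdot> VId (vself V) (M.S D))"
  have at: "at \<alpha> D = N.und (gmap P (cou D))" if "D \<in> Obj V" for D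
    using that by (intro gmor_eqI) (simp_all add: cpt_def \<alpha>_def gmap_def cou_def gid_def pt_def act_def)
  have at_mor [simp]: "mor (vself V) (at \<alpha> D)" if "D \<in> Obj V" for D
    using that by (simp add: at)
  have und_P: "N.und (gmap P f) = at \<alpha> (Tgt f) \<bullet> M.und f" if f [simp]: "mor M.kcat f" for f
  proof -
    have "f = cou (Tgt f) \<odot>\<^bsub>M.kcat\<^esub> gmap M.kfun (M.und f)"
      by (rule M.und_eqI) (simp_all add: M.und_gcomp_gmap_kfun)
    then have "gmap P f = gmap P (cou (Tgt f) \<odot>\<^bsub>M.kcat\<^esub> gmap M.kfun (M.und f))"
      by simp
    also have "\<dots> = gmap P (cou (Tgt f)) \<odot>\<^bsub>N.kcat\<^esub> gmap N.kfun (M.und f)"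
      by simp
    finally have "N.und (gmap P f) = N.und (gmap P (cou (Tgt f)) \<odot>\<^bsub>N.kcat\<^esub> gmap N.kfun (M.und f))"
      by simp
    also have "\<dots> = N.und (gmap P (cou (Tgt f))) \<bullet> M.und f"
      by (rule N.und_gcomp_gmap_kfun) simp_all
    finally show ?thesis by (simp add: at)
  qed
  have \<alpha>: "vnat V (vself V) (vself V) (Endo M) (Endo N) \<alpha>"
  proof (rule vnatI)
    fix f :: "('o, 'o, 'm) gmor" assume f [simp]: "mor (vself V) f"
    let ?h = "gmk (M.S (Src f)) (Tgt f) (Body (M.E f))"
    have h [simp]: "mor M.kcat ?h" "M.und ?h = M.E f" by simp_all
    have "?h = gmap M.kfun f \<odot>\<^bsub>M.kcat\<^esub> cou (Src f)"
      by (rule M.und_eqI) simp_all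
    then have "gmap P ?h = gmap N.kfun f \<odot>\<^bsub>N.kcat\<^esub> gmap P (cou (Src f))"
      by simp
    then have "N.und (gmap P ?h) = N.E f \<bullet> at \<alpha> (Src f)"
      by (simp add: at)
    then show "at \<alpha> (Tgt f) \<bullet> M.E f = N.E f \<bullet> at \<alpha> (Src f)"
      by (simp add: und_P[OF h(1)])
  qed (simp_all add: M.endo N.endo, simp add: \<alpha>_def)
  have "at \<alpha> A \<bullet> M.\<eta> A = N.\<eta> A" if [simp]: "A \<in> Obj V" for A
    using und_P[of "gid M.kcat A"] by simp
  moreover have "at \<alpha> A \<bullet> M.\<mu> A = N.\<mu> A \<bullet> (N.E (at \<alpha> A) \<bullet> at \<alpha> (M.S A))" if [simp]: "A \<in> Obj V" for A
    using und_P[of "cou A \<odot>\<^bsub>M.kcat\<^esub> cou (M.S A)"] by (simp add: at)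
  ultimately have mm: "monad_morphism V (vself V) M N \<alpha>"
    using \<alpha> by (simp add: monad_morphism_iff[OF M.monad N.monad])
  have "kmap \<alpha> = P"
  proof (rule vfunctor_eqI[OF vfunctor_kmap(1)[OF mm] P])
    fix f assume [simp]: "mor M.kcat f"
    show "gmap (kmap \<alpha>) f = gmap P f"
      by (rule N.und_eqI) (simp_all add: und_P und_gmap_kmap[OF \<alpha>])
  qed simp
  with mm show ?thesis by blast
qed

end


section \<open>The monad of a theory\<close>

locale smcc_cotheory = smcc V for V :: "('o, 'm) smc_category" (structure) +
  fixes K :: "('o, 'o, 'm) vcategory" and F :: "('o, 'o, 'm) vfunctor"
  assumes cotheory: "cotheory K F"
begin

lemma vfunctor_F: "vfunctor V (vself V) K F"
  and VOb_K [simp]: "VOb K = Obj V" and F_ob [simp]: "A \<in> Obj V \<Longrightarrow> VMap_ob F A = A"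
  and F_tensor: "is_tensor (vself V) W X P \<gamma> \<Longrightarrow> is_tensor K W X P (VMap_hom F X P \<cdot> \<gamma>)"
  using cotheory by (simp_all add: cotheory_def)

lemma vcategory_K [simp]: "vcategory V K"
  using vfunctor_simps(2)[OF vfunctor_F] .

lemmas [simp] = mor_gmap[OF vfunctor_F] gmap_gcomp[OF vfunctor_F]

lemma mor_K [simp]:
  assumes "mor K f"
  shows "Src f \<in> Obj V" "Tgt f \<in> Obj V"
  using mor_simps(1,2)[OF assms] by simp_all

abbreviation S where "S D \<equiv> VHom K (Unit V) D"

text \<open>
  The comparison arrow at \<open>D\<close> is postcomposition with \<open>D \<cong> [I,D]\<close>, so postcomposition with evaluation at
  the unit element is its inverse.
\<close>

lemma is_tensor_from_unit:
  assumes A [simp]: "A \<in> Obj V"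
  shows "is_tensor (vself V) A (Unit V) A (from_unit A)"
proof -
  let ?I = "Unit V"
  have j [simp]: "from_unit A \<in> Hom V A (IHom V (Unit V) A)" by (simp add: in_Hom)
  have "iso V (tensor_cmp (vself V) A ?I A (from_unit A) D)" if D [simp]: "D \<in> Obj V" for D
  proof -
    let ?t = "tensor_cmp (vself V) A ?I A (from_unit A) D"
    let ?l = "vcurry V (IHom V A (IHom V ?I D)) A D (at_unit D \<cdot> Ev V A (IHom V ?I D))"
    have eqs: "at_unit D \<cdot> from_unit D = Id V D" "from_unit D \<cdot> at_unit D = Id V (IHom V ?I D)"
      using inverse_pair_from_unit[OF D] by (simp_all add: inverse_pair_def)
    have unit: "act (at_unit D) (act (from_unit D) d) = d" if "el D d" for d
      using act_Comp[of "at_unit D" "from_unit D" d] eqs(1) that by simp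
    have counit: "act (from_unit D) (act (at_unit D) d) = d" if "el (IHom V ?I D) d" for d
      using act_Comp[of "from_unit D" "at_unit D" d] eqs(2) that by simp
    have t: "app (gmk A (IHom V ?I D) (act ?t (Body f))) a = act (from_unit D) (app f a)"
      if "mor (vself V) f" "Src f = A" "Tgt f = D" "el A a" for f a
    proof -
      have "app (gmk A (VHom (vself V) ?I D) (act ?t (Body f))) a = Body (f \<bullet> gmk ?I A (act (from_unit A) a))"
        by (rule app_tensor_cmp) (use that in simp_all)
      then have "app (gmk A (IHom V ?I D) (act ?t (Body f))) a = Body (f \<bullet> ptd A a)"
        by (simp add: ptd_def)
      then show ?thesis using that by (simp add: gcomp_ptd)
    qed
    have l: "app (gmk A D (act ?l (Body h))) a = act (at_unit D) (app h a)"
      if "mor (vself V) h" "Src h = A" "Tgt h = IHom V ?I D" "el A a" for h a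
      using that by (simp add: app_def)
    show ?thesis
      unfolding iso_def
    proof (intro exI inverse_pairI)
      show "?l \<cdot> ?t = Id V (Dom V ?t)"
      proof (rule hom_arrow_eqI[of _ "vself V" A D "IHom V A D"])
        fix f assume f [simp]: "mor (vself V) f" "Src f = A" "Tgt f = D"
        have "gmk A D (act ?l (Body (gmk A (IHom V ?I D) (act ?t (Body f))))) = f"
          by (rule mor_eqI) (simp_all add: l t unit del: gmk_simps(3))
        from arg_cong[OF this, of Body]
        show "act (?l \<cdot> ?t) (Body f) = act (Id V (Dom V ?t)) (Body f)" by simp
      qed (simp_all add: in_Hom)
      show "?t \<cdot> ?l = Id V (Cod V ?t)"
      proof (rule hom_arrow_eqI[of _ "vself V" A "IHom V ?I D" "IHom V A (IHom V ?I D)"])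
        fix h assume h [simp]: "mor (vself V) h" "Src h = A" "Tgt h = IHom V ?I D"
        have "gmk A (IHom V ?I D) (act ?t (Body (gmk A D (act ?l (Body h))))) = h"
          by (rule mor_eqI) (simp_all add: l t counit del: gmk_simps(3))
        from arg_cong[OF this, of Body]
        show "act (?t \<cdot> ?l) (Body h) = act (Id V (Cod V ?t)) (Body h)" by simp
      qed (simp_all add: in_Hom)
    qed simp_all
  qed
  then show ?thesis using j by (simp add: is_tensor_def)
qed

text \<open>
  The isomorphism \<open>K(A,D) \<cong> [A, K(I,D)]\<close>: the tensor of \<open>A\<close> with the unit, transported along \<open>F\<close>.
\<close>

definition kap :: "'o \<Rightarrow> 'o \<Rightarrow> 'm" where
  "kap A D = tensor_cmp K A (Unit V) A (VMap_hom F (Unit V) A \<cdot> from_unit A) D"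

lemma delta_in [simp]:
  "A \<in> Obj V \<Longrightarrow> VMap_hom F (Unit V) A \<cdot> from_unit A \<in> Hom V A (S A)"
  by (simp add: in_Hom vfunctor_simps[OF vfunctor_F])

lemma kap_simps [simp]:
  assumes "A \<in> Obj V" "D \<in> Obj V"
  shows "kap A D \<in> Arr V" "Dom V (kap A D) = VHom K A D" "Cod V (kap A D) = IHom V A (S D)" "iso V (kap A D)"
proof -
  show "kap A D \<in> Arr V" "Dom V (kap A D) = VHom K A D" "Cod V (kap A D) = IHom V A (S D)"
    using assms by (simp_all add: kap_def)
  show "iso V (kap A D)"
    using F_tensor[OF is_tensor_from_unit[OF assms(1)]] assms(2) by (simp add: is_tensor_def kap_def)
qed

text \<open>
  The transpose \<open>A \<rightarrow> K(I,D)\<close> of \<open>f : A \<rightarrow> D\<close>. At an element \<open>a\<close> its value is \<open>f \<circ> F a\<close> (\<open>app_hat\<close>).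
\<close>

definition hat :: "('o, 'o, 'm) gmor \<Rightarrow> ('o, 'o, 'm) gmor" where
  "hat f = gmk (Src f) (S (Tgt f)) (act (kap (Src f) (Tgt f)) (Body f))"

lemma hat_simps [simp]:
  "Src (hat f) = Src f" "Tgt (hat f) = S (Tgt f)" "mor K f \<Longrightarrow> mor (vself V) (hat f)"
  by (simp_all add: hat_def)

text \<open>An element \<open>a\<close> of \<open>A\<close>, as a morphism of \<open>K\<close> from the unit object to \<open>A\<close>.\<close>

definition kel :: "'o \<Rightarrow> ('o, 'm) elt \<Rightarrow> ('o, 'o, 'm) gmor" where
  "kel A a = gmap F (ptd A a)"

lemma kel_simps [simp]:
  "el A a \<Longrightarrow> mor K (kel A a)" "Src (kel A a) = Unit V" "el A a \<Longrightarrow> Tgt (kel A a) = A"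
  using el_Obj[of A a] by (simp_all add: kel_def)

lemma app_hat [simp]:
  assumes "mor K f" "el (Src f) a"
  shows "app (hat f) a = Body (f \<odot>\<^bsub>K\<^esub> kel (Src f) a)"
proof -
  note [simp] = vfunctor_simps[OF vfunctor_F]
  have "gmk (Unit V) (Src f) (act (VMap_hom F (Unit V) (Src f) \<cdot> from_unit (Src f)) a) = kel (Src f) a"
    using assms by (intro gmor_eqI) (simp_all add: kel_def gmap_def)
  then show ?thesis
    using assms app_tensor_cmp[of K "Src f" "Unit V" "Src f" f "Tgt f" _ a]
    by (simp add: hat_def kap_def del: act_Comp)
qed

lemma gmap_F_kel [simp]:
  "mor (vself V) f \<Longrightarrow> el (Src f) a \<Longrightarrow> A = Src f \<Longrightarrow> gmap F f \<odot>\<^bsub>K\<^esub> kel A a = kel (Tgt f) (app f a)"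
  by (simp add: kel_def gcomp_ptd flip: gmap_gcomp[OF vfunctor_F])

lemma hat_inject:
  assumes "mor K f" "mor K g" "Tgt f = Tgt g" "hat f = hat g"
  shows "f = g"
proof (rule gmor_eqI)
  show *: "Src f = Src g" using assms(4) hat_simps(1) by metis
  have "act (kap (Src g) (Tgt g)) (Body f) = act (kap (Src g) (Tgt g)) (Body g)"
    using assms(3,4) * by (simp add: hat_def gmk_def)
  then have "act (Inv V (kap (Src g) (Tgt g))) (act (kap (Src g) (Tgt g)) (Body f))
      = act (Inv V (kap (Src g) (Tgt g))) (act (kap (Src g) (Tgt g)) (Body g))" by simp
  then show "Body f = Body g" using assms * by simp
qed fact

text \<open>
  Transposition is injective, so a morphism of \<open>K\<close> is determined by its composites with the images of
  the elements of its source. This reduces equations in \<open>K\<close> to equations between elements.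
\<close>

lemma K_eqI:
  assumes "mor K f" "mor K g" "Src f = Src g" "Tgt f = Tgt g"
    and "\<And>a. el (Src g) a \<Longrightarrow> f \<odot>\<^bsub>K\<^esub> kel (Src g) a = g \<odot>\<^bsub>K\<^esub> kel (Src g) a"
  shows "f = g"
proof (rule hat_inject)
  show "hat f = hat g"
    by (rule mor_eqI) (use assms in simp_all)
qed fact+

text \<open>
  The counit at \<open>A\<close> of the adjunction between \<open>F\<close> and \<open>K(I,-)\<close>: the morphism whose transpose is the identity.
\<close>

definition eps :: "'o \<Rightarrow> ('o, 'o, 'm) gmor" where
  "eps A = gmk (S A) A (act (Inv V (kap (S A) A)) (Body (gid (vself V) (S A))))"

lemma eps_simps [simp]:
  "Src (eps A) = S A" "Tgt (eps A) = A" "A \<in> Obj V \<Longrightarrow> mor K (eps A)"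
  by (simp_all add: eps_def)

lemma hat_eps: "A \<in> Obj V \<Longrightarrow> hat (eps A) = gid (vself V) (S A)"
  by (intro gmor_eqI) (simp_all add: hat_def eps_def)

lemma eps_kel:
  assumes "mor K s" "Src s = Unit V" "A = Tgt s"
  shows "eps A \<odot>\<^bsub>K\<^esub> kel (S A) (Body s) = s"
proof (rule gmor_eqI)
  show "Body (eps A \<odot>\<^bsub>K\<^esub> kel (S A) (Body s)) = Body s"
    using app_hat[of "eps A" "Body s"] assms by (simp add: hat_eps)
qed (use assms in simp_all)

lemma eps_hat:
  assumes [simp]: "mor K f"
  shows "eps (Tgt f) \<odot>\<^bsub>K\<^esub> gmap F (hat f) = f"
  by (rule K_eqI) (simp_all add: eps_kel)

abbreviation U where "U \<equiv> vrep V K (Unit V)"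

lemma vfunctor_U: "vfunctor V K (vself V) U"
  by (simp add: vfunctor_vrep)

lemmas [simp] = mor_gmap[OF vfunctor_U] gmap_gcomp[OF vfunctor_U]

text \<open>
  The monad of this adjunction: the unit consists of the transposes of identities, the multiplication is
  the image of the counit under \<open>K(I,-)\<close>.
\<close>

definition tmonad :: "('o, 'm) vmonad" where
  "tmonad = \<lparr>Endo = vfunctor_comp V (vself V) U F,
     Eta = (\<lambda>A\<in>Obj V. kap A A \<cdot> VId K A),
     Mu = (\<lambda>A\<in>Obj V. Val (Body (gmap U (eps A))))\<rparr>"

lemma tmonad_simps [simp]:
  "Endo tmonad = vfunctor_comp V (vself V) U F"
  "A \<in> Obj V \<Longrightarrow> eta_at tmonad A = hat (gid K A)"
  "A \<in> Obj V \<Longrightarrow> mu_at tmonad A = gmap U (eps A)"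
  by (simp_all add: tmonad_def eta_at_def mu_at_def hat_def gid_def gmk_def pt_def act_def gmap_def eps_def)

lemma gmap_endo [simp]: "mor (vself V) f \<Longrightarrow> gmap (vfunctor_comp V (vself V) U F) f = gmap U (gmap F f)"
  by (rule gmap_vfunctor_comp[OF vfunctor_F vfunctor_U])

lemma app_gmap_U:
  assumes "mor K f" "mor K s" "Src s = Unit V" "Tgt s = Src f"
  shows "app (gmap U f) (Body s) = Body (f \<odot>\<^bsub>K\<^esub> s)"
  using assms by (simp add: app_gmap_vrep)

lemma eps_eta: "A \<in> Obj V \<Longrightarrow> eps A \<odot>\<^bsub>K\<^esub> gmap F (hat (gid K A)) = gid K A"
  using eps_hat[of "gid K A"] by simp

lemma eps_nat:
  assumes f [simp]: "mor K f"
  shows "eps (Tgt f) \<odot>\<^bsub>K\<^esub> gmap F (gmap U f) = f \<odot>\<^bsub>K\<^esub> eps (Src f)"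
proof (rule K_eqI)
  fix a assume "el (Src (f \<odot>\<^bsub>K\<^esub> eps (Src f))) a"
  then have a: "el (S (Src f)) a" by simp
  define s where "s = gmk (Unit V) (Src f) a"
  have s [simp]: "mor K s" "Src s = Unit V" "Tgt s = Src f" "a = Body s" using a by (simp_all add: s_def)
  show "(eps (Tgt f) \<odot>\<^bsub>K\<^esub> gmap F (gmap U f)) \<odot>\<^bsub>K\<^esub> kel (Src (f \<odot>\<^bsub>K\<^esub> eps (Src f))) a
      = (f \<odot>\<^bsub>K\<^esub> eps (Src f)) \<odot>\<^bsub>K\<^esub> kel (Src (f \<odot>\<^bsub>K\<^esub> eps (Src f))) a"
    by (simp add: eps_kel app_gmap_U)
qed simp_all

lemma vmonad_tmonad: "vmonad V (vself V) tmonad"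
  unfolding vmonad_iff
proof (intro conjI ballI allI impI)
  show "vfunctor V (vself V) (vself V) (Endo tmonad)"
    by (simp add: vfunctor_vfunctor_comp[OF vfunctor_F vfunctor_U])
  show "Eta tmonad \<in> extensional (VOb (vself V))" "Mu tmonad \<in> extensional (VOb (vself V))"
    by (simp_all add: tmonad_def)
  show "eta_at tmonad (Tgt f) \<bullet> f = gmap (Endo tmonad) f \<bullet> eta_at tmonad (Src f)"
    if [simp]: "mor (vself V) f" for f
  proof (rule mor_eqI)
    fix a assume "el (Src (gmap (Endo tmonad) f \<bullet> eta_at tmonad (Src f))) a"
    then have [simp]: "el (Src f) a" by simp
    show "app (eta_at tmonad (Tgt f) \<bullet> f) a = app (gmap (Endo tmonad) f \<bullet> eta_at tmonad (Src f)) a"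
      by (simp add: app_gmap_U)
  qed simp_all
  show "mu_at tmonad (Tgt f) \<bullet> gmap (Endo tmonad) (gmap (Endo tmonad) f)
      = gmap (Endo tmonad) f \<bullet> mu_at tmonad (Src f)" if [simp]: "mor (vself V) f" for f
    using arg_cong[OF eps_nat[of "gmap F f"], of "gmap U"] by simp
  fix A assume "A \<in> VOb (vself V)"
  then have A [simp]: "A \<in> Obj V" by simp
  show "mor (vself V) (eta_at tmonad A)" "mor (vself V) (mu_at tmonad A)" by simp_all
  show "mu_at tmonad A \<bullet> gmap (Endo tmonad) (eta_at tmonad A) = gid (vself V) (VMap_ob (Endo tmonad) A)"
    using arg_cong[OF eps_eta[of A], of "gmap U"] gmap_gid[OF vfunctor_U, of A] by simp
  show "mu_at tmonad A \<bullet> eta_at tmonad (VMap_ob (Endo tmonad) A) = gid (vself V) (VMap_ob (Endo tmonad) A)"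
  proof (rule mor_eqI)
    fix a assume "el (Src (gid (vself V) (VMap_ob (Endo tmonad) A))) a"
    then have a: "el (S A) a" by simp
    define s where "s = gmk (Unit V) A a"
    have s [simp]: "mor K s" "Src s = Unit V" "Tgt s = A" "a = Body s" using a by (simp_all add: s_def)
    show "app (mu_at tmonad A \<bullet> eta_at tmonad (VMap_ob (Endo tmonad) A)) a
        = app (gid (vself V) (VMap_ob (Endo tmonad) A)) a"
      by (simp add: app_gmap_U eps_kel)
  qed simp_all
  show "mu_at tmonad A \<bullet> gmap (Endo tmonad) (mu_at tmonad A)
      = mu_at tmonad A \<bullet> mu_at tmonad (VMap_ob (Endo tmonad) A)"
    using arg_cong[OF eps_nat[of "eps A"], of "gmap U"] by simp
qed

sublocale T: smcc_monad V tmonad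
  by (intro smcc_monad.intro smcc_axioms smcc_monad_axioms.intro vmonad_tmonad)

text \<open>
  The comparison with the Kleisli \<open>V\<close>-category is transposition. It respects composition since
  \<open>\<epsilon> \<circ> F (hat g) = g\<close> (\<open>eps_hat\<close>), and it is invertible since transposition is.
\<close>

definition cmp :: "('o, 'o, 'm) vfunctor" where
  "cmp = \<lparr>VMap_ob = (\<lambda>A\<in>Obj V. A), VMap_hom = (\<lambda>A\<in>Obj V. \<lambda>D\<in>Obj V. kap A D)\<rparr>"

lemma cmp_ob [simp]: "A \<in> Obj V \<Longrightarrow> VMap_ob cmp A = A"
  by (simp add: cmp_def)

lemma und_gmap_cmp: "mor K f \<Longrightarrow> T.und (gmap cmp f) = hat f"
  by (simp add: T.und_def hat_def gmap_def cmp_def)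

lemma hat_gcomp:
  assumes [simp]: "mor K f" "mor K g" "Src g = Tgt f"
  shows "hat (g \<odot>\<^bsub>K\<^esub> f) = gmap U (eps (Tgt g)) \<bullet> gmap U (gmap F (hat g)) \<bullet> hat f"
proof (rule mor_eqI)
  fix a assume "el (Src (gmap U (eps (Tgt g)) \<bullet> gmap U (gmap F (hat g)) \<bullet> hat f)) a"
  then have [simp]: "el (Src f) a" by simp
  have "app (gmap U (eps (Tgt g)) \<bullet> gmap U (gmap F (hat g)) \<bullet> hat f) a
      = Body ((eps (Tgt g) \<odot>\<^bsub>K\<^esub> gmap F (hat g)) \<odot>\<^bsub>K\<^esub> f \<odot>\<^bsub>K\<^esub> kel (Src f) a)"
    by (simp add: app_gmap_U)
  then show "app (hat (g \<odot>\<^bsub>K\<^esub> f)) a = app (gmap U (eps (Tgt g)) \<bullet> gmap U (gmap F (hat g)) \<bullet> hat f) a"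
    by (simp add: eps_hat del: gcomp_assoc) simp
qed simp_all

lemma vfunctor_cmp: "vfunctor V K T.kcat cmp"
proof (rule vfunctorI)
  show "VMap_ob cmp \<in> VOb K \<rightarrow>\<^sub>E VOb T.kcat" by (simp add: cmp_def)
  show "VMap_hom cmp \<in> (\<Pi>\<^sub>E A\<in>VOb K. \<Pi>\<^sub>E B\<in>VOb K.
      Hom V (VHom K A B) (VHom T.kcat (VMap_ob cmp A) (VMap_ob cmp B)))"
    by (simp add: cmp_def in_Hom)
  have m [simp]: "mor T.kcat (gmap cmp f)" if [simp]: "mor K f" for f
  proof -
    have "gmap cmp f = gmk (Src f) (Tgt f) (Body (hat f))"
      by (intro gmor_eqI) (simp_all add: gmap_def cmp_def hat_def)
    then show ?thesis by simp
  qed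
  show "gmap cmp (g \<odot>\<^bsub>K\<^esub> f) = gmap cmp g \<odot>\<^bsub>T.kcat\<^esub> gmap cmp f"
    if [simp]: "mor K f" "mor K g" "Src g = Tgt f" for f g
    by (rule T.und_eqI) (simp_all add: und_gmap_cmp hat_gcomp)
  show "gmap cmp (gid K A) = gid T.kcat (VMap_ob cmp A)" if "A \<in> VOb K" for A
    by (rule T.und_eqI) (use that in \<open>simp_all add: und_gmap_cmp\<close>)
qed simp_all

lemma cmp_F: "vfunctor_comp V (vself V) cmp F = T.kfun"
proof (rule vfunctor_eqI[OF vfunctor_vfunctor_comp[OF vfunctor_F vfunctor_cmp] T.vfunctor_kfun])
  fix f :: "('o, 'o, 'm) gmor" assume f [simp]: "mor (vself V) f"
  have "hat (gmap F f) = hat (gid K (Tgt f)) \<bullet> f"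
    by (rule mor_eqI) simp_all
  then have "gmap cmp (gmap F f) = gmap T.kfun f"
    by (intro T.und_eqI[of "gmap cmp (gmap F f)" "gmap T.kfun f"]) (simp_all add: und_gmap_cmp)
  then show "gmap (vfunctor_comp V (vself V) cmp F) f = gmap T.kfun f"
    by (simp add: gmap_vfunctor_comp[OF vfunctor_F vfunctor_cmp])
qed simp

end


section \<open>The equivalence\<close>

context smcc
begin

text \<open>
  Functoriality of the inverse can be tested after applying \<open>H\<close>, because \<open>H\<close> is invertible on hom-objects.
\<close>

lemma ex_inverse_vfunctor:
  assumes H: "vfunctor V C D H" and ob: "VOb D = VOb C" "\<And>A. A \<in> VOb C \<Longrightarrow> VMap_ob H A = A"
    and iso: "\<And>A B. A \<in> VOb C \<Longrightarrow> B \<in> VOb C \<Longrightarrow> iso V (VMap_hom H A B)"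
  shows "\<exists>H'. vfunctor V D C H' \<and> vfunctor_comp V C H' H = vfunctor_id V C \<and>
    vfunctor_comp V D H H' = vfunctor_id V D"
proof -
  note [simp] = vfunctor_simps[OF H] ob iso mor_gmap[OF H] gmap_gcomp[OF H] gmap_gid[OF H]
  have hom [simp]: "VMap_hom H A B \<in> Arr V" "Dom V (VMap_hom H A B) = VHom C A B"
    "Cod V (VMap_hom H A B) = VHom D A B" if "A \<in> VOb C" "B \<in> VOb C" for A B
    using vfunctor_simps(4-6)[OF H that] that by simp_all
  define H' where "H' = \<lparr>VMap_ob = (\<lambda>A\<in>VOb C. A),
    VMap_hom = (\<lambda>A\<in>VOb C. \<lambda>B\<in>VOb C. Inv V (VMap_hom H A B))\<rparr>"
  have [simp]: "VMap_ob H' A = A" "B \<in> VOb C \<Longrightarrow> VMap_hom H' A B = Inv V (VMap_hom H A B)"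
    if "A \<in> VOb C" for A B using that by (simp_all add: H'_def)
  have ob_D [simp]: "Src f \<in> VOb C" "Tgt f \<in> VOb C" if "mor D f" for f
    using mor_simps(1,2)[OF that] by simp_all
  have mor' [simp]: "mor C (gmap H' f)" if [simp]: "mor D f" for f
  proof -
    have "gmap H' f = gmk (Src f) (Tgt f) (act (Inv V (VMap_hom H (Src f) (Tgt f))) (Body f))"
      by (intro gmor_eqI) (simp_all add: gmap_def)
    then show ?thesis by simp
  qed
  have l: "gmap H' (gmap H f) = f" if "mor C f" for f
    using that by (intro gmor_eqI) (simp_all add: gmap_def)
  have r: "gmap H (gmap H' f) = f" if "mor D f" for f
    using that by (intro gmor_eqI) (simp_all add: gmap_def)
  have H': "vfunctor V D C H'"
  proof (rule vfunctorI)
    show "VMap_ob H' \<in> VOb D \<rightarrow>\<^sub>E VOb C" by (simp add: H'_def)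
    show "VMap_hom H' \<in> (\<Pi>\<^sub>E A\<in>VOb D. \<Pi>\<^sub>E B\<in>VOb D.
        Hom V (VHom D A B) (VHom C (VMap_ob H' A) (VMap_ob H' B)))"
      by (simp add: H'_def in_Hom)
    fix f g assume fg [simp]: "mor D f" "mor D g" "Src g = Tgt f"
    have "gmap H (gmap H' g \<odot>\<^bsub>C\<^esub> gmap H' f) = g \<odot>\<^bsub>D\<^esub> f"
      by (simp add: r)
    then show "gmap H' (g \<odot>\<^bsub>D\<^esub> f) = gmap H' g \<odot>\<^bsub>C\<^esub> gmap H' f"
      using l[of "gmap H' g \<odot>\<^bsub>C\<^esub> gmap H' f"] by simp
  next
    fix A assume "A \<in> VOb D"
    then have [simp]: "A \<in> VOb C" by simp
    show "gmap H' (gid D A) = gid C (VMap_ob H' A)"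
      using l[of "gid C A"] by simp
  qed simp_all
  moreover have "vfunctor_comp V C H' H = vfunctor_id V C"
    by (rule vfunctor_eqI[OF vfunctor_vfunctor_comp[OF H H'] vfunctor_vfunctor_id])
      (simp_all add: gmap_vfunctor_comp[OF H H'] l)
  moreover have "vfunctor_comp V D H H' = vfunctor_id V D"
    by (rule vfunctor_eqI[OF vfunctor_vfunctor_comp[OF H' H] vfunctor_vfunctor_id])
      (simp_all add: gmap_vfunctor_comp[OF H' H] r)
  ultimately show ?thesis by blast
qed

lemma theory_morphism_fop:
  assumes K: "cotheory K F" and L: "cotheory L G"
    and N: "vfunctor V K L N" and NF: "vfunctor_comp V (vself V) N F = G"
  shows "(theory_of K F, fop K N, theory_of L G) \<in> Arr (Th V)"
  using vtheory_theory_of[OF K] vtheory_theory_of[OF L] vfunctor_fop[OF N] NF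
  by (simp add: Th_def theory_morphism_theory_of[OF K L])

text \<open>
  Taking opposites turns morphisms of theories into \<open>V\<close>-functors under the base, and the following two
  lemmas transport composites and identities accordingly.
\<close>

lemma theory_morphismE:
  assumes K: "cotheory K F" and L: "cotheory L G"
    and M: "(theory_of K F, M, theory_of L G) \<in> Arr (Th V)"
  obtains N where "vfunctor V K L N" "vfunctor_comp V (vself V) N F = G" "M = fop K N"
proof
  have F: "vfunctor V (vself V) K F" and G: "vfunctor V (vself V) L G"
    using K L by (simp_all add: cotheory_def)
  have "theory_morphism V (theory_of K F) (theory_of L G) M" using M by (simp add: Th_def)
  then have M: "vfunctor V (vop V K) (vop V L) M"
    by (simp add: theory_morphism_def theory_of_def)
  show N: "vfunctor V K L (fop K M)"
    using vfunctor_fop[OF M] vfunctor_simps(2)[OF F] vfunctor_simps(2)[OF G] by simp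
  show M_eq: "M = fop K (fop K M)"
    using fop_fop[OF M] by simp
  have "fop (vself V) (vfunctor_comp V (vself V) (fop K M) F) = fop (vself V) G"
    using \<open>theory_morphism V (theory_of K F) (theory_of L G) M\<close>
    by (subst (asm) M_eq) (simp add: theory_morphism_theory_of[OF K L])
  then show "vfunctor_comp V (vself V) (fop K M) F = G"
    using fop_fop[OF vfunctor_vfunctor_comp[OF F N]] fop_fop[OF G] by metis
qed

lemma Comp_Th_fop:
  assumes "vfunctor V K L N"
  shows "Comp (Th V) (theory_of L G, fop L P, X) (theory_of K F, fop K N, theory_of L G)
    = (theory_of K F, fop K (vfunctor_comp V K P N), X)"
  by (simp add: Th_def theory_of_def fop_vfunctor_comp[OF assms])

lemma Id_Th_fop: "Id (Th V) (theory_of K F) = (theory_of K F, fop K (vfunctor_id V K), theory_of K F)"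
  by (simp add: Th_def theory_of_def fop_vfunctor_id)

definition kleisli_functor :: "(('o, 'm) vmonad, ('o, 'm) vmonad \<times> ('o \<Rightarrow> 'm) \<times> ('o, 'm) vmonad,
    ('o, 'm) vtheory, ('o, 'm) vtheory \<times> ('o, 'o, 'm) vfunctor \<times> ('o, 'm) vtheory) cat_functor" where
  "kleisli_functor = \<lparr>Map_ob = smcc_monad.kleisli V, Map_arr = (\<lambda>(M, \<alpha>, N).
     (smcc_monad.kleisli V M, fop (smcc_monad.kcat V M) (smcc_monads.kmap V M N \<alpha>), smcc_monad.kleisli V N))\<rparr>"

lemma smcc_monadI: "vmonad V (vself V) M \<Longrightarrow> smcc_monad V M"
  by (intro smcc_monad.intro smcc_axioms smcc_monad_axioms.intro)

lemma smcc_monadsI: "vmonad V (vself V) M \<Longrightarrow> vmonad V (vself V) N \<Longrightarrow> smcc_monads V M N"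
  by (intro smcc_monads.intro smcc_axioms smcc_monadI)

lemma Mnd_arrD:
  assumes "(M, \<alpha>, N) \<in> Arr (Mnd V (vself V))"
  shows "smcc_monads V M N" "monad_morphism V (vself V) M N \<alpha>"
    "vnat V (vself V) (vself V) (Endo M) (Endo N) \<alpha>"
  using assms smcc_monadsI by (auto simp: Mnd_def monad_morphism_def)

lemma cat_functor_kleisli: "cat_functor (Mnd V (vself V)) (Th V) kleisli_functor"
proof (intro cat_functor.intro category_Mnd category_Th cat_functor_axioms.intro)
  show "Map_ob kleisli_functor M \<in> Obj (Th V)" if "M \<in> Obj (Mnd V (vself V))" for M
    using smcc_monad.vtheory_kleisli[OF smcc_monadI, of M] that by (simp add: kleisli_functor_def Mnd_def Th_def)
  show "Map_arr kleisli_functor f \<in> Hom (Th V) (Map_ob kleisli_functor A) (Map_ob kleisli_functor B)" if hom: "f \<in> Hom (Mnd V (vself V)) A B" for f A B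
  proof -
    obtain \<alpha> where f: "f = (A, \<alpha>, B)" "(A, \<alpha>, B) \<in> Arr (Mnd V (vself V))"
      using hom by (auto simp: Mnd_def in_Hom)
    interpret smcc_monads V A B by (rule Mnd_arrD(1)[OF f(2)])
    note H = vfunctor_kmap[OF Mnd_arrD(2)[OF f(2)]]
    show ?thesis
      using theory_morphism_fop[OF M.cotheory_kleisli N.cotheory_kleisli H]
      by (simp add: f kleisli_functor_def in_Hom M.kleisli_def N.kleisli_def Th_def)
  qed
  show "Map_arr kleisli_functor (Id (Mnd V (vself V)) M) = Id (Th V) (Map_ob kleisli_functor M)" if "M \<in> Obj (Mnd V (vself V))" for M
  proof -
    have M: "vmonad V (vself V) M" using that by (simp add: Mnd_def)
    interpret smcc_monads V M M by (rule smcc_monadsI[OF M M])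
    have id: "(M, vnat_id (vself V) (vself V) (Endo M), M) \<in> Arr (Mnd V (vself V))"
      using category.Id_in[OF category_Mnd that] by (simp add: Mnd_def in_Hom)
    note \<alpha> = Mnd_arrD[OF id]
    have "kmap (vnat_id (vself V) (vself V) (Endo M)) = vfunctor_id V M.kcat"
    proof (rule vfunctor_eqI[OF vfunctor_kmap(1)[OF \<alpha>(2)] vfunctor_vfunctor_id[OF M.vcategory_kcat]])
      fix f assume [simp]: "mor M.kcat f"
      show "gmap (kmap (vnat_id (vself V) (vself V) (Endo M))) f = gmap (vfunctor_id V M.kcat) f"
        by (rule M.und_eqI) (simp_all add: und_gmap_kmap(1)[OF \<alpha>(3)] cpt_vnat_id)
    qed simp
    then show ?thesis
      by (simp add: kleisli_functor_def Mnd_def M.kleisli_def Id_Th_fop)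
  qed
  show "Map_arr kleisli_functor (Comp (Mnd V (vself V)) g f) = Comp (Th V) (Map_arr kleisli_functor g) (Map_arr kleisli_functor f)"
    if hom: "f \<in> Hom (Mnd V (vself V)) A B" "g \<in> Hom (Mnd V (vself V)) B C" for f g A B C
  proof -
    obtain \<alpha> \<beta> where f: "f = (A, \<alpha>, B)" "(A, \<alpha>, B) \<in> Arr (Mnd V (vself V))"
      and g: "g = (B, \<beta>, C)" "(B, \<beta>, C) \<in> Arr (Mnd V (vself V))"
      using hom by (auto simp: Mnd_def in_Hom)
    let ?c = "vnat_comp V (vself V) (vself V) (Endo A) (Endo B) (Endo C) \<beta> \<alpha>"
    have c: "(A, ?c, C) \<in> Arr (Mnd V (vself V))"
      using category.Comp_in[OF category_Mnd hom] by (simp add: f g Mnd_def in_Hom)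
    interpret f: smcc_monads V A B by (rule Mnd_arrD(1)[OF f(2)])
    interpret g: smcc_monads V B C by (rule Mnd_arrD(1)[OF g(2)])
    interpret c: smcc_monads V A C by (rule Mnd_arrD(1)[OF c])
    note Hf = f.vfunctor_kmap(1)[OF Mnd_arrD(2)[OF f(2)]] and Hg = g.vfunctor_kmap(1)[OF Mnd_arrD(2)[OF g(2)]]
      and Hc = c.vfunctor_kmap(1)[OF Mnd_arrD(2)[OF c]]
    note \<alpha> = Mnd_arrD(3)[OF f(2)] and \<beta> = Mnd_arrD(3)[OF g(2)]
    have "c.kmap ?c = vfunctor_comp V f.M.kcat (g.kmap \<beta>) (f.kmap \<alpha>)"
    proof (rule vfunctor_eqI[OF Hc vfunctor_vfunctor_comp[OF Hf Hg]])
      fix h assume h [simp]: "mor f.M.kcat h"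
      note [simp] = mor_gmap[OF Hf] mor_cpt[OF \<alpha>] mor_cpt[OF \<beta>]
      show "gmap (c.kmap ?c) h = gmap (vfunctor_comp V f.M.kcat (g.kmap \<beta>) (f.kmap \<alpha>)) h"
        by (rule g.N.und_eqI) (simp_all add: gmap_vfunctor_comp[OF Hf Hg] cpt_vnat_comp
            c.und_gmap_kmap(1)[OF Mnd_arrD(3)[OF c]] f.und_gmap_kmap(1)[OF \<alpha>] g.und_gmap_kmap(1)[OF \<beta>])
    qed simp
    then show ?thesis
      unfolding f g by (simp add: kleisli_functor_def f.M.kleisli_def f.N.kleisli_def Comp_Th_fop[OF Hf])
        (simp add: Mnd_def f.M.kleisli_def)
  qed
qed

lemma equivalence: "equivalent_categories (Th V) (Mnd V (vself V))"
proof (rule equivalent_categories_if_ff_eso[OF cat_functor_kleisli])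
  fix f g assume fg: "f \<in> Arr (Mnd V (vself V))" "g \<in> Arr (Mnd V (vself V))"
    "Dom (Mnd V (vself V)) f = Dom (Mnd V (vself V)) g" "Cod (Mnd V (vself V)) f = Cod (Mnd V (vself V)) g"
    and eq: "Map_arr kleisli_functor f = Map_arr kleisli_functor g"
  obtain M \<alpha> N \<beta> where f: "f = (M, \<alpha>, N)" and g: "g = (M, \<beta>, N)"
    using fg by (auto simp: Mnd_def)
  note \<alpha> = Mnd_arrD[OF fg(1)[unfolded f]] and \<beta> = Mnd_arrD[OF fg(2)[unfolded g]]
  interpret smcc_monads V M N by (rule \<alpha>(1))
  have "fop M.kcat (kmap \<alpha>) = fop M.kcat (kmap \<beta>)"
    using eq by (simp add: f g kleisli_functor_def)
  then have "kmap \<alpha> = kmap \<beta>"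
    using fop_fop[OF vfunctor_kmap(1)[OF \<alpha>(2)]] fop_fop[OF vfunctor_kmap(1)[OF \<beta>(2)]] by metis
  then show "f = g" using kmap_inject[OF \<alpha>(3) \<beta>(3)] by (simp add: f g)
next
  fix M N h assume MN: "M \<in> Obj (Mnd V (vself V))" "N \<in> Obj (Mnd V (vself V))"
    and h: "h \<in> Hom (Th V) (Map_ob kleisli_functor M) (Map_ob kleisli_functor N)"
  have M: "vmonad V (vself V) M" and N: "vmonad V (vself V) N" using MN by (simp_all add: Mnd_def)
  interpret smcc_monads V M N by (rule smcc_monadsI[OF M N])
  obtain Q where h_eq: "h = (M.kleisli, Q, N.kleisli)" and "(M.kleisli, Q, N.kleisli) \<in> Arr (Th V)"
    using h by (auto simp: kleisli_functor_def Th_def in_Hom)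
  then obtain P where P: "vfunctor V M.kcat N.kcat P" "vfunctor_comp V (vself V) P M.kfun = N.kfun"
    and Q: "Q = fop M.kcat P"
    unfolding M.kleisli_def N.kleisli_def
    using theory_morphismE[OF M.cotheory_kleisli N.cotheory_kleisli] by blast
  obtain \<alpha> where "monad_morphism V (vself V) M N \<alpha>" "kmap \<alpha> = P"
    using kmap_surj[OF P] by blast
  then have "(M, \<alpha>, N) \<in> Hom (Mnd V (vself V)) M N" "Map_arr kleisli_functor (M, \<alpha>, N) = h"
    using M N by (simp_all add: Mnd_def in_Hom kleisli_functor_def h_eq Q)
  then show "\<exists>f \<in> Hom (Mnd V (vself V)) M N. Map_arr kleisli_functor f = h" by blast
next
  fix T assume "T \<in> Obj (Th V)"
  then have "vtheory V T" by (simp add: Th_def)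
  then obtain K F where cot: "cotheory K F" and T: "T = theory_of K F"
    by (rule vtheory_cases)
  interpret smcc_cotheory V K F
    by (intro smcc_cotheory.intro smcc_axioms smcc_cotheory_axioms.intro cot)
  note H = vfunctor_cmp
  obtain H' where H': "vfunctor V T.kcat K H'" and l: "vfunctor_comp V K H' cmp = vfunctor_id V K"
    and r: "vfunctor_comp V T.kcat cmp H' = vfunctor_id V T.kcat"
    using ex_inverse_vfunctor[OF H] by (force simp: cmp_def)
  have H'F: "vfunctor_comp V (vself V) H' T.kfun = F"
    unfolding cmp_F[symmetric]
    using vfunctor_comp_assoc[OF vfunctor_F H H'] l vfunctor_id_comp(2)[OF vfunctor_F] by simp
  let ?u = "(T, fop K cmp, T.kleisli)" and ?v = "(T.kleisli, fop T.kcat H', T)"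
  have u: "?u \<in> Arr (Th V)" and v: "?v \<in> Arr (Th V)"
    unfolding T T.kleisli_def
    using theory_morphism_fop[OF cot T.cotheory_kleisli H cmp_F]
      theory_morphism_fop[OF T.cotheory_kleisli cot H' H'F] by simp_all
  have dc: "Dom (Th V) ?u = T" "Cod (Th V) ?u = T.kleisli" "Dom (Th V) ?v = T.kleisli" "Cod (Th V) ?v = T"
    by (simp_all add: Th_def)
  have "Comp (Th V) ?v ?u = Id (Th V) T" "Comp (Th V) ?u ?v = Id (Th V) T.kleisli"
    unfolding T T.kleisli_def by (simp_all add: Comp_Th_fop[OF H] Comp_Th_fop[OF H'] l r Id_Th_fop)
  then have "iso (Th V) ?u"
    unfolding iso_def using u v dc by (intro exI[of _ ?v] category.inverse_pairI[OF category_Th]) simp_all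
  moreover have "tmonad \<in> Obj (Mnd V (vself V))" using vmonad_tmonad by (simp add: Mnd_def)
  moreover have "?u \<in> Hom (Th V) T (Map_ob kleisli_functor tmonad)"
    using u dc by (simp add: in_Hom kleisli_functor_def)
  ultimately show "\<exists>B \<in> Obj (Mnd V (vself V)). \<exists>u \<in> Hom (Th V) T (Map_ob kleisli_functor B). iso (Th V) u"
    by blast
qed

end

theorem corollary11p10:
  fixes V :: "('o, 'm) smc_category"
  assumes "symmetric_monoidal_closed_category V"
  shows "equivalent_categories (Th V) (Mnd V (vself V))"
  using smcc.equivalence[OF smcc.intro[OF assms]] .

end
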